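(* Fix $\alpha\in(0,1]$. Let $P$ be a Borel probability measure on $\mathbb{R}^d$ supported on a compact convex set $\mathcal{X}\subset\mathbb{R}^d$ with nonempty interior (so $\mathcal{X}=\mathrm{supp}\,P$), having a Lebesgue density $\rho$ that is Lipschitz continuous and strictly positive on $\mathcal{X}$. Let $\mathcal{Y}=\{y_1,\dots,y_N\}\subset\mathbb{R}^d$ be a finite set of distinct points and let $c_0\in(0,1)$. Then there exists a constant $C>0$ depending only on $\alpha,\mathcal{X},\rho,\mathcal{Y}$ and $c_0$ such that for every probability measure $Q$ with support $\mathcal{Y}$ and masses $q_i=Q(\{y_i\})$ satisfying $\min_{1\le i\le N}q_i\ge c_0$, $$ \|T^\varepsilon-T^0\|_{(\mathcal{C}^\alpha)^*}\le C\,\max\big\{\varepsilon^{1+\alpha},\ \varepsilon^2\log^3(1/\varepsilon)\big\}\qquad\text{for all }\varepsilon\in(0,1), $$ where $T^0$ is the Brenier map and $T^\varepsilon$ the entropic map from $P$ to $Q$.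
   Context: $\|\cdot\|$ and $\langle\cdot,\cdot\rangle$ are the Euclidean norm and inner product; $\mathbb{1}_N\in\mathbb{R}^N$ is the vector of ones; $q=(q_1,\dots,q_N)^\intercal$. Brenier map. Let $z^0\in\mathbb{R}^N$ be the unique (under the stated conditions on $P$) minimizer of $z\mapsto\int\max_{1\le i\le N}(\langle x,y_i\rangle-z_i)\,dP(x)+\langle z,q\rangle$ subject to $\langle z,\mathbb{1}_N\rangle=0$. The Laguerre cells are $C_i(z)=\bigcap_{j\ne i}\{x\in\mathcal{X}:\langle y_i-y_j,x\rangle\ge z_i-z_j\}$; they partition $\mathcal{X}$ up to Lebesgue-null sets. The Brenier map is the $P$-a.e. defined map $T^0(x)=y_i$ for $x\in C_i(z^0)$, $i=1,\dots,N$. (It induces the optimal coupling in $\sup_{\pi\in\Pi(P,Q)}\int\langle x,y\rangle\,d\pi(x,y)$, where $\Pi(P,Q)$ is the set of couplings of $P$ and $Q$.) Entropic map. For $\varepsilon>0$ let $z^\varepsilon\in\mathbb{R}^N$ be the unique minimizer of $z\mapsto\int\varepsilon\log\big(\sum_{i=1}^N e^{(\langle x,y_i\rangle-z_i)/\varepsilon}\big)\,dP(x)+\langle z,q\rangle$ subject to $\langle z,\mathbb{1}_N\rangle=0$. The entropic map is $$T^\varepsilon(x)=\sum_{i=1}^N y_i\,\frac{e^{(\langle x,y_i\rangle-z_i^\varepsilon)/\varepsilon}}{\sum_{j=1}^N e^{(\langle x,y_j\rangle-z_j^\varepsilon)/\varepsilon}},\quad x\in\mathcal{X}.$$ (Equivalently,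 $T^\varepsilon(x)=\mathbb{E}_{(X,Y)\sim\pi^\varepsilon}[Y\mid X=x]$, where $\pi^\varepsilon$ is the unique maximizer of $\int\langle x,y\rangle\,d\pi-\varepsilon D_{\mathsf{KL}}(\pi\|P\otimes Q)$ over $\Pi(P,Q)$.) Norms. $\|\varphi\|_\infty=\sup_{x\in\mathcal{X}}\|\varphi(x)\|$ and $\|\varphi\|_{\mathcal{C}^\alpha}=\|\varphi\|_\infty+\sup_{x\ne y\in\mathcal{X}}\|\varphi(x)-\varphi(y)\|/\|x-y\|^\alpha$. $\mathcal{C}^\alpha=\mathcal{C}^\alpha(\mathcal{X};\mathbb{R}^d)$ is the Banach space of maps $\varphi:\mathcal{X}\to\mathbb{R}^d$ with $\|\varphi\|_{\mathcal{C}^\alpha}<\infty$, and $(\mathcal{C}^\alpha)^*$ is its topological dual with norm $\|\ell\|_{(\mathcal{C}^\alpha)^*}=\sup_{\|\varphi\|_{\mathcal{C}^\alpha}\le1}\ell(\varphi)$. A bounded measurable map $T:\mathcal{X}\to\mathbb{R}^d$ is identified with the element $\varphi\mapsto\langle\varphi,T\rangle_{L^2(P)}=\int\langle\varphi(x),T(x)\rangle\,dP(x)$ of $(\mathcal{C}^\alpha)^*$. *)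

theory Defs
  imports "HOL-Probability.Probability"
begin

text \<open>The points of the target space are a family \<open>y\<close> indexed by a finite type \<open>'n\<close> (so \<open>N = CARD('n)\<close>),
  and dual potentials are vectors \<open>z\<close> in \<open>real^'n\<close>.\<close>

definition measure_support :: "'a::topological_space measure \<Rightarrow> 'a set" where
  "measure_support M = {x. \<forall>U. open U \<longrightarrow> x \<in> U \<longrightarrow> emeasure M U > 0}"

definition masses :: "(real^'d) measure \<Rightarrow> ('n \<Rightarrow> real^'d) \<Rightarrow> real^'n" where
  "masses Q y = (\<chi> i. measure Q {y i})"

subsection \<open>Brenier map\<close>

definition semidual :: "(real^'d) measure \<Rightarrow> (real^'d) measure \<Rightarrow> ('n::finite \<Rightarrow> real^'d) \<Rightarrow> real^'n \<Rightarrow> real" where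
  "semidual P Q y z = (LINT x|P. (MAX i. x \<bullet> y i - z $ i)) + z \<bullet> masses Q y"

text \<open>When \<open>P\<close> has a density that is positive on a convex body, this problem and its entropic version below have
  unique minimizers, so \<open>arg_min\<close> involves no choice. The constant \<open>1\<close> is the vector of ones.\<close>

definition brenier_potential :: "(real^'d) measure \<Rightarrow> (real^'d) measure \<Rightarrow> ('n::finite \<Rightarrow> real^'d) \<Rightarrow> real^'n" where
  "brenier_potential P Q y = arg_min (semidual P Q y) (\<lambda>z. z \<bullet> 1 = 0)"

definition laguerre_cell :: "(real^'d) set \<Rightarrow> ('n \<Rightarrow> real^'d) \<Rightarrow> real^'n \<Rightarrow> 'n \<Rightarrow> (real^'d) set" where
  "laguerre_cell X y z i = {x \<in> X. \<forall>j. j \<noteq> i \<longrightarrow> (y i - y j) \<bullet> x \<ge> z $ i - z $ j}"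

text \<open>The cells cover \<open>X\<close> and, for distinct points, overlap only in Lebesgue-null sets. On an overlap one of the
  cells is picked; the map is Borel on \<open>X\<close> because the pick depends only on the set of cells containing \<open>x\<close>.\<close>

definition brenier_map ::
  "(real^'d) measure \<Rightarrow> (real^'d) set \<Rightarrow> (real^'d) measure \<Rightarrow> ('n::finite \<Rightarrow> real^'d) \<Rightarrow> real^'d \<Rightarrow> real^'d" where
  "brenier_map P X Q y x = y (SOME i. x \<in> laguerre_cell X y (brenier_potential P Q y) i)"

subsection \<open>Entropic map\<close>

definition entropic_semidual ::
  "(real^'d) measure \<Rightarrow> (real^'d) measure \<Rightarrow> ('n::finite \<Rightarrow> real^'d) \<Rightarrow> real \<Rightarrow> real^'n \<Rightarrow> real" where
  "entropic_semidual P Q y \<epsilon> z =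
     (LINT x|P. \<epsilon> * ln (\<Sum>i\<in>UNIV. exp ((x \<bullet> y i - z $ i) / \<epsilon>))) + z \<bullet> masses Q y"

definition entropic_potential ::
  "(real^'d) measure \<Rightarrow> (real^'d) measure \<Rightarrow> ('n::finite \<Rightarrow> real^'d) \<Rightarrow> real \<Rightarrow> real^'n" where
  "entropic_potential P Q y \<epsilon> = arg_min (entropic_semidual P Q y \<epsilon>) (\<lambda>z. z \<bullet> 1 = 0)"

definition entropic_map ::
  "(real^'d) measure \<Rightarrow> (real^'d) measure \<Rightarrow> ('n::finite \<Rightarrow> real^'d) \<Rightarrow> real \<Rightarrow> real^'d \<Rightarrow> real^'d" where
  "entropic_map P Q y \<epsilon> x =
     (let z = entropic_potential P Q y \<epsilon> in
        \<Sum>i\<in>UNIV. (exp ((x \<bullet> y i - z $ i) / \<epsilon>) / (\<Sum>j\<in>UNIV. exp ((x \<bullet> y j - z $ j) / \<epsilon>))) *\<^sub>R y i)"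

subsection \<open>Hoelder norms and the dual norm\<close>

text \<open>Maps on \<open>X\<close> are total functions of which only the values on \<open>X\<close> matter. The norms are extended-valued, and
  the Hoelder space consists of the functions of finite norm.\<close>

definition sup_norm_on :: "'a set \<Rightarrow> ('a \<Rightarrow> 'b::real_normed_vector) \<Rightarrow> ennreal" where
  "sup_norm_on X \<phi> = (SUP x\<in>X. ennreal (norm (\<phi> x)))"

definition holder_norm_on ::
  "real \<Rightarrow> 'a::real_normed_vector set \<Rightarrow> ('a \<Rightarrow> 'b::real_normed_vector) \<Rightarrow> ennreal" where
  "holder_norm_on \<alpha> X \<phi> = sup_norm_on X \<phi> +
     (SUP (x, x') \<in> {(x, x'). x \<in> X \<and> x' \<in> X \<and> x \<noteq> x'}.
        ennreal (norm (\<phi> x - \<phi> x') / norm (x - x') powr \<alpha>))"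

definition holder_dual_norm ::
  "real \<Rightarrow> 'a::real_normed_vector set \<Rightarrow> (('a \<Rightarrow> 'b::real_normed_vector) \<Rightarrow> real) \<Rightarrow> ereal" where
  "holder_dual_norm \<alpha> X l = (SUP \<phi> \<in> {\<phi>. holder_norm_on \<alpha> X \<phi> \<le> 1}. ereal (l \<phi>))"

text \<open>The functional on the Hoelder space with which a bounded measurable map \<open>T\<close> is identified. Restricting the
  integral to \<open>X\<close>, a set of full measure, keeps the integrand measurable whatever \<open>\<phi>\<close> is outside \<open>X\<close>.\<close>

definition L2_functional ::
  "'a measure \<Rightarrow> 'a set \<Rightarrow> ('a \<Rightarrow> 'b::real_inner) \<Rightarrow> ('a \<Rightarrow> 'b) \<Rightarrow> real" where
  "L2_functional P X T = (\<lambda>\<phi>. LINT x:X|P. \<phi> x \<bullet> T x)"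

end

theory Submission
  imports Defs
begin

text \<open>In fact the bound \<open>C \<epsilon>\<^sup>1\<^sup>+\<^sup>\<alpha>\<close> holds, without logarithms.

  At the Brenier potential \<open>z\<^sup>0\<close>, the difference of the softmax weight \<open>p\<^sub>i\<close> and the indicator of the cell \<open>C\<^sub>i\<close>,
  integrated against a test function, is the sum over \<open>k\<close> of the mass \<open>\<integral>\<^bsub>C k\<^esub> p\<^sub>i\<close> minus its counterpart
  \<open>\<integral>\<^bsub>C i\<^esub> p\<^sub>k\<close>. The reflection in the hyperplane between the two cells matches these two integrals up to the
  modulus of continuity of the integrand at scale \<open>\<epsilon>\<close>, on a layer of width \<open>\<epsilon>\<close>, and up to errors of order \<open>\<epsilon>\<^sup>2\<close> where a third cell or
  the boundary of \<open>X\<close> is close. Here the lower bound on the masses makes the constants uniform in \<open>Q\<close>: no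
  hyperplane between two cells cuts only a thin cap off \<open>X\<close>, and there are no near ties of three cells with collinear targets.

  Taking the constant test function shows that the entropic cell masses at \<open>z\<^sup>0\<close> differ from those at \<open>z\<^sup>\<epsilon>\<close> by
  \<open>O(\<epsilon>\<^sup>1\<^sup>+\<^sup>\<alpha>)\<close>. Splitting the indices at a gap of \<open>z\<^sup>0 - z\<^sup>\<epsilon>\<close> turns this, with a Poincare inequality on the convex set
  \<open>X\<close>, into \<open>z\<^sup>0 - z\<^sup>\<epsilon> = O(\<epsilon>\<^sup>1\<^sup>+\<^sup>\<alpha>)\<close>; and the \<open>L\<^sup>1\<close> norm of the softmax weights is Lipschitz in the potential
  at this scale, uniformly in \<open>\<epsilon>\<close>.\<close>

section \<open>Slabs, isometries and reflections\<close>

text \<open>In L^1 the softmax at temperature \<epsilon> is within order \<epsilon> of the cell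
  indicators, the mass of the layers around the facets. The extra factor \<epsilon>^\<alpha> can
  only come from cancellation. Reflection provides it: it preserves Lebesgue measure and swaps the
  roles of two cells exactly, so that only the test function times the density changes. The
  expansion is made at the Brenier potential because its cell masses are prescribed; the target
  measure enters the geometry through \<open>good\<close> alone. A cutoff at distance \<epsilon>
  log(1/\<epsilon>) from the facets would cost logarithms. Instead each exceptional set is bounded
  at every width s > 0, by K s for one near tie and K s^2 for two constraints, and the bounds are
  summed against exp(-s/\<epsilon>). The response of the masses to a change of potential is
  1/\<epsilon> times a variance. A variance of order at least \<epsilon> makes this response bounded
  below, so an error in the masses passes to the potentials without losing a power of
  \<epsilon>.\<close>

lemma slab_packing:
  fixes w v :: "'a::euclidean_space"
  assumes S: "S \<in> lmeasurable" and slab: "\<And>x. x \<in> S \<Longrightarrow> \<bar>w \<bullet> x - b\<bar> \<le> s"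
    and wv: "w \<bullet> v = 1" and s: "0 < s" "s \<le> 1"
  obtains U where "U \<in> lmeasurable" "measure lebesgue S \<le> s * measure lebesgue U"
    "\<And>u. u \<in> U \<Longrightarrow> \<exists>x\<in>S. \<exists>r. 0 \<le> r \<and> r \<le> 3 \<and> u = x + r *\<^sub>R v"
proof -
  define n where "n = nat \<lceil>1 / s\<rceil>"
  have n: "1 / s \<le> real n" "real n - 1 < 1 / s"
    unfolding n_def using s by (auto simp: le_nat_iff) linarith+
  \<comment> \<open>Since \<open>w \<bullet> v = 1\<close>, the copy \<open>T k\<close> lies within
    \<open>s\<close> of level \<open>b + 3 * k * s\<close>; the step \<open>3 * s\<close> exceeds
    the width \<open>2 * s\<close>, so the copies are disjoint. About \<open>1 / s\<close> of them
    are taken, which gives the factor \<open>s\<close> and keeps the shifts at most 3.\<close>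
  define T where "T k = (+) ((3 * real k * s) *\<^sub>R v) ` S" for k :: nat
  define U where "U = (\<Union>k<n. T k)"
  have T: "T k \<in> lmeasurable" "measure lebesgue (T k) = measure lebesgue S" for k
    unfolding T_def using S by (auto intro: measurable_translation simp: measure_translation)
  have "disjoint_family_on T {..<n}"
  proof (clarsimp simp: disjoint_family_on_def disjoint_iff T_def image_iff)
    fix k l x x' assume kl: "k \<noteq> l" and x: "x \<in> S" "x' \<in> S"
      and eq: "(3 * real k * s) *\<^sub>R v + x = (3 * real l * s) *\<^sub>R v + x'"
    from arg_cong[OF eq, of "\<lambda>u. w \<bullet> u"]
    have "3 * s * (real k - real l) = w \<bullet> x' - w \<bullet> x"
      by (simp add: inner_simps wv algebra_simps)
    moreover have "\<bar>w \<bullet> x' - w \<bullet> x\<bar> \<le> 2 * s"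
      using slab[OF x(1)] slab[OF x(2)] by linarith
    moreover have "\<bar>real k - real l\<bar> \<ge> 1" using kl by linarith
    then have "3 * s * \<bar>real k - real l\<bar> \<ge> 3 * s" using s by simp
    moreover have "\<bar>3 * s * (real k - real l)\<bar> = 3 * s * \<bar>real k - real l\<bar>" using s by (simp add: abs_mult)
    ultimately show False using s by linarith
  qed
  then have "measure lebesgue U = (\<Sum>k<n. measure lebesgue (T k))"
    unfolding U_def using fmeasurableD2[OF T(1)] fmeasurableD[OF T(1)]
    by (intro measure_finite_Union) (auto simp del: emeasure_completion)
  then have "measure lebesgue U = n * measure lebesgue S" by (simp add: T)
  then have sU: "s * measure lebesgue U = (s * n) * measure lebesgue S" by simp
  have "s * n \<ge> 1" using n(1) s by (simp add: field_simps)
  then have "measure lebesgue S \<le> s * measure lebesgue U"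
    unfolding sU using mult_right_mono[of 1 "s * n" "measure lebesgue S"] by simp
  moreover have "U \<in> lmeasurable" unfolding U_def using T by (intro fmeasurable_UN[of _ _ "cball 0 1"] fmeasurable.finite_UN) auto
  moreover have "\<exists>x\<in>S. \<exists>r. 0 \<le> r \<and> r \<le> 3 \<and> u = x + r *\<^sub>R v" if u: "u \<in> U" for u
  proof -
    obtain k x where k: "k < n" and x: "x \<in> S" "u = (3 * real k * s) *\<^sub>R v + x"
      using u by (auto simp: U_def T_def)
    have "real k < 1 / s" using k n by linarith
    then have "real k * s \<le> 1" using s by (simp add: field_simps)
    then show ?thesis using x s by (intro bexI[of _ x] exI[of _ "3 * real k * s"]) (auto simp: add.commute)
  qed
  ultimately show ?thesis using that by blast
qed

text \<open>About \<open>1 / s\<close> disjoint translates of the slice fit into one fixed ball,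
  wherever the slab lies. For \<open>s > 1\<close> the measure of the ball is already a bound of the
  right order.\<close>

lemma slab_measure_le:
  fixes w :: "'a::euclidean_space"
  assumes "w \<noteq> 0"
  shows "\<exists>K>0. \<forall>S b s. S \<in> lmeasurable \<longrightarrow> S \<subseteq> cball 0 R \<longrightarrow> 0 < s \<longrightarrow>
    (\<forall>x\<in>S. \<bar>w \<bullet> x - b\<bar> \<le> s) \<longrightarrow> measure lebesgue S \<le> K * s"
proof -
  define v where "v = (1 / (w \<bullet> w)) *\<^sub>R w"
  have wv: "w \<bullet> v = 1" using assms by (simp add: v_def)
  define K where "K = measure lebesgue (cball (0::'a) (\<bar>R\<bar> + 3 * norm v)) + 1"
  have K: "K > 0" by (simp add: K_def add_nonneg_pos)
  have bd: "measure lebesgue U \<le> K" if "U \<subseteq> cball 0 (\<bar>R\<bar> + 3 * norm v)" "U \<in> lmeasurable" for U :: "'a set"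
    unfolding K_def using measure_mono_fmeasurable[OF that(1)] that(2) by (fastforce)
  show ?thesis
  proof (intro exI[of _ K] conjI K allI impI)
    fix S b s assume S: "S \<in> lmeasurable" "S \<subseteq> cball 0 R" and s: "0 < s" and slab: "\<forall>x\<in>S. \<bar>w \<bullet> x - b\<bar> \<le> s"
    show "measure lebesgue S \<le> K * s"
    proof (cases "s \<le> 1")
      case True
      obtain U where U: "U \<in> lmeasurable" "measure lebesgue S \<le> s * measure lebesgue U"
        "\<And>u. u \<in> U \<Longrightarrow> \<exists>x\<in>S. \<exists>r. 0 \<le> r \<and> r \<le> 3 \<and> u = x + r *\<^sub>R v"
        using slab_packing[OF S(1) _ wv s True, of b] slab by blast
      have "U \<subseteq> cball 0 (\<bar>R\<bar> + 3 * norm v)"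
      proof
        fix u assume "u \<in> U"
        then obtain x r where x: "x \<in> S" "0 \<le> r" "r \<le> 3" "u = x + r *\<^sub>R v" using U(3) by blast
        have "norm u \<le> norm x + r * norm v" using x norm_triangle_ineq[of x "r *\<^sub>R v"] by simp
        moreover have "norm x \<le> \<bar>R\<bar>" using x S by force
        moreover have "r * norm v \<le> 3 * norm v" using x by (intro mult_right_mono) auto
        ultimately show "u \<in> cball 0 (\<bar>R\<bar> + 3 * norm v)" by simp
      qed
      then have "s * measure lebesgue U \<le> s * K" using bd U s by (intro mult_left_mono) auto
      then show ?thesis using U(2) by (simp add: mult.commute)
    next
      case False
      have "S \<subseteq> cball 0 (\<bar>R\<bar> + 3 * norm v)"
      proof
        fix x assume "x \<in> S"
        then have "norm x \<le> \<bar>R\<bar>" using S by force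
        then show "x \<in> cball 0 (\<bar>R\<bar> + 3 * norm v)"
          using add_increasing2[of "3 * norm v" "norm x" "\<bar>R\<bar>"] by simp
      qed
      then have "measure lebesgue S \<le> K" using bd S by auto
      also have "\<dots> \<le> K * s" using False K by simp
      finally show ?thesis .
    qed
  qed
qed

text \<open>\<open>indep\<close> is strictness in Cauchy-Schwarz, so some \<open>v\<close> has
  \<open>w \<bullet> v = 1\<close> and \<open>w' \<bullet> v = 0\<close>. Packing along
  \<open>v\<close> stays in the second slab, whose bound of order \<open>s\<close> multiplies the
  factor \<open>s\<close> of the packing.\<close>

lemma double_slab_measure_le:
  fixes w w' :: "'a::euclidean_space"
  assumes indep: "(w \<bullet> w')\<^sup>2 \<noteq> (w \<bullet> w) * (w' \<bullet> w')"
  shows "\<exists>K>0. \<forall>S b b' s. S \<in> lmeasurable \<longrightarrow> S \<subseteq> cball 0 R \<longrightarrow> 0 < s \<longrightarrow>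
    (\<forall>x\<in>S. \<bar>w \<bullet> x - b\<bar> \<le> s \<and> \<bar>w' \<bullet> x - b'\<bar> \<le> s) \<longrightarrow> measure lebesgue S \<le> K * s\<^sup>2"
proof -
  define D where "D = (w \<bullet> w) * (w' \<bullet> w') - (w \<bullet> w')\<^sup>2"
  have D: "D \<noteq> 0" using indep by (simp add: D_def)
  define v where "v = (1 / D) *\<^sub>R ((w' \<bullet> w') *\<^sub>R w - (w \<bullet> w') *\<^sub>R w')"
  have "w \<bullet> v = (1 / D) * ((w' \<bullet> w') * (w \<bullet> w) - (w \<bullet> w') * (w \<bullet> w'))"
    unfolding v_def by (simp add: inner_diff_right)
  also have "\<dots> = (1 / D) * D" by (simp add: D_def power2_eq_square mult.commute)
  finally have "w \<bullet> v = (1 / D) * D" .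
  then have wv: "w \<bullet> v = 1" using D by simp
  have wv': "w' \<bullet> v = 0"
    by (simp add: v_def inner_diff_right inner_commute[of w' w])
  have "w' \<noteq> 0" using indep by auto
  from slab_measure_le[OF this, of "\<bar>R\<bar> + 3 * norm v"] obtain K where K: "K > 0"
    "\<And>S b s. S \<in> lmeasurable \<Longrightarrow> S \<subseteq> cball 0 (\<bar>R\<bar> + 3 * norm v) \<Longrightarrow> 0 < s \<Longrightarrow>
     (\<forall>x\<in>S. \<bar>w' \<bullet> x - b\<bar> \<le> s) \<Longrightarrow> measure lebesgue S \<le> K * s" by metis
  define K' where "K' = K + measure lebesgue (cball (0::'a) R)"
  have K': "K \<le> K'" "measure lebesgue (cball (0::'a) R) \<le> K'" "K' > 0"
    using K(1) by (auto simp: K'_def add_pos_nonneg)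
  show ?thesis
  proof (intro exI[of _ K'] conjI allI impI K')
    fix S b b' s assume S: "S \<in> lmeasurable" "S \<subseteq> cball 0 R" and s: "0 < s"
      and slab: "\<forall>x\<in>S. \<bar>w \<bullet> x - b\<bar> \<le> s \<and> \<bar>w' \<bullet> x - b'\<bar> \<le> s"
    show "measure lebesgue S \<le> K' * s\<^sup>2"
    proof (cases "s \<le> 1")
      case True
      obtain U where U: "U \<in> lmeasurable" "measure lebesgue S \<le> s * measure lebesgue U"
        "\<And>u. u \<in> U \<Longrightarrow> \<exists>x\<in>S. \<exists>r. 0 \<le> r \<and> r \<le> 3 \<and> u = x + r *\<^sub>R v"
        using slab_packing[OF S(1) _ wv s True, of b] slab by blast
      have "measure lebesgue U \<le> K * s"
      proof (rule K(2)[OF U(1) _ s, of b'])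
        show "U \<subseteq> cball 0 (\<bar>R\<bar> + 3 * norm v)"
        proof
          fix u assume "u \<in> U"
          then obtain x r where x: "x \<in> S" "0 \<le> r" "r \<le> 3" "u = x + r *\<^sub>R v" using U(3) by blast
          have "norm u \<le> norm x + r * norm v" using x norm_triangle_ineq[of x "r *\<^sub>R v"] by simp
          moreover have "norm x \<le> \<bar>R\<bar>" using x S by force
          moreover have "r * norm v \<le> 3 * norm v" using x by (intro mult_right_mono) auto
          ultimately show "u \<in> cball 0 (\<bar>R\<bar> + 3 * norm v)" by simp
        qed
        show "\<forall>u\<in>U. \<bar>w' \<bullet> u - b'\<bar> \<le> s"
          using U(3) slab by (fastforce simp: inner_simps wv')
      qed
      also have "\<dots> \<le> K' * s" using K' s by simp
      finally have "s * measure lebesgue U \<le> s * (K' * s)" using s by simp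
      then show ?thesis using U(2) by (simp add: power2_eq_square algebra_simps)
    next
      case False
      have "measure lebesgue S \<le> measure lebesgue (cball (0::'a) R)"
        using S by (intro measure_mono_fmeasurable) auto
      also have "\<dots> \<le> K' * 1" using K' by simp
      also have "\<dots> \<le> K' * s\<^sup>2" using False K' by (intro mult_left_mono) auto
      finally show ?thesis .
    qed
  qed
qed

text \<open>Uniqueness of Haar measure: both sides of the exchange formula \<open>\<mu> A * \<lambda> B = \<mu> B * \<lambda> A\<close> are read
  off from \<open>\<integral>\<integral> 1\<^sub>A(x) 1\<^sub>B(x + y)\<close>; the unit ball identifies the constant.\<close>

lemma lborel_distr_isometry:
  fixes f :: "'a::euclidean_space \<Rightarrow> 'a"
  assumes f: "orthogonal_transformation f"
  shows "distr lborel borel f = lborel"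
proof -
  have lin: "linear f" and nf: "\<And>x. norm (f x) = norm x"
    using f orthogonal_transformation by blast+
  have [measurable]: "f \<in> borel_measurable borel"
    using lin by (intro borel_measurable_continuous_onI linear_continuous_on linear_conv_bounded_linear[THEN iffD1])
  have surj: "surj f" using f orthogonal_transformation_surj by blast
  define \<mu> where "\<mu> = distr lborel borel f"
  have [simp]: "sets \<mu> = sets borel" "space \<mu> = UNIV" by (auto simp: \<mu>_def)
  have [measurable_cong]: "sets \<mu> = sets borel" by simp
  have muA: "emeasure \<mu> A = emeasure lborel (f -` A)" if "A \<in> sets borel" for A
    using that unfolding \<mu>_def by (subst emeasure_distr) auto
  have ball: "emeasure \<mu> (ball 0 r) = emeasure lborel (ball (0::'a) r)" for r
  proof -
    have "f -` ball 0 r = ball 0 r" by (auto simp: nf)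
    then show ?thesis by (subst muA) auto
  qed
  interpret mu: sigma_finite_measure \<mu>
  proof
    show "\<exists>A. countable A \<and> A \<subseteq> sets \<mu> \<and> \<Union>A = space \<mu> \<and> (\<forall>a\<in>A. emeasure \<mu> a \<noteq> \<infinity>)"
    proof (intro exI[of _ "range (\<lambda>n::nat. ball 0 (real n))"] conjI ballI)
      show "\<Union>(range (\<lambda>n::nat. ball 0 (real n))) = space \<mu>"
        by (auto simp: dist_norm reals_Archimedean2)
      show "emeasure \<mu> a \<noteq> \<infinity>" if a: "a \<in> range (\<lambda>n::nat. ball 0 (real n))" for a
      proof -
        obtain n :: nat where "a = ball 0 (real n)" using a by auto
        then show ?thesis using emeasure_lborel_ball_finite[of "0::'a" "real n"] by (simp add: ball)
      qed
    qed auto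
  qed
  interpret pair_sigma_finite lborel \<mu> ..
  have mu_shift: "(\<integral>\<^sup>+x. h (x + y) \<partial>\<mu>) = (\<integral>\<^sup>+x. h x \<partial>\<mu>)" if [measurable]: "h \<in> borel_measurable borel" for h y
  proof -
    \<comment> \<open>A shift by \<open>y = f a\<close> after \<open>f\<close> is a shift by
      \<open>a\<close> before it; so \<open>\<mu>\<close> inherits translation invariance.\<close>
    obtain a where a: "f a = y" using surj by (metis surjD)
    have "(\<integral>\<^sup>+x. h (x + y) \<partial>\<mu>) = (\<integral>\<^sup>+x. h (f (a + x)) \<partial>lborel)"
      unfolding \<mu>_def by (subst nn_integral_distr) (auto simp: a linear_add[OF lin] add.commute)
    also have "\<dots> = (\<integral>\<^sup>+x. h (f x) \<partial>distr lborel borel ((+) a))"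
      by (subst nn_integral_distr) auto
    also have "\<dots> = (\<integral>\<^sup>+x. h x \<partial>\<mu>)"
      unfolding \<mu>_def lborel_distr_plus by (subst nn_integral_distr) auto
    finally show ?thesis .
  qed
  have lb_shift: "(\<integral>\<^sup>+x. h (x + y) \<partial>lborel) = (\<integral>\<^sup>+x. h x \<partial>lborel)" if [measurable]: "h \<in> borel_measurable borel" for h and y :: 'a
  proof -
    have "(\<integral>\<^sup>+x. h (x + y) \<partial>lborel) = (\<integral>\<^sup>+x. h x \<partial>distr lborel borel ((+) y))"
      by (subst nn_integral_distr) (auto simp: add.commute)
    then show ?thesis by (simp add: lborel_distr_plus)
  qed
  have lb_neg: "(\<integral>\<^sup>+y. h (x - y) \<partial>lborel) = (\<integral>\<^sup>+x. h x \<partial>lborel)" if [measurable]: "h \<in> borel_measurable borel" for h and x :: 'a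
  proof -
    have "(\<integral>\<^sup>+x. h x \<partial>lborel) = (\<integral>\<^sup>+y. h y \<partial>density (distr lborel borel (\<lambda>y. x + (-1) *\<^sub>R y)) (\<lambda>_. 1))"
      using lborel_affine[of "-1" x] by simp
    also have "\<dots> = (\<integral>\<^sup>+y. h (x - y) \<partial>lborel)"
      by (subst density_1, subst nn_integral_distr) auto
    finally show ?thesis by simp
  qed
  have exch: "emeasure \<mu> A * emeasure lborel B = emeasure \<mu> B * emeasure lborel A"
    if [measurable]: "A \<in> sets borel" "B \<in> sets borel" for A B
  proof -
    let ?a = "indicator A :: 'a \<Rightarrow> ennreal" and ?b = "indicator B :: 'a \<Rightarrow> ennreal"
    have "emeasure \<mu> A * emeasure lborel B = (\<integral>\<^sup>+x. ?a x * (\<integral>\<^sup>+y. ?b (y + x) \<partial>lborel) \<partial>\<mu>)"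
      by (simp add: lb_shift nn_integral_multc)
    also have "\<dots> = (\<integral>\<^sup>+x. (\<integral>\<^sup>+y. ?a x * ?b (y + x) \<partial>lborel) \<partial>\<mu>)"
      by (simp add: nn_integral_cmult)
    also have "\<dots> = (\<integral>\<^sup>+y. (\<integral>\<^sup>+x. ?a x * ?b (y + x) \<partial>\<mu>) \<partial>lborel)"
      by (rule Fubini') measurable
    also have "\<dots> = (\<integral>\<^sup>+y. (\<integral>\<^sup>+x. (\<lambda>x. ?a (x - y) * ?b x) (x + y) \<partial>\<mu>) \<partial>lborel)"
      by (simp add: add.commute)
    also have "\<dots> = (\<integral>\<^sup>+y. (\<integral>\<^sup>+x. ?a (x - y) * ?b x \<partial>\<mu>) \<partial>lborel)"
      by (subst mu_shift) auto
    also have "\<dots> = (\<integral>\<^sup>+x. (\<integral>\<^sup>+y. ?a (x - y) * ?b x \<partial>lborel) \<partial>\<mu>)"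
      by (rule Fubini'[symmetric]) measurable
    also have "\<dots> = emeasure \<mu> B * emeasure lborel A"
      by (simp add: nn_integral_multc lb_neg nn_integral_cmult mult.commute)
    finally show ?thesis .
  qed
  have "emeasure \<mu> A = emeasure lborel A" if A: "A \<in> sets borel" for A
  proof -
    let ?m = "emeasure lborel (ball (0::'a) 1)"
    have "?m \<noteq> 0" "?m \<noteq> \<top>"
      using emeasure_lborel_ball_finite[of 0 1] content_ball_pos[of 1 "0::'a"]
      by (auto simp: emeasure_eq_ennreal_measure less_top[symmetric] measure_def)
    moreover have "emeasure \<mu> A * ?m = emeasure lborel A * ?m"
      using exch[OF A, of "ball 0 1"] by (simp add: ball mult.commute)
    ultimately show ?thesis
      by (metis ennreal_mult_divide_eq)
  qed
  then show ?thesis unfolding \<mu>_def[symmetric] by (intro measure_eqI) auto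
qed


section \<open>Reflection in a hyperplane\<close>

definition reflect :: "'a::euclidean_space \<Rightarrow> real \<Rightarrow> 'a \<Rightarrow> 'a" where
  "reflect w b x = x - (2 * (w \<bullet> x - b) / (w \<bullet> w)) *\<^sub>R w"

lemma inner_reflect: "w \<noteq> 0 \<Longrightarrow> w \<bullet> reflect w b x - b = - (w \<bullet> x - b)"
  by (simp add: reflect_def inner_diff_right)

lemma reflect_reflect [simp]: "w \<noteq> 0 \<Longrightarrow> reflect w b (reflect w b x) = x"
proof -
  assume "w \<noteq> 0"
  then have "reflect w b (reflect w b x) = reflect w b x + (2 * (w \<bullet> x - b) / (w \<bullet> w)) *\<^sub>R w"
    unfolding reflect_def[of w b "reflect w b x"] inner_reflect[OF \<open>w \<noteq> 0\<close>]
    by (simp only: mult_minus_right minus_divide_left[symmetric] scaleR_minus_left diff_minus_eq_add)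
  then show ?thesis by (simp add: reflect_def)
qed

lemma norm_reflect_diff: "w \<noteq> 0 \<Longrightarrow> norm (reflect w b x - x) = 2 * \<bar>w \<bullet> x - b\<bar> / norm w"
proof -
  assume "w \<noteq> 0"
  have "norm (reflect w b x - x) = \<bar>2 * (w \<bullet> x - b)\<bar> / (norm w * norm w) * norm w"
    unfolding reflect_def by (simp add: power2_norm_eq_inner[symmetric] power2_eq_square)
  then show ?thesis using \<open>w \<noteq> 0\<close> unfolding abs_mult by simp
qed

lemma measurable_reflect [measurable]: "reflect w b \<in> borel_measurable borel"
  unfolding reflect_def[abs_def] by measurable

lemma lborel_distr_reflect:
  assumes "w \<noteq> 0"
  shows "distr lborel borel (reflect w b) = lborel"
proof -
  let ?a = "(2 * b / (w \<bullet> w)) *\<^sub>R w"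
  have "orthogonal_transformation (reflect w 0)"
  proof -
    have "linear (reflect w 0)"
      by (rule linearI) (simp_all add: reflect_def inner_simps algebra_simps add_divide_distrib)
    moreover have "reflect w 0 x \<bullet> reflect w 0 y = x \<bullet> y" for x y
      using assms by (simp add: reflect_def inner_simps inner_commute)
    ultimately show ?thesis by (simp add: orthogonal_transformation_def)
  qed
  then have "distr lborel borel (reflect w 0) = lborel" by (rule lborel_distr_isometry)
  then have "lborel = distr (distr lborel borel (reflect w 0)) borel ((+) ?a)"
    by (simp add: lborel_distr_plus)
  also have "\<dots> = distr lborel borel ((+) ?a \<circ> reflect w 0)"
    by (rule distr_distr) auto
  also have "(+) ?a \<circ> reflect w 0 = reflect w b"
    by (auto simp: fun_eq_iff reflect_def algebra_simps diff_divide_distrib)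
  finally show ?thesis ..
qed

text \<open>The line through a bad point \<open>x\<close> in direction \<open>w\<close> leaves \<open>X\<close> between the levels \<open>s\<close> and \<open>- s\<close>.
  The union \<open>E r\<close> of all lines meeting \<open>X\<close> below level \<open>r\<close>, cut to the slab, therefore contains \<open>x\<close> for
  \<open>r = s\<close> but not for \<open>r = - s\<close>. A homothety about the deep point \<open>x0\<close> with ratio \<open>1 - O(s)\<close> maps
  \<open>E s\<close> into \<open>E (- s)\<close>, so the difference of the two has measure \<open>O(s)\<close> times that of the slab.\<close>

lemma reflection_boundary_layer:
  fixes w :: "'a::euclidean_space"
  assumes X: "compact X" "convex X" and w: "w \<noteq> 0" and c: "0 < c"
  shows "\<exists>K>0. \<forall>b s. (\<exists>x\<in>X. w \<bullet> x - b \<le> - c) \<longrightarrow> 0 < s \<longrightarrow>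
    measure lebesgue {x \<in> X. 0 \<le> w \<bullet> x - b \<and> w \<bullet> x - b \<le> s \<and> reflect w b x \<notin> X} \<le> K * s\<^sup>2"
proof -
  obtain R where R: "R > 0" "\<And>x. x \<in> X \<Longrightarrow> norm x \<le> R"
    using compact_imp_bounded[OF X(1)] by (auto simp: bounded_pos)
  \<comment> \<open>Two points of \<open>X\<close> on a line in direction \<open>w\<close> differ by
    a multiple of \<open>w\<close> with coefficient at most \<open>M\<close> in absolute value.
    Bounding the coefficient in \<open>E\<close> below makes \<open>E r\<close> compact, hence
    measurable.\<close>
  define M where "M = 2 * R / norm w"
  obtain K where K: "K > 0" "\<And>S b s. S \<in> lmeasurable \<Longrightarrow> S \<subseteq> cball 0 (3 * R) \<Longrightarrow> 0 < s \<Longrightarrow>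
     (\<forall>x\<in>S. \<bar>w \<bullet> x - b\<bar> \<le> s) \<Longrightarrow> measure lebesgue S \<le> K * s"
    using slab_measure_le[OF w, of "3 * R"] by metis
  define K' where "K' = measure lebesgue X / c\<^sup>2 + DIM('a) * (2 / c) * K"
  have K': "K' > 0" using K c by (simp add: K'_def add_nonneg_pos)
  show ?thesis
  proof (intro exI[of _ K'] conjI allI impI K', elim bexE)
    fix b s x0 assume x0: "x0 \<in> X" "w \<bullet> x0 - b \<le> - c" and s: "(0::real) < s"
    define t where "t x = w \<bullet> x - b" for x
    define B where "B = {x \<in> X. 0 \<le> w \<bullet> x - b \<and> w \<bullet> x - b \<le> s \<and> reflect w b x \<notin> X}"
    have X_b: "X \<in> sets borel" using X by (simp add: compact_imp_closed)
    have "B = (X \<inter> {x. 0 \<le> w \<bullet> x - b \<and> w \<bullet> x - b \<le> s}) - (reflect w b -` X \<inter> space borel)"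
      by (auto simp: B_def)
    moreover have "reflect w b -` X \<inter> space borel \<in> sets borel"
      by (rule measurable_sets[OF measurable_reflect X_b])
    ultimately have "B \<in> sets borel" using X_b by (auto intro!: sets.Diff sets.Int)
    then have B_m: "B \<in> sets lebesgue" by simp
    have Xl: "X \<in> lmeasurable" using X by (simp add: lmeasurable_compact)
    consider "B = {}" | "s \<ge> c" | x1 where "s < c" "x1 \<in> B" by fastforce
    then have "measure lebesgue B \<le> K' * s\<^sup>2"
    proof cases
      case 1 then show ?thesis using K' by simp
    next
      case 2
      have "measure lebesgue B \<le> measure lebesgue X"
        using Xl B_m by (intro measure_mono_fmeasurable) (auto simp: B_def)
      also have "\<dots> = measure lebesgue X / c\<^sup>2 * c\<^sup>2" using c by simp
      also have "\<dots> \<le> K' * s\<^sup>2"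
        unfolding K'_def using 2 c K by (intro mult_mono power_mono) auto
      finally show ?thesis .
    next
      case 3
      define E where "E r = {x. 0 \<le> t x \<and> t x \<le> s \<and> (\<exists>\<rho>. \<bar>\<rho>\<bar> \<le> M \<and> x - \<rho> *\<^sub>R w \<in> X \<and> t (x - \<rho> *\<^sub>R w) \<le> r)}" for r
      have E_sub: "E r \<subseteq> cball 0 (3 * R)" for r
      proof
        fix x assume "x \<in> E r"
        then obtain \<rho> where \<rho>: "\<bar>\<rho>\<bar> \<le> M" "x - \<rho> *\<^sub>R w \<in> X" by (auto simp: E_def)
        have "norm x \<le> norm (x - \<rho> *\<^sub>R w) + \<bar>\<rho>\<bar> * norm w"
          using norm_triangle_ineq[of "x - \<rho> *\<^sub>R w" "\<rho> *\<^sub>R w"] by simp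
        moreover have "\<bar>\<rho>\<bar> * norm w \<le> M * norm w" using \<rho> by (intro mult_right_mono) auto
        moreover have "M * norm w = 2 * R" using w by (simp add: M_def)
        ultimately show "x \<in> cball 0 (3 * R)" using R(2)[OF \<rho>(2)] by simp
      qed
      have E_c: "compact (E r)" for r
      proof -
        have "E r = {x. 0 \<le> t x \<and> t x \<le> s} \<inter> (\<lambda>(\<rho>, y). y + \<rho> *\<^sub>R w) ` ({-M..M} \<times> (X \<inter> {x. t x \<le> r}))"
        proof (intro set_eqI iffI)
          fix x assume "x \<in> E r"
          then obtain \<rho> where \<rho>: "\<bar>\<rho>\<bar> \<le> M" "x - \<rho> *\<^sub>R w \<in> X" "t (x - \<rho> *\<^sub>R w) \<le> r" "0 \<le> t x" "t x \<le> s"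
            by (auto simp: E_def)
          then show "x \<in> {x. 0 \<le> t x \<and> t x \<le> s} \<inter> (\<lambda>(\<rho>, y). y + \<rho> *\<^sub>R w) ` ({-M..M} \<times> (X \<inter> {x. t x \<le> r}))"
            by (auto intro!: image_eqI[of _ _ "(\<rho>, x - \<rho> *\<^sub>R w)"])
        next
          fix x assume "x \<in> {x. 0 \<le> t x \<and> t x \<le> s} \<inter> (\<lambda>(\<rho>, y). y + \<rho> *\<^sub>R w) ` ({-M..M} \<times> (X \<inter> {x. t x \<le> r}))"
          then obtain \<rho> y where "0 \<le> t x" "t x \<le> s" "x = y + \<rho> *\<^sub>R w" "\<bar>\<rho>\<bar> \<le> M" "y \<in> X" "t y \<le> r"
            by auto
          then show "x \<in> E r" by (auto simp: E_def intro!: exI[of _ \<rho>])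
        qed
        moreover have "compact ((\<lambda>(\<rho>, y). y + \<rho> *\<^sub>R w) ` ({-M..M} \<times> (X \<inter> {x. t x \<le> r})))"
          using X by (intro compact_continuous_image compact_Times compact_Int_closed)
            (auto simp: t_def split_beta intro!: continuous_intros closed_Collect_le)
        moreover have "closed {x. 0 \<le> t x \<and> t x \<le> s}"
          unfolding t_def by (intro closed_Collect_conj closed_Collect_le continuous_intros)
        ultimately show ?thesis by (simp add: closed_Int_compact)
      qed
      then have E_l: "E r \<in> lmeasurable" for r by (rule lmeasurable_compact)
      have "B \<subseteq> E s - E (- s)"
      proof
        fix x assume x: "x \<in> B"
        then have xX: "x \<in> X" and tx: "0 \<le> t x" "t x \<le> s" and rx: "reflect w b x \<notin> X"
          by (auto simp: B_def t_def)
        have "M \<ge> 0" using R by (simp add: M_def)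
        then have "x \<in> E s" using xX tx by (auto simp: E_def intro!: exI[of _ 0])
        moreover have "x \<notin> E (- s)"
        proof
          assume "x \<in> E (- s)"
          then obtain \<rho> where \<rho>: "x - \<rho> *\<^sub>R w \<in> X" "t (x - \<rho> *\<^sub>R w) \<le> - s" by (auto simp: E_def)
          have "t (x - \<rho> *\<^sub>R w) = t x - \<rho> * (w \<bullet> w)" by (simp add: t_def inner_diff_right)
          then have ge: "\<rho> * (w \<bullet> w) \<ge> 2 * t x" using \<rho>(2) tx by linarith
          have ww: "w \<bullet> w > 0" using w by simp
          show False
          proof (cases "t x = 0")
            case True
            then have "reflect w b x = x" by (simp add: reflect_def t_def)
            then show False using rx xX by simp
          next
            case False
            then have tpos: "t x > 0" using tx by simp
            then have \<rho>pos: "\<rho> > 0" using ge ww mult_nonpos_nonneg[of \<rho> "w \<bullet> w"] by linarith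
            \<comment> \<open>The position of the reflected point on the segment from
              \<open>x\<close> to \<open>x - \<rho> *\<^sub>R w\<close>; convexity would put that
              point into \<open>X\<close>.\<close>
            define l where "l = 2 * t x / (\<rho> * (w \<bullet> w))"
            have l: "0 \<le> l" "l \<le> 1" using ge tpos \<rho>pos ww by (auto simp: l_def)
            have "(1 - l) *\<^sub>R x + l *\<^sub>R (x - \<rho> *\<^sub>R w) \<in> X"
              using X(2) xX \<rho>(1) l by (auto intro: convexD)
            also have "(1 - l) *\<^sub>R x + l *\<^sub>R (x - \<rho> *\<^sub>R w) = x - (l * \<rho>) *\<^sub>R w"
              by (simp add: algebra_simps)
            also have "l * \<rho> = 2 * t x / (w \<bullet> w)" using \<rho>pos by (simp add: l_def)
            finally show False using rx by (simp add: reflect_def t_def)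
          qed
        qed
        ultimately show "x \<in> E s - E (- s)" by blast
      qed
      then have "measure lebesgue B \<le> measure lebesgue (E s - E (- s))"
        using B_m E_l by (intro measure_mono_fmeasurable fmeasurable.Diff) auto
      also have "E (- s) \<subseteq> E s" using s by (force simp: E_def)
      then have "measure lebesgue (E s - E (- s)) = measure lebesgue (E s) - measure lebesgue (E (- s))"
        using E_l by (intro measurable_measure_Diff) auto
      also have "\<dots> \<le> DIM('a) * (2 * s / c) * measure lebesgue (E s)"
      proof -
        \<comment> \<open>Solves \<open>q * (c + s) - c = - s\<close>: a point at level at most
          \<open>s\<close>, pulled towards the point at level at most \<open>- c\<close>, ends at
          level at most \<open>- s\<close>.\<close>
        define q where "q = (c - s) / (c + s)"
        have q: "0 < q" "q \<le> 1" "1 - q \<le> 2 * s / c"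
          using s c 3(1) by (auto simp: q_def field_simps)
        \<comment> \<open>A shift along \<open>w\<close> stays on the same line. This one resets the
          level of \<open>A x\<close> to \<open>q * t x\<close>, so that the image remains in the
          slab.\<close>
        define \<kappa> where "\<kappa> = - (1 - q) * t x0 / (w \<bullet> w)"
        have "\<bar>t x0\<bar> \<le> t x1 - t x0" using x0 3 c by (auto simp: B_def t_def)
        also have "\<dots> = w \<bullet> (x1 - x0)" by (simp add: t_def inner_diff_right)
        also have "\<dots> \<le> norm w * norm (x1 - x0)" by (rule norm_cauchy_schwarz)
        also have "\<dots> \<le> norm w * (2 * R)"
          using R(2)[OF x0(1)] R(2)[of x1] 3(2) norm_triangle_ineq4[of x1 x0]
          by (intro mult_left_mono) (auto simp: B_def)
        finally have "\<bar>t x0\<bar> / (w \<bullet> w) \<le> M"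
          using w by (simp add: M_def field_simps power2_norm_eq_inner[symmetric] power2_eq_square)
        then have \<kappa>: "\<bar>\<kappa>\<bar> \<le> (1 - q) * M"
          unfolding \<kappa>_def using q mult_left_mono[of "\<bar>t x0\<bar> / (w \<bullet> w)" M "1 - q"] by (simp add: abs_mult)
        define A where "A x = q *\<^sub>R x + ((1 - q) *\<^sub>R x0 + \<kappa> *\<^sub>R w)" for x
        have t_lin: "t (q *\<^sub>R x + (1 - q) *\<^sub>R x0) = q * t x + (1 - q) * t x0" for x
          by (simp add: t_def inner_simps algebra_simps)
        have "t (A x) = t (q *\<^sub>R x + (1 - q) *\<^sub>R x0) + \<kappa> * (w \<bullet> w)" for x
          by (simp add: A_def t_def inner_simps)
        moreover have "\<kappa> * (w \<bullet> w) = - (1 - q) * t x0" using w by (simp add: \<kappa>_def)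
        ultimately have tA: "t (A x) = q * t x" for x by (simp only: t_lin)
        have "A ` E s \<subseteq> E (- s)"
        proof clarify
          fix x assume "x \<in> E s"
          then obtain \<rho> where tx: "0 \<le> t x" "t x \<le> s" and \<rho>: "\<bar>\<rho>\<bar> \<le> M" "x - \<rho> *\<^sub>R w \<in> X" "t (x - \<rho> *\<^sub>R w) \<le> s"
            by (auto simp: E_def)
          let ?y = "q *\<^sub>R (x - \<rho> *\<^sub>R w) + (1 - q) *\<^sub>R x0"
          have yX: "?y \<in> X" using X(2) x0(1) \<rho>(2) q by (auto intro: convexD)
          have "t ?y \<le> q * s + (1 - q) * (- c)"
            unfolding t_lin using q \<rho>(3) x0(2) by (intro add_mono mult_left_mono) (auto simp: t_def)
          also have "\<dots> = q * (c + s) - c" by (simp add: algebra_simps)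
          also have "\<dots> = - s" using s c by (simp add: q_def)
          finally have ty: "t ?y \<le> - s" .
          have eq: "A x - (q * \<rho> + \<kappa>) *\<^sub>R w = ?y" by (simp add: A_def algebra_simps)
          have "\<bar>q * \<rho> + \<kappa>\<bar> \<le> q * \<bar>\<rho>\<bar> + \<bar>\<kappa>\<bar>" using q abs_triangle_ineq[of "q * \<rho>" \<kappa>] by (simp add: abs_mult)
          also have "\<dots> \<le> q * M + (1 - q) * M" using q \<rho> \<kappa> by (intro add_mono mult_left_mono) auto
          finally have "\<bar>q * \<rho> + \<kappa>\<bar> \<le> M" by (simp add: algebra_simps)
          moreover have "q * t x \<le> s" using q tx mult_mono[of q 1 "t x" s] by simp
          ultimately show "A x \<in> E (- s)"
            unfolding E_def using q tx eq yX ty by (auto simp: tA intro!: exI[of _ "q * \<rho> + \<kappa>"])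
        qed
        moreover have "measure lebesgue (A ` E s) = q ^ DIM('a) * measure lebesgue (E s)"
          unfolding A_def using measure_lebesgue_affine[of q "(1 - q) *\<^sub>R x0 + \<kappa> *\<^sub>R w" "E s"] q by simp
        moreover have "compact (A ` E s)"
          unfolding A_def by (intro compact_continuous_image E_c continuous_intros)
        then have "A ` E s \<in> sets lebesgue" by (simp add: lmeasurable_compact fmeasurableD)
        ultimately have "q ^ DIM('a) * measure lebesgue (E s) \<le> measure lebesgue (E (- s))"
          using E_l by (metis measure_mono_fmeasurable)
        \<comment> \<open>Bernoulli's inequality makes the relative loss of volume linear in
          \<open>s\<close>.\<close>
        moreover have "q ^ DIM('a) \<ge> 1 + DIM('a) * (q - 1)"
          using Bernoulli_inequality[of "q - 1" "DIM('a)"] q by simp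
        then have "1 - q ^ DIM('a) \<le> DIM('a) * (2 * s / c)"
          using q(3) mult_left_mono[of "1 - q" "2 * s / c" "real DIM('a)"] by (simp add: algebra_simps)
        then have "(1 - q ^ DIM('a)) * measure lebesgue (E s) \<le> DIM('a) * (2 * s / c) * measure lebesgue (E s)"
          by (intro mult_right_mono) auto
        ultimately show ?thesis by (simp add: algebra_simps)
      qed
      also have "\<dots> \<le> DIM('a) * (2 * s / c) * (K * s)"
      proof (intro mult_left_mono K(2)[of _ _ b])
        show "\<forall>x\<in>E s. \<bar>w \<bullet> x - b\<bar> \<le> s" by (auto simp: E_def t_def)
      qed (use E_l E_sub s c in auto)
      also have "\<dots> = DIM('a) * (2 / c) * K * s\<^sup>2" by (simp add: power2_eq_square)
      also have "\<dots> \<le> K' * s\<^sup>2" unfolding K'_def by (intro mult_right_mono) auto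
      finally show ?thesis .
    qed
    then show "measure lebesgue {x \<in> X. 0 \<le> w \<bullet> x - b \<and> w \<bullet> x - b \<le> s \<and> reflect w b x \<notin> X} \<le> K' * s\<^sup>2"
      by (simp add: B_def)
  qed
qed

section \<open>Layer cake and the softmax function\<close>

lemma summable_exp_poly: "summable (\<lambda>n::nat. exp (- real n) * (real n + 1) ^ m)"
proof (rule summable_comparison_test_ev)
  let ?g = "\<lambda>n::nat. (2 ^ m * exp (1/2)) * exp (- (1/2)) ^ n :: real"
  show "summable ?g" by (intro summable_mult summable_geometric) simp
  have lim: "filterlim (\<lambda>n::nat. (real n + 1) / 2) at_top sequentially"
    by (rule filterlim_at_top_mono[OF filterlim_tendsto_pos_mult_at_top[OF tendsto_const[of "1/2"] _ filterlim_real_sequentially]]) auto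
  have "\<forall>\<^sub>F x::real in at_top. x ^ m / exp x < 1"
    using order_tendstoD(2)[OF tendsto_power_div_exp_0, of 1] by simp
  from filterlim_iff[THEN iffD1, OF lim, rule_format, OF this]
  show "\<forall>\<^sub>F n::nat in sequentially. norm (exp (- real n) * (real n + 1) ^ m) \<le> ?g n"
  proof eventually_elim
    case (elim n)
    then have "((real n + 1) / 2) ^ m \<le> exp ((real n + 1) / 2)" by (simp add: field_simps)
    then have "exp (- real n) * (2 ^ m * ((real n + 1) / 2) ^ m) \<le> exp (- real n) * (2 ^ m * exp ((real n + 1) / 2))"
      by (intro mult_left_mono) auto
    moreover have "2 ^ m * ((real n + 1) / 2) ^ m = (real n + 1) ^ m"
      by (metis nonzero_mult_div_cancel_left power_mult_distrib times_divide_eq_right zero_neq_numeral)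
    moreover have "exp (- real n) * (2 ^ m * exp ((real n + 1) / 2)) = ?g n"
      by (simp add: exp_of_nat_mult[symmetric] exp_add[symmetric] field_simps)
    ultimately show ?case by simp
  qed
qed

text \<open>On the layer where \<open>f x / \<epsilon>\<close> is between \<open>n\<close> and
  \<open>n + 1\<close> the integrand is at most \<open>exp (- n)\<close>, and the layer lies in a
  sublevel set of measure at most \<open>K * ((n + 1) * \<epsilon>) ^ m\<close>. The resulting
  series is a constant free of \<epsilon>, so a bound at all widths becomes a pure power of
  \<epsilon>.\<close>

lemma (in finite_measure) layer_cake_exp:
  assumes [measurable]: "f \<in> borel_measurable M" "B \<in> sets M" and f0: "\<And>x. x \<in> B \<Longrightarrow> 0 \<le> f x"
    and K: "\<And>s. 0 < s \<Longrightarrow> measure M {x \<in> B. f x \<le> s} \<le> K * s ^ m" and \<epsilon>: "0 < \<epsilon>"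
  shows "(LINT x|M. indicator B x * exp (- f x / \<epsilon>)) \<le> (\<Sum>n. exp (- real n) * (real n + 1) ^ m) * K * \<epsilon> ^ m"
proof -
  let ?c = "\<lambda>n::nat. exp (- real n) * (real n + 1) ^ m"
  have K0: "K \<ge> 0" using order_trans[OF measure_nonneg K[of 1]] by simp
  have B_sub: "x \<in> B \<Longrightarrow> x \<in> space M" for x using sets.sets_into_space[OF assms(2)] by blast
  have set_eq: "{x \<in> B. f x \<le> s} = {x \<in> space M. x \<in> B \<and> f x \<le> s}" for s using B_sub by auto
  have term_le: "h n \<le> suminf h" for h :: "nat \<Rightarrow> ennreal" and n
    using sum_le_suminf[of h "{n}"] by simp
  have "(\<integral>\<^sup>+x. ennreal (indicator B x * exp (- f x / \<epsilon>)) \<partial>M)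
      \<le> (\<integral>\<^sup>+x. (\<Sum>n. ennreal (exp (- real n)) * indicator {x \<in> B. f x \<le> (real n + 1) * \<epsilon>} x) \<partial>M)"
  proof (rule nn_integral_mono)
    fix x
    show "ennreal (indicator B x * exp (- f x / \<epsilon>))
      \<le> (\<Sum>n. ennreal (exp (- real n)) * indicator {x \<in> B. f x \<le> (real n + 1) * \<epsilon>} x)" (is "_ \<le> (\<Sum>n. ?h n)")
    proof (cases "x \<in> B")
      case True
      define n where "n = nat \<lfloor>f x / \<epsilon>\<rfloor>"
      have "0 \<le> f x / \<epsilon>" using f0[OF True] \<epsilon> by simp
      then have n: "real n \<le> f x / \<epsilon>" "f x / \<epsilon> \<le> real n + 1" unfolding n_def by linarith+
      have "ennreal (indicator B x * exp (- f x / \<epsilon>)) \<le> ?h n"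
      proof -
        have "f x \<le> (real n + 1) * \<epsilon>" using n \<epsilon> by (simp add: field_simps)
        then have "?h n = ennreal (exp (- real n))" using True by (subst indicator_simps(1)) auto
        then show ?thesis using n True by (simp add: ennreal_leI)
      qed
      also have "?h n \<le> (\<Sum>n. ?h n)" by (rule term_le)
      finally show ?thesis .
    qed simp
  qed
  also have "\<dots> = (\<Sum>n. ennreal (exp (- real n)) * emeasure M {x \<in> B. f x \<le> (real n + 1) * \<epsilon>})"
    unfolding set_eq by (subst nn_integral_suminf) (simp_all add: nn_integral_cmult)
  also have "\<dots> \<le> (\<Sum>n. ennreal (?c n * (K * \<epsilon> ^ m)))"
  proof (rule suminf_le)
    fix n :: nat
    have "measure M {x \<in> B. f x \<le> (real n + 1) * \<epsilon>} \<le> K * ((real n + 1) * \<epsilon>) ^ m"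
      using \<epsilon> by (intro K) auto
    then have "exp (- real n) * measure M {x \<in> B. f x \<le> (real n + 1) * \<epsilon>} \<le> ?c n * (K * \<epsilon> ^ m)"
      by (simp add: power_mult_distrib mult.assoc mult.left_commute)
    then show "ennreal (exp (- real n)) * emeasure M {x \<in> B. f x \<le> (real n + 1) * \<epsilon>} \<le> ennreal (?c n * (K * \<epsilon> ^ m))"
      by (simp add: emeasure_eq_measure ennreal_mult'[symmetric] ennreal_leI)
  qed auto
  also have "\<dots> = ennreal (\<Sum>n. ?c n * (K * \<epsilon> ^ m))"
    using K0 \<epsilon> by (intro suminf_ennreal2 summable_mult2 summable_exp_poly) auto
  also have "(\<Sum>n. ?c n * (K * \<epsilon> ^ m)) = (\<Sum>n. ?c n) * (K * \<epsilon> ^ m)"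
    by (rule suminf_mult2[symmetric]) (rule summable_exp_poly)
  finally have le: "(\<integral>\<^sup>+x. ennreal (indicator B x * exp (- f x / \<epsilon>)) \<partial>M) \<le> ennreal ((\<Sum>n. ?c n) * (K * \<epsilon> ^ m))" .
  have "0 \<le> (\<Sum>n. ?c n) * (K * \<epsilon> ^ m)"
    using K0 \<epsilon> summable_exp_poly by (intro mult_nonneg_nonneg suminf_nonneg) auto
  with enn2real_mono[OF le] show ?thesis
    by (subst integral_eq_nn_integral) (auto simp: mult.assoc)
qed

text \<open>Half of the exponential decay absorbs the power, by
  \<open>r powr \<alpha> \<le> 1 + r\<close> and \<open>1 + r / 2 \<le> exp (r / 2)\<close>.\<close>

lemma powr_exp_le:
  fixes r :: real
  assumes "0 \<le> r" "0 < \<alpha>" "\<alpha> \<le> 1"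
  shows "r powr \<alpha> * exp (- r) \<le> 2 * exp (- r / 2)"
proof -
  have "r powr \<alpha> \<le> 1 + r"
  proof (cases "r \<le> 1")
    case True
    then have "r powr \<alpha> \<le> 1 powr \<alpha>" using assms by (intro powr_mono2) auto
    then show ?thesis using assms by simp
  next
    case False
    then have "r powr \<alpha> \<le> r powr 1" using assms by (intro powr_mono) auto
    then show ?thesis using assms by simp
  qed
  also have "\<dots> \<le> 2 * (1 + r / 2)" using assms by simp
  also have "\<dots> \<le> 2 * exp (r / 2)" by (intro mult_left_mono exp_ge_add_one_self) auto
  finally have "r powr \<alpha> * exp (- r) \<le> 2 * exp (r / 2) * exp (- r)" by (rule mult_right_mono) simp
  also have "\<dots> = 2 * exp (- r / 2)" by (simp add: exp_add[symmetric])
  finally show ?thesis .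
qed

section \<open>Softmax weights and their perturbation\<close>

definition softmax :: "('n::finite \<Rightarrow> real) \<Rightarrow> 'n \<Rightarrow> real" where
  "softmax u i = exp (u i) / (\<Sum>j\<in>UNIV. exp (u j))"

lemma sum_exp_pos: "0 < (\<Sum>j\<in>(UNIV::'n::finite set). exp (u j :: real))"
  by (intro sum_pos) auto

lemma softmax_pos: "0 < softmax u i"
  by (simp add: softmax_def sum_exp_pos)

lemma sum_softmax: "(\<Sum>i\<in>UNIV. softmax u i) = 1"
  using sum_exp_pos[of u] by (simp add: softmax_def sum_divide_distrib[symmetric])

lemma sum_softmax_le_1: "(\<Sum>i\<in>A. softmax u i) \<le> 1"
  using sum_mono2[of UNIV A "softmax u"] softmax_pos[of u] by (simp add: sum_softmax less_imp_le)

lemma sum_softmax_nonneg: "0 \<le> (\<Sum>i\<in>A. softmax u i)"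
  using softmax_pos[of u] by (simp add: sum_nonneg less_imp_le)

lemma softmax_le_1: "softmax u i \<le> 1"
  using sum_softmax_le_1[of u "{i}"] by simp

lemma sum_softmax_Compl: "(\<Sum>i\<in>-A. softmax u i) = 1 - (\<Sum>i\<in>A. softmax u i)"
  using sum.subset_diff[of A UNIV "softmax u"] by (simp add: sum_softmax Compl_eq_Diff_UNIV)

lemma softmax_le: "softmax u i \<le> exp (u i - u k)"
proof -
  have "exp (u k) \<le> (\<Sum>j\<in>UNIV. exp (u j))" by (intro member_le_sum) auto
  then have "exp (u i) / (\<Sum>j\<in>UNIV. exp (u j)) \<le> exp (u i) / exp (u k)"
    by (intro divide_left_mono) (auto intro!: mult_pos_pos sum_exp_pos)
  then show ?thesis by (simp add: softmax_def exp_diff)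
qed

lemma softmax_mult_le: "softmax u i * softmax u j \<le> exp (- \<bar>u i - u j\<bar>)"
proof (cases "u i \<le> u j")
  case True
  have "softmax u i * softmax u j \<le> exp (u i - u j) * 1"
    using softmax_pos[of u] by (intro mult_mono softmax_le softmax_le_1) (auto simp: less_imp_le)
  then show ?thesis using True by simp
next
  case False
  have "softmax u i * softmax u j \<le> 1 * exp (u j - u i)"
    using softmax_pos[of u] by (intro mult_mono softmax_le softmax_le_1) (auto simp: less_imp_le)
  then show ?thesis using False by simp
qed

lemma softmax_add:
  "softmax (\<lambda>j. u j + a j) i = softmax u i * exp (a i) / (\<Sum>j\<in>UNIV. softmax u j * exp (a j))"
  using sum_exp_pos[of u] by (simp add: softmax_def exp_add sum_divide_distrib[symmetric])

text \<open>Adding \<open>a\<close> to the exponents reweights the masses \<open>g\<close> and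
  \<open>1 - g\<close> of \<open>A\<close> and its complement to \<open>p\<close> and
  \<open>q\<close>. The numerator \<open>(1 - g) * p - g * q\<close> vanishes for constant
  \<open>a\<close>; the upper and the lower perturbation bound below both estimate it.\<close>

lemma sum_softmax_add:
  fixes u a :: "'n::finite \<Rightarrow> real" and A :: "'n set"
  defines "g \<equiv> (\<Sum>i\<in>A. softmax u i)"
    and "p \<equiv> (\<Sum>i\<in>A. softmax u i * exp (a i))" and "q \<equiv> (\<Sum>i\<in>-A. softmax u i * exp (a i))"
  shows "(\<Sum>i\<in>A. softmax (\<lambda>j. u j + a j) i) = p / (p + q)" and "0 < p + q"
    and "(\<Sum>i\<in>A. softmax (\<lambda>j. u j + a j) i) - g = ((1 - g) * p - g * q) / (p + q)"
proof -
  have pq: "(\<Sum>j\<in>UNIV. softmax u j * exp (a j)) = p + q"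
    unfolding p_def q_def by (subst sum.subset_diff[of A UNIV]) (auto simp: Compl_eq_Diff_UNIV)
  show 1: "(\<Sum>i\<in>A. softmax (\<lambda>j. u j + a j) i) = p / (p + q)"
    by (simp add: softmax_add pq p_def sum_divide_distrib)
  show 2: "0 < p + q"
    unfolding pq[symmetric] by (intro sum_pos) (auto simp: softmax_pos)
  show "(\<Sum>i\<in>A. softmax (\<lambda>j. u j + a j) i) - g = ((1 - g) * p - g * q) / (p + q)"
    unfolding 1 using 2 by (simp add: field_simps)
qed

text \<open>All reweighting factors lie between \<open>exp (- c)\<close> and \<open>exp c\<close>,
  so the numerator is at most \<open>(exp c - exp (- c)) * (g * (1 - g))\<close> and the denominator
  at least \<open>exp (- c)\<close>. The factor \<open>g * (1 - g)\<close>, tiny away from ties, is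
  what both the Poincare inequality and the L^1 bound live on.\<close>

lemma abs_sum_softmax_diff_le:
  fixes u u' :: "'n::finite \<Rightarrow> real" and A :: "'n set"
  defines "g \<equiv> (\<Sum>i\<in>A. softmax u i)"
  assumes c: "\<And>j. \<bar>u' j - u j\<bar> \<le> c"
  shows "\<bar>(\<Sum>i\<in>A. softmax u' i) - g\<bar> \<le> (exp (2 * c) - 1) * (g * (1 - g))"
proof -
  define a where "a j = u' j - u j" for j
  have u': "u' = (\<lambda>j. u j + a j)" by (simp add: a_def)
  define p where "p = (\<Sum>i\<in>A. softmax u i * exp (a i))"
  define q where "q = (\<Sum>i\<in>-A. softmax u i * exp (a i))"
  note add = sum_softmax_add[of u a A, folded p_def q_def g_def, folded u']
  have bnds: "exp (- c) \<le> exp (a i) \<and> exp (a i) \<le> exp c" for i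
    using c[of i] by (auto simp: a_def abs_le_iff)
  have lo: "(\<Sum>i\<in>B. softmax u i) * exp (- c) \<le> (\<Sum>i\<in>B. softmax u i * exp (a i))"
    and hi: "(\<Sum>i\<in>B. softmax u i * exp (a i)) \<le> (\<Sum>i\<in>B. softmax u i) * exp c" for B
    unfolding sum_distrib_right
    by (intro sum_mono mult_left_mono conjunct1[OF bnds] conjunct2[OF bnds] less_imp_le[OF softmax_pos])+
  have p: "g * exp (- c) \<le> p" "p \<le> g * exp c" unfolding g_def p_def by (rule lo hi)+
  have q: "(1 - g) * exp (- c) \<le> q" "q \<le> (1 - g) * exp c"
    using lo[of "- A"] hi[of "- A"] by (simp_all add: q_def g_def sum_softmax_Compl)
  have g: "0 \<le> g" "g \<le> 1" by (simp_all add: g_def sum_softmax_nonneg sum_softmax_le_1)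
  have "exp (- c) \<le> p + q" using p(1) q(1) by (simp add: algebra_simps)
  have "\<bar>(1 - g) * p - g * q\<bar> \<le> (exp c - exp (- c)) * (g * (1 - g))"
  proof -
    have "(1 - g) * p \<le> (1 - g) * (g * exp c)" "(1 - g) * (g * exp (- c)) \<le> (1 - g) * p"
      "g * q \<le> g * ((1 - g) * exp c)" "g * ((1 - g) * exp (- c)) \<le> g * q"
      using p q g by (auto intro!: mult_left_mono)
    then show ?thesis by (simp add: abs_le_iff algebra_simps)
  qed
  also have "\<dots> = (exp (2 * c) - 1) * (g * (1 - g)) * exp (- c)"
    by (simp add: algebra_simps exp_add[symmetric])
  also have "\<dots> \<le> (exp (2 * c) - 1) * (g * (1 - g)) * (p + q)"
  proof (intro mult_left_mono)
    \<comment> \<open>Any index gives the sign of \<open>c\<close>; \<open>undefined\<close> serves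
      as one.\<close>
    have "0 \<le> c" using c[of undefined] by linarith
    then show "0 \<le> (exp (2 * c) - 1) * (g * (1 - g))" using g by simp
  qed fact
  finally show ?thesis
    unfolding add(3) using add(2) by (simp add: abs_divide divide_le_eq)
qed

text \<open>Comparing the double sums over one index inside and one outside \<open>A\<close> gives
  \<open>p * (1 - g) \<le> exp (- h) * (g * q)\<close>, and \<open>1 - exp (- h) \<ge> h / 2\<close>
  for \<open>h \<le> 1\<close>. So a relative shift by \<open>h\<close> takes from \<open>A\<close>
  a mass at least proportional to the variance \<open>g * (1 - g)\<close>.\<close>

lemma sum_softmax_gap:
  fixes u u' :: "'n::finite \<Rightarrow> real" and A :: "'n set"
  defines "g \<equiv> (\<Sum>i\<in>A. softmax u i)"
  assumes gap: "\<And>i j. i \<in> A \<Longrightarrow> j \<notin> A \<Longrightarrow> (u' j - u j) - (u' i - u i) \<ge> h" and h: "0 \<le> h" "h \<le> 1"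
  shows "h / 2 * (g * (1 - g)) \<le> g - (\<Sum>i\<in>A. softmax u' i)"
proof -
  define a where "a j = u' j - u j" for j
  have u': "u' = (\<lambda>j. u j + a j)" by (simp add: a_def)
  define p where "p = (\<Sum>i\<in>A. softmax u i * exp (a i))"
  define q where "q = (\<Sum>i\<in>-A. softmax u i * exp (a i))"
  note add = sum_softmax_add[of u a A, folded p_def q_def g_def, folded u']
  have g: "0 \<le> g" "g \<le> 1" by (simp_all add: g_def sum_softmax_nonneg sum_softmax_le_1)
  have q0: "0 \<le> q" unfolding q_def using softmax_pos[of u] by (intro sum_nonneg mult_nonneg_nonneg) (auto intro: less_imp_le)
  have "p * (1 - g) = (\<Sum>i\<in>A. \<Sum>j\<in>-A. softmax u i * softmax u j * exp (a i))"
    unfolding p_def g_def sum_softmax_Compl[symmetric] sum_product by (intro sum.cong) (simp_all add: mult_ac)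
  also have "\<dots> \<le> (\<Sum>i\<in>A. \<Sum>j\<in>-A. softmax u i * softmax u j * (exp (- h) * exp (a j)))"
  proof (intro sum_mono mult_left_mono)
    fix i j assume "i \<in> A" "j \<in> - A"
    then show "exp (a i) \<le> exp (- h) * exp (a j)"
      using gap[of i j] by (simp add: a_def exp_add[symmetric])
    show "0 \<le> softmax u i * softmax u j" by (simp add: softmax_pos less_imp_le)
  qed
  also have "\<dots> = exp (- h) * (g * q)"
    unfolding q_def g_def sum_product by (simp add: sum_distrib_left mult_ac)
  finally have pg: "p * (1 - g) \<le> exp (- h) * (g * q)" .
  have eh: "h / 2 \<le> 1 - exp (- h)"
  proof -
    have "(1 + h) * exp (- h) \<le> exp h * exp (- h)" by (intro mult_right_mono exp_ge_add_one_self) auto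
    then have "exp (- h) \<le> 1 / (1 + h)" using h by (simp add: exp_add[symmetric] field_simps)
    moreover have "1 / (1 + h) \<le> 1 - h / 2" using h mult_left_mono[of h 1 h] by (simp add: field_simps)
    ultimately show ?thesis by linarith
  qed
  have "p * (1 - g) \<le> g * q"
    using pg mult_right_mono[of "exp (- h)" 1 "g * q"] h g q0 by simp
  then have "(1 - g) * (p + q) \<le> q" by (simp add: algebra_simps)
  then have "h / 2 * (g * ((1 - g) * (p + q))) \<le> (1 - exp (- h)) * (g * q)"
    using eh h g q0 add(2) by (intro mult_mono) auto
  also have "\<dots> \<le> g * q - p * (1 - g)" using pg by (simp add: algebra_simps)
  finally have "h / 2 * (g * (1 - g)) \<le> (g * q - p * (1 - g)) / (p + q)"
    using add(2) by (simp add: pos_le_divide_eq mult_ac)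
  also have "\<dots> = - (((1 - g) * p - g * q) / (p + q))" by (simp add: minus_divide_left mult.commute)
  also have "\<dots> = g - (\<Sum>i\<in>A. softmax u' i)" unfolding add(3)[symmetric] by simp
  finally show ?thesis .
qed

text \<open>With the indices \<open>i\<close> and \<open>k\<close> alone the weight would be
  \<open>a / (1 + a)\<close>. The others add \<open>r\<close> to the denominator, which costs at
  most \<open>a * r\<close>; for maximal \<open>u k\<close> a term of this product is small unless
  two indices nearly tie with \<open>k\<close> at once.\<close>

lemma softmax_approx_logistic:
  fixes u :: "'n::finite \<Rightarrow> real"
  assumes "i \<noteq> k" and ik: "u i \<le> u k"
  shows "\<bar>softmax u i - exp (u i - u k) / (1 + exp (u i - u k))\<bar>
    \<le> exp (u i - u k) * (\<Sum>j\<in>UNIV - {i, k}. exp (u j - u k))"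
proof -
  define a where "a = exp (u i - u k)"
  define r where "r = (\<Sum>j\<in>UNIV - {i, k}. exp (u j - u k))"
  have a: "0 < a" and r: "0 \<le> r" by (auto simp: a_def r_def intro: sum_nonneg)
  have "(\<Sum>j\<in>UNIV. exp (u j)) = exp (u k) * (\<Sum>j\<in>UNIV. exp (u j - u k))"
    by (simp add: sum_distrib_left exp_add[symmetric])
  also have "(\<Sum>j\<in>UNIV. exp (u j - u k)) = 1 + a + r"
    using assms by (subst sum.subset_diff[of "{i, k}" UNIV]) (auto simp: a_def r_def)
  finally have "softmax u i = a / (1 + a + r)"
    by (simp add: softmax_def a_def exp_diff)
  moreover have "a / (1 + a + r) - a / (1 + a) = - (a * r / ((1 + a + r) * (1 + a)))"
    using a r by (simp add: divide_simps add_pos_nonneg add_eq_0_iff) (simp add: algebra_simps)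
  ultimately have "\<bar>softmax u i - a / (1 + a)\<bar> = a * r / ((1 + a + r) * (1 + a))"
    using a r by simp
  also have "\<dots> \<le> a * r / 1"
  proof (rule divide_left_mono)
    show "1 \<le> (1 + a + r) * (1 + a)" using a r mult_mono[of 1 "1 + a + r" 1 "1 + a"] by simp
  qed (use a r in auto)
  finally show ?thesis by (simp add: a_def r_def)
qed

section \<open>Near ties between cells\<close>

text \<open>Finitely many constants can be added up. Pairs and triples of cells are passed as a
  single index \<open>i\<close>.\<close>

lemma uniform_const:
  fixes f :: "'i::finite \<Rightarrow> 'z \<Rightarrow> 's \<Rightarrow> real"
  assumes ex: "\<And>i. \<exists>K>0. \<forall>z s. A i z s \<longrightarrow> f i z s \<le> K * g s" and g: "\<And>s. 0 \<le> g s"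
  shows "\<exists>K>0. \<forall>i z s. A i z s \<longrightarrow> f i z s \<le> K * g s"
proof -
  obtain k where k: "\<And>i. k i > 0" "\<And>i z s. A i z s \<Longrightarrow> f i z s \<le> k i * g s" using ex by metis
  have "k i \<le> (\<Sum>i\<in>UNIV. k i)" for i
    using k by (intro member_le_sum) (auto intro: less_imp_le)
  then have "f i z s \<le> (\<Sum>i\<in>UNIV. k i) * g s" if "A i z s" for i z s
    using k(2)[OF that] g[of s] by (meson mult_right_mono order_trans)
  moreover have "(\<Sum>i\<in>UNIV. k i) > 0" using k by (intro sum_pos) auto
  ultimately show ?thesis by blast
qed

text \<open>The target measure is not a parameter: a constant obtained from the data fixed here is
  automatically uniform in it. The support of \<open>P\<close> enters through
  \<open>AE_X\<close>.\<close>

locale semidiscrete = prob_space P for P :: "(real^'d) measure" +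
  fixes X :: "(real^'d) set" and \<rho> :: "real^'d \<Rightarrow> real" and y :: "'n::finite \<Rightarrow> real^'d" and \<alpha> c0 :: real
  assumes compact_X: "compact X" and convex_X: "convex X"
    and \<rho>_measurable [measurable]: "\<rho> \<in> borel_measurable borel" and \<rho>_nonneg: "\<And>x. 0 \<le> \<rho> x"
    and P_eq: "P = density lborel (\<lambda>x. ennreal (\<rho> x))"
    and \<rho>_lipschitz: "\<exists>L. L-lipschitz_on X \<rho>" and \<rho>_pos: "\<And>x. x \<in> X \<Longrightarrow> 0 < \<rho> x"
    and inj_y: "inj y" and c0_pos: "0 < c0" and \<alpha>_pos: "0 < \<alpha>" and \<alpha>_le: "\<alpha> \<le> 1"
    and AE_X: "AE x in P. x \<in> X"
begin

lemma sets_P [simp, measurable_cong]: "sets P = sets borel" and space_P [simp]: "space P = UNIV"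
  by (simp_all add: P_eq)

lemma X_borel [measurable]: "X \<in> sets borel"
  using compact_X by (simp add: compact_imp_closed)

lemma X_nonempty: "X \<noteq> {}"
  using AE_X by auto

definition pot :: "real^'n \<Rightarrow> real^'d \<Rightarrow> 'n \<Rightarrow> real" where
  "pot z x i = x \<bullet> y i - z $ i"

definition p :: "real \<Rightarrow> real^'n \<Rightarrow> real^'d \<Rightarrow> 'n \<Rightarrow> real" where
  "p \<epsilon> z x = softmax (\<lambda>i. pot z x i / \<epsilon>)"

abbreviation cell :: "real^'n \<Rightarrow> 'n \<Rightarrow> (real^'d) set" where
  "cell \<equiv> laguerre_cell X y"

text \<open>Stands in for the lower bound on the masses of \<open>Q\<close>: at the Brenier
  potential the cell masses are those masses (\<open>brenier_optimality\<close>).\<close>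

definition good :: "real^'n \<Rightarrow> bool" where
  "good z \<longleftrightarrow> (\<forall>i. c0 \<le> prob (cell z i))"

abbreviation margin :: "real^'n \<Rightarrow> 'n \<Rightarrow> 'n \<Rightarrow> real^'d \<Rightarrow> real" where
  "margin z i k x \<equiv> \<bar>pot z x k - pot z x i\<bar>"

lemma pot_measurable [measurable]: "(\<lambda>x. pot z x i) \<in> borel_measurable borel"
  unfolding pot_def by measurable

lemma p_measurable [measurable]: "(\<lambda>x. p \<epsilon> z x i) \<in> borel_measurable borel"
  unfolding p_def softmax_def by measurable

lemma cell_eq: "cell z i = {x \<in> X. \<forall>j. pot z x j \<le> pot z x i}"
  unfolding laguerre_cell_def pot_def by (force simp: inner_simps inner_commute algebra_simps)

lemma cell_measurable [measurable]: "cell z i \<in> sets borel"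
  unfolding cell_eq by measurable

lemma pot_diff: "pot z x k - pot z x i = (y k - y i) \<bullet> x - (z $ k - z $ i)"
  by (simp add: pot_def inner_simps inner_commute)

lemma integrable_bounded:
  assumes [measurable]: "f \<in> borel_measurable borel" and "\<And>x. x \<in> X \<Longrightarrow> \<bar>f x :: real\<bar> \<le> B"
  shows "integrable P f"
  using assms(2) AE_X by (intro integrable_const_bound[of _ B]) auto

lemma prob_Int_X: "S \<in> sets borel \<Longrightarrow> prob S = prob (S \<inter> X)"
  using AE_X by (intro measure_eq_AE) auto

lemma \<rho>_bounds: obtains m M where "0 < m" "0 < M" "\<And>x. x \<in> X \<Longrightarrow> m \<le> \<rho> x" "\<And>x. x \<in> X \<Longrightarrow> \<rho> x \<le> M"
proof -
  have cont: "continuous_on X \<rho>" using \<rho>_lipschitz lipschitz_on_continuous_on by blast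
  obtain a where a: "a \<in> X" "\<forall>x\<in>X. \<rho> a \<le> \<rho> x"
    using continuous_attains_inf[OF compact_X X_nonempty cont] by blast
  obtain b where b: "b \<in> X" "\<forall>x\<in>X. \<rho> x \<le> \<rho> b"
    using continuous_attains_sup[OF compact_X X_nonempty cont] by blast
  show ?thesis using that[of "\<rho> a" "\<rho> b"] a b \<rho>_pos by auto
qed

lemma prob_le_lebesgue:
  assumes S: "S \<in> sets borel" "S \<subseteq> X" and M: "\<And>x. x \<in> X \<Longrightarrow> \<rho> x \<le> M"
  shows "prob S \<le> M * measure lebesgue S"
proof -
  have M0: "M \<ge> 0" using X_nonempty M \<rho>_nonneg by (meson ex_in_conv order_trans)
  have Sl: "S \<in> lmeasurable"
    using compact_X S by (intro bounded_set_imp_lmeasurable) (auto intro: bounded_subset compact_imp_bounded)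
  have "emeasure P S = (\<integral>\<^sup>+x. ennreal (\<rho> x) * indicator S x \<partial>lborel)"
    unfolding P_eq using S by (subst emeasure_density) auto
  also have "\<dots> \<le> (\<integral>\<^sup>+x. ennreal M * indicator S x \<partial>lborel)"
    using S M by (intro nn_integral_mono) (auto simp: indicator_def intro!: ennreal_leI)
  also have "\<dots> = ennreal M * emeasure lborel S" using S by (simp add: nn_integral_cmult)
  also have "emeasure lborel S = emeasure lebesgue S" using S by simp
  also have "\<dots> = ennreal (measure lebesgue S)" using Sl by (simp add: emeasure_eq_measure2 fmeasurableD2 del: emeasure_completion)
  finally show ?thesis
    using M0 by (simp add: emeasure_eq_measure ennreal_mult'[symmetric] ennreal_le_iff)
qed

lemma prob_slab: "\<exists>K>0. \<forall>i k b s. i \<noteq> k \<longrightarrow> 0 < s \<longrightarrow> prob {x. \<bar>(y k - y i) \<bullet> x - b\<bar> \<le> s} \<le> K * s"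
proof -
  obtain m M where M: "0 < M" "\<And>x. x \<in> X \<Longrightarrow> \<rho> x \<le> M" using \<rho>_bounds by metis
  obtain R where R: "X \<subseteq> cball 0 R"
    using compact_imp_bounded[OF compact_X] by (auto simp: bounded_iff subset_iff)
  \<comment> \<open>\<open>uniform_const\<close> asks for a right-hand side that is nonnegative at
    every real \<open>s\<close>, hence the absolute value. For equal indices the premise fails and
    any constant will do.\<close>
  have "\<exists>K>0. \<forall>b s. i \<noteq> k \<and> 0 < s \<longrightarrow> prob {x. \<bar>(y k - y i) \<bullet> x - b\<bar> \<le> s} \<le> K * \<bar>s\<bar>" for i k
    proof (cases "i = k")
      case False
      then have "y k - y i \<noteq> 0" using inj_y by (auto dest: injD)
      from slab_measure_le[OF this, of R] obtain K where K: "K > 0"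
        "\<And>S b s. S \<in> lmeasurable \<Longrightarrow> S \<subseteq> cball 0 R \<Longrightarrow> 0 < s \<Longrightarrow>
          (\<forall>x\<in>S. \<bar>(y k - y i) \<bullet> x - b\<bar> \<le> s) \<Longrightarrow> measure lebesgue S \<le> K * s" by blast
      have "prob {x. \<bar>(y k - y i) \<bullet> x - b\<bar> \<le> s} \<le> (M * K) * s" if "0 < s" for b s
      proof -
        define S where "S = {x. \<bar>(y k - y i) \<bullet> x - b\<bar> \<le> s} \<inter> X"
        have S: "S \<in> sets borel" "S \<subseteq> X" unfolding S_def by auto
        then have "prob S \<le> M * measure lebesgue S" using M by (intro prob_le_lebesgue) auto
        also have "\<dots> \<le> M * (K * s)"
          using M S R that compact_X by (intro mult_left_mono K(2)[of _ _ b])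
            (auto simp: S_def intro!: bounded_set_imp_lmeasurable intro: bounded_subset compact_imp_bounded)
        finally show ?thesis by (subst prob_Int_X) (auto simp: S_def)
      qed
      then show ?thesis using K M by (intro exI[of _ "M * K"]) auto
    qed (auto intro: exI[of _ 1])
  then show ?thesis
    using uniform_const[of "\<lambda>(i, k) b s. i \<noteq> k \<and> 0 < s"
      "\<lambda>(i, k) b s. prob {x. \<bar>(y k - y i) \<bullet> x - b\<bar> \<le> s}" abs] by force
qed

lemma prob_pot_slab: "\<exists>K>0. \<forall>z i k s. i \<noteq> k \<longrightarrow> 0 < s \<longrightarrow> prob {x. margin z i k x \<le> s} \<le> K * s"
  using prob_slab unfolding pot_diff by blast

lemma AE_no_ties: "AE x in P. \<forall>i k. i \<noteq> k \<longrightarrow> pot z x i \<noteq> pot z x k"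
proof -
  obtain K where K: "K > 0" "\<And>z i k s. i \<noteq> k \<Longrightarrow> 0 < s \<Longrightarrow> prob {x. margin z i k x \<le> s} \<le> K * s"
    using prob_pot_slab by blast
  have "AE x in P. pot z x i \<noteq> pot z x k" if "i \<noteq> k" for i k
  proof (rule AE_I[of _ _ "{x. pot z x i = pot z x k}"])
    have "prob {x. pot z x i = pot z x k} \<le> 0 + e" if e: "e > 0" for e
    proof -
      have "prob {x. pot z x i = pot z x k} \<le> prob {x. margin z i k x \<le> e / K}"
        using K e by (intro finite_measure_mono) auto
      also have "\<dots> \<le> K * (e / K)" using K e \<open>i \<noteq> k\<close> by (intro K) auto
      finally show ?thesis using K by simp
    qed
    then have "prob {x. pot z x i = pot z x k} \<le> 0" by (rule field_le_epsilon)
    then show "emeasure P {x. pot z x i = pot z x k} = 0"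
      by (simp add: emeasure_eq_measure measure_le_0_iff)
  qed auto
  then show ?thesis by (simp add: AE_all_countable)
qed

text \<open>Otherwise the cell of \<open>i\<close> would lie in the slab of half-width
  \<open>c\<close> around its tie with \<open>k\<close>, of mass at most
  \<open>K * c = c0 / 2\<close>. This supplies the deep point for
  \<open>reflection_boundary_layer\<close>.\<close>

lemma cell_depth: "\<exists>c>0. \<forall>z i k. good z \<longrightarrow> i \<noteq> k \<longrightarrow> (\<exists>x\<in>X. pot z x k - pot z x i \<le> - c)"
proof -
  obtain K where K: "K > 0" "\<And>z i k s. i \<noteq> k \<Longrightarrow> 0 < s \<Longrightarrow> prob {x. margin z i k x \<le> s} \<le> K * s"
    using prob_pot_slab by blast
  define c where "c = c0 / (2 * K)"
  have c: "c > 0" "K * c < c0" using K c0_pos by (auto simp: c_def)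
  have "\<exists>x\<in>X. pot z x k - pot z x i \<le> - c" if "good z" "i \<noteq> k" for z i k
  proof (rule ccontr)
    assume "\<not> (\<exists>x\<in>X. pot z x k - pot z x i \<le> - c)"
    then have "cell z i \<subseteq> {x. margin z i k x \<le> c}" by (fastforce simp: cell_eq)
    then have "prob (cell z i) \<le> prob {x. margin z i k x \<le> c}"
      by (intro finite_measure_mono) auto
    also have "\<dots> \<le> K * c" using that c by (intro K) auto
    finally show False using c that(1) by (auto simp: good_def not_le[symmetric] intro: order_trans)
  qed
  then show ?thesis using c by blast
qed

text \<open>The convex combination of the leads of \<open>b\<close> over \<open>a\<close> and over
  \<open>d\<close>, with the weights that make up \<open>y b\<close>, does not depend on
  \<open>x\<close> (\<open>affine\<close>). A near tie at one point makes this constant small; then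
  on the whole cell of \<open>b\<close> the lead over \<open>a\<close> is at most
  \<open>c / \<mu>\<close>, and the mass of the cell falls below \<open>c0\<close>.\<close>

lemma middle_tie:
  assumes mid: "y b = \<mu> *\<^sub>R y a + (1 - \<mu>) *\<^sub>R y d" and \<mu>: "0 < \<mu>" "\<mu> < 1" and ab: "a \<noteq> b"
  shows "\<exists>c>0. \<forall>z x s. good z \<longrightarrow> margin z a b x \<le> s \<longrightarrow> margin z d b x \<le> s \<longrightarrow> c \<le> s"
proof -
  obtain K where K: "K > 0" "\<And>z i k s. i \<noteq> k \<Longrightarrow> 0 < s \<Longrightarrow> prob {x. margin z i k x \<le> s} \<le> K * s"
    using prob_pot_slab by blast
  define c where "c = c0 * \<mu> / (2 * K)"
  have c: "c > 0" "K * (c / \<mu>) < c0" using K c0_pos \<mu> by (auto simp: c_def)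
  have affine: "\<mu> * (pot z x b - pot z x a) + (1 - \<mu>) * (pot z x b - pot z x d)
      = \<mu> * z $ a + (1 - \<mu>) * z $ d - z $ b" for z x
    unfolding pot_def mid by (simp add: inner_simps algebra_simps)
  have "c \<le> s" if z: "good z" and tie: "margin z a b x \<le> s" "margin z d b x \<le> s" for z x s
  proof (rule ccontr)
    assume "\<not> c \<le> s"
    have "\<mu> * (pot z x b - pot z x a) + (1 - \<mu>) * (pot z x b - pot z x d) \<le> \<mu> * s + (1 - \<mu>) * s"
      using tie \<mu> by (intro add_mono mult_left_mono) auto
    then have \<kappa>: "\<mu> * z $ a + (1 - \<mu>) * z $ d - z $ b \<le> c"
      using \<open>\<not> c \<le> s\<close> unfolding affine by (simp add: algebra_simps)
    have "cell z b \<subseteq> {x. margin z a b x \<le> c / \<mu>}"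
    proof
      fix x' assume "x' \<in> cell z b"
      then have ge: "0 \<le> pot z x' b - pot z x' a" "0 \<le> pot z x' b - pot z x' d" by (auto simp: cell_eq)
      then have "0 \<le> (1 - \<mu>) * (pot z x' b - pot z x' d)" using \<mu> by simp
      then have "\<mu> * (pot z x' b - pot z x' a) \<le> c" using affine[of z x'] \<kappa> by linarith
      then show "x' \<in> {x. margin z a b x \<le> c / \<mu>}" using ge \<mu> by (simp add: field_simps)
    qed
    then have "prob (cell z b) \<le> prob {x. margin z a b x \<le> c / \<mu>}"
      by (intro finite_measure_mono) auto
    also have "\<dots> \<le> K * (c / \<mu>)" using ab c \<mu> by (intro K) auto
    finally show False using c z by (auto simp: good_def not_le[symmetric] intro: order_trans)
  qed
  then show ?thesis using c by blast
qed

text \<open>\<open>dep\<close> is equality in Cauchy-Schwarz: the three targets are collinear, one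
  of them lies between the others, and \<open>middle_tie\<close> applies to it. Passing to ties with
  the middle target costs at most a factor 2, by the triangle inequality.\<close>

lemma collinear_tie:
  assumes dist: "i \<noteq> j" "j \<noteq> k" "i \<noteq> k"
    and dep: "((y k - y i) \<bullet> (y k - y j))\<^sup>2 = ((y k - y i) \<bullet> (y k - y i)) * ((y k - y j) \<bullet> (y k - y j))"
  shows "\<exists>c>0. \<forall>z x s. good z \<longrightarrow> margin z i k x \<le> s \<longrightarrow> margin z j k x \<le> s \<longrightarrow> c \<le> s"
proof -
  define w w' where "w = y k - y i" and "w' = y k - y j"
  have w: "w \<noteq> 0" "w' \<noteq> 0" "w \<noteq> w'" using dist inj_y by (auto simp: w_def w'_def dest: injD)
  define l where "l = (w \<bullet> w') / (w \<bullet> w)"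
  have "(w' - l *\<^sub>R w) \<bullet> (w' - l *\<^sub>R w) = w' \<bullet> w' - (w \<bullet> w')\<^sup>2 / (w \<bullet> w)"
    using w by (simp add: l_def inner_simps inner_commute power2_eq_square)
  also have "\<dots> = 0" using dep w by (simp add: w_def[symmetric] w'_def[symmetric])
  finally have w'l: "w' = l *\<^sub>R w" by simp
  have l: "l \<noteq> 0" "l \<noteq> 1" using w w'l by auto
  have yj: "y j = (1 - l) *\<^sub>R y k + l *\<^sub>R y i"
    using w'l unfolding w_def w'_def by (simp add: algebra_simps)
  have half: ?thesis if "\<exists>c>0. \<forall>z x s. good z \<longrightarrow> margin z i k x \<le> s \<longrightarrow> margin z j k x \<le> s \<longrightarrow> c \<le> 2 * s"
  proof -
    from that obtain c where "c > 0" "\<forall>z x s. good z \<longrightarrow> margin z i k x \<le> s \<longrightarrow> margin z j k x \<le> s \<longrightarrow> c \<le> 2 * s"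
      by blast
    then show ?thesis by (intro exI[of _ "c / 2"]) (auto simp: field_simps)
  qed
  \<comment> \<open>As \<open>y k - y j\<close> is \<open>l\<close> times \<open>y k - y i\<close>,
    the target in the middle is \<open>y j\<close>, \<open>y i\<close> and \<open>y k\<close> in the
    three cases.\<close>
  consider "0 < l" "l < 1" | "1 < l" | "l < 0" using l by linarith
  then show ?thesis
  proof cases
    case 1
    have "y j = l *\<^sub>R y i + (1 - l) *\<^sub>R y k" using yj by (simp add: add.commute)
    from middle_tie[OF this 1 dist(1)] obtain c where c: "c > 0"
      "\<And>z x s. good z \<Longrightarrow> margin z i j x \<le> s \<Longrightarrow> margin z k j x \<le> s \<Longrightarrow> c \<le> s" by blast
    show ?thesis
    proof (rule half, intro exI[of _ c] conjI allI impI c(1))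
      fix z x s assume "good z" "margin z i k x \<le> s" "margin z j k x \<le> s"
      then show "c \<le> 2 * s" by (intro c(2)[of z x]) linarith+
    qed
  next
    case 2
    have l1: "l * (1 - 1 / l) = l - 1" using 2 by (simp add: field_simps)
    have "l *\<^sub>R ((1 / l) *\<^sub>R y j + (1 - 1 / l) *\<^sub>R y k) = y j + (l * (1 - 1 / l)) *\<^sub>R y k"
      using 2 by (simp add: scaleR_add_right)
    also have "\<dots> = l *\<^sub>R y i" unfolding l1 yj by (simp add: algebra_simps)
    finally have "y i = (1 / l) *\<^sub>R y j + (1 - 1 / l) *\<^sub>R y k" using 2 by (metis l(1) scaleR_cancel_left)
    moreover have "0 < 1 / l" "1 / l < 1" using 2 by auto
    ultimately obtain c where c: "c > 0"
      "\<And>z x s. good z \<Longrightarrow> margin z j i x \<le> s \<Longrightarrow> margin z k i x \<le> s \<Longrightarrow> c \<le> s"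
      using middle_tie[OF _ _ _ dist(1)[symmetric], of "1 / l" k] by blast
    show ?thesis
    proof (rule half, intro exI[of _ c] conjI allI impI c(1))
      fix z x s assume "good z" "margin z i k x \<le> s" "margin z j k x \<le> s"
      then show "c \<le> 2 * s" by (intro c(2)[of z x]) linarith+
    qed
  next
    case 3
    define m where "m = 1 / (1 - l)"
    have m: "m * (1 - l) = 1" "m * l + (1 - m) = 1 - m * (1 - l)"
      using 3 by (simp add: m_def, simp add: right_diff_distrib)
    have "m *\<^sub>R y j + (1 - m) *\<^sub>R y i = (m * (1 - l)) *\<^sub>R y k + (m * l + (1 - m)) *\<^sub>R y i"
      unfolding yj by (simp add: scaleR_add_right scaleR_add_left)
    then have "y k = m *\<^sub>R y j + (1 - m) *\<^sub>R y i" unfolding m(2) unfolding m(1) by simp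
    then have "y k = (1 / (1 - l)) *\<^sub>R y j + (1 - 1 / (1 - l)) *\<^sub>R y i" unfolding m_def .
    moreover have "0 < 1 / (1 - l)" "1 / (1 - l) < 1" using 3 by auto
    ultimately obtain c where c: "c > 0"
      "\<And>z x s. good z \<Longrightarrow> margin z j k x \<le> s \<Longrightarrow> margin z i k x \<le> s \<Longrightarrow> c \<le> s"
      using middle_tie[OF _ _ _ dist(2), of "1 / (1 - l)" i] by metis
    then show ?thesis by blast
  qed
qed

text \<open>Non-collinear targets give two transversal slabs. For collinear ones the set is empty
  below a fixed width \<open>c\<close>, and from there on \<open>(s / c)\<^sup>2\<close> is at least
  1.\<close>

lemma prob_triple:
  "\<exists>K>0. \<forall>i j k z s. i \<noteq> j \<longrightarrow> j \<noteq> k \<longrightarrow> i \<noteq> k \<longrightarrow> good z \<longrightarrow> 0 < s \<longrightarrow>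
    prob {x. margin z i k x \<le> s \<and> margin z j k x \<le> s} \<le> K * s\<^sup>2"
proof -
  obtain m M where M: "0 < M" "\<And>x. x \<in> X \<Longrightarrow> \<rho> x \<le> M" using \<rho>_bounds by metis
  obtain R where R: "X \<subseteq> cball 0 R"
    using compact_imp_bounded[OF compact_X] by (auto simp: bounded_iff subset_iff)
  let ?S = "\<lambda>z i j k s. {x. margin z i k x \<le> s \<and> margin z j k x \<le> s}"
    have dist_case: "\<exists>K>0. \<forall>z s. good z \<longrightarrow> 0 < s \<longrightarrow> prob (?S z i j k s) \<le> K * s\<^sup>2" if dist: "i \<noteq> j" "j \<noteq> k" "i \<noteq> k" for i j k
    proof (cases "((y k - y i) \<bullet> (y k - y j))\<^sup>2 = ((y k - y i) \<bullet> (y k - y i)) * ((y k - y j) \<bullet> (y k - y j))")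
      case True
      from collinear_tie[OF dist True] obtain c where c: "c > 0"
        "\<And>z x s. good z \<Longrightarrow> margin z i k x \<le> s \<Longrightarrow> margin z j k x \<le> s \<Longrightarrow> c \<le> s" by blast
      have "prob (?S z i j k s) \<le> (1 / c\<^sup>2) * s\<^sup>2" if "good z" "0 < s" for z s
      proof (cases "?S z i j k s = {}")
        case False
        then have "c \<le> s" using c that by blast
        then have "1 \<le> (s / c)\<^sup>2" using c by simp
        then show ?thesis using prob_le_1[of "?S z i j k s"] by (simp only: power_divide) (simp add: order_trans[OF prob_le_1])
      next
        case True
        show ?thesis unfolding True by simp
      qed
      then show ?thesis using c by (intro exI[of _ "1 / c\<^sup>2"]) auto
    next
      case False
      from double_slab_measure_le[OF this, of R] obtain K where K: "K > 0"
        "\<And>S b b' s. S \<in> lmeasurable \<Longrightarrow> S \<subseteq> cball 0 R \<Longrightarrow> 0 < s \<Longrightarrow>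
          (\<forall>x\<in>S. \<bar>(y k - y i) \<bullet> x - b\<bar> \<le> s \<and> \<bar>(y k - y j) \<bullet> x - b'\<bar> \<le> s) \<Longrightarrow> measure lebesgue S \<le> K * s\<^sup>2" by blast
      have "prob (?S z i j k s) \<le> (M * K) * s\<^sup>2" if "0 < s" for z s
      proof -
        define S where "S = ?S z i j k s \<inter> X"
        have S: "S \<in> sets borel" "S \<subseteq> X" unfolding S_def by auto
        then have "prob S \<le> M * measure lebesgue S" using M by (intro prob_le_lebesgue) auto
        also have "\<dots> \<le> M * (K * s\<^sup>2)"
          using M S R that compact_X by (intro mult_left_mono K(2)[of _ _ "z $ k - z $ i" "z $ k - z $ j"])
            (auto simp: S_def pot_diff intro!: bounded_set_imp_lmeasurable intro: bounded_subset compact_imp_bounded)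
        finally show ?thesis by (subst prob_Int_X) (auto simp: S_def)
      qed
      then show ?thesis using K M by (intro exI[of _ "M * K"]) auto
    qed
  have "\<exists>K>0. \<forall>z s. (i \<noteq> j \<and> j \<noteq> k \<and> i \<noteq> k) \<and> good z \<and> 0 < s \<longrightarrow> prob (?S z i j k s) \<le> K * s\<^sup>2" for i j k
    using dist_case[of i j k] zero_less_one by blast
  then show ?thesis
    using uniform_const[of "\<lambda>(i, j, k) z s. (i \<noteq> j \<and> j \<noteq> k \<and> i \<noteq> k) \<and> good z \<and> 0 < s"
      "\<lambda>(i, j, k) z s. prob (?S z i j k s)" "\<lambda>s. s\<^sup>2"] by force
qed

section \<open>Reflection between two cells\<close>

definition mirror :: "real^'n \<Rightarrow> 'n \<Rightarrow> 'n \<Rightarrow> real^'d \<Rightarrow> real^'d" where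
  "mirror z i k = reflect (y k - y i) (z $ k - z $ i)"

lemma mirror_commute: "mirror z i k = mirror z k i"
proof -
  have "y i - y k = - (y k - y i)" "z $ i - z $ k = - (z $ k - z $ i)" by simp_all
  then show ?thesis
    unfolding mirror_def reflect_def fun_eq_iff
    by (simp only: inner_minus_left inner_minus_right minus_minus minus_diff_minus mult_minus_right
        minus_divide_left[symmetric] scaleR_minus_left scaleR_minus_right) simp
qed

lemma mirror_measurable [measurable]: "mirror z i k \<in> borel_measurable borel"
  unfolding mirror_def by measurable

lemma y_diff: "i \<noteq> k \<Longrightarrow> y k - y i \<noteq> 0"
  using inj_y by (auto dest: injD)

lemma mirror_mirror [simp]: "i \<noteq> k \<Longrightarrow> mirror z i k (mirror z i k x) = x"
  unfolding mirror_def using y_diff by simp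

lemma pot_mirror: "i \<noteq> k \<Longrightarrow> pot z (mirror z i k x) k - pot z (mirror z i k x) i = pot z x i - pot z x k"
proof -
  assume "i \<noteq> k"
  then have "pot z (mirror z i k x) k - pot z (mirror z i k x) i = - (pot z x k - pot z x i)"
    using inner_reflect[OF y_diff[OF \<open>i \<noteq> k\<close>], of "z $ k - z $ i" x] by (simp only: pot_diff mirror_def)
  then show ?thesis by simp
qed

text \<open>Restricted to the side where \<open>k\<close> leads, because \<open>cell_depth\<close>
  provides the deep point on the side of \<open>i\<close>.\<close>

lemma prob_boundary:
  "\<exists>K>0. \<forall>z i k s. i \<noteq> k \<longrightarrow> good z \<longrightarrow> 0 < s \<longrightarrow>
    prob {x \<in> X. 0 \<le> pot z x k - pot z x i \<and> pot z x k - pot z x i \<le> s \<and> mirror z i k x \<notin> X} \<le> K * s\<^sup>2"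
proof -
  obtain m M where M: "0 < M" "\<And>x. x \<in> X \<Longrightarrow> \<rho> x \<le> M" using \<rho>_bounds by metis
  obtain c where c: "c > 0" "\<And>z i k. good z \<Longrightarrow> i \<noteq> k \<Longrightarrow> (\<exists>x\<in>X. pot z x k - pot z x i \<le> - c)"
    using cell_depth by blast
  let ?S = "\<lambda>z i k s. {x \<in> X. 0 \<le> pot z x k - pot z x i \<and> pot z x k - pot z x i \<le> s \<and> mirror z i k x \<notin> X}"
  have "\<exists>K>0. \<forall>z s. i \<noteq> k \<and> good z \<and> 0 < s \<longrightarrow> prob (?S z i k s) \<le> K * s\<^sup>2" for i k
    proof (cases "i = k")
      case False
      define L where "L b s = measure lebesgue {x \<in> X. 0 \<le> (y k - y i) \<bullet> x - b
        \<and> (y k - y i) \<bullet> x - b \<le> s \<and> reflect (y k - y i) b x \<notin> X}" for b s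
      obtain K where K: "K > 0" "\<And>b s. \<exists>x\<in>X. (y k - y i) \<bullet> x - b \<le> - c \<Longrightarrow> 0 < s \<Longrightarrow> L b s \<le> K * s\<^sup>2"
        using reflection_boundary_layer[OF compact_X convex_X y_diff[OF False] c(1), folded L_def] by blast
      have "prob (?S z i k s) \<le> (M * K) * s\<^sup>2" if "good z" "0 < s" for z s
      proof -
        have "prob (?S z i k s) \<le> M * measure lebesgue (?S z i k s)"
          by (rule prob_le_lebesgue) (use M in auto)
        also have "measure lebesgue (?S z i k s) = L (z $ k - z $ i) s"
          by (simp only: pot_diff mirror_def L_def)
        also have "L (z $ k - z $ i) s \<le> K * s\<^sup>2"
          by (rule K(2)[OF _ that(2)]) (use c(2)[OF that(1) False] in \<open>simp only: pot_diff\<close>)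
        finally show ?thesis using M by simp
      qed
      then show ?thesis using K M by (intro exI[of _ "M * K"]) auto
    qed (auto intro: exI[of _ 1])
  then show ?thesis
    using uniform_const[of "\<lambda>(i, k) z s. i \<noteq> k \<and> good z \<and> 0 < s"
      "\<lambda>(i, k) z s. prob (?S z i k s)" "\<lambda>s. s\<^sup>2"] by force
qed

end

section \<open>Mass exchanged between two cells\<close>

context semidiscrete
begin

lemma integral_abs_le:
  assumes [measurable]: "f \<in> borel_measurable borel" "g \<in> borel_measurable borel"
    and fg: "\<And>x. x \<in> X \<Longrightarrow> \<bar>f x :: real\<bar> \<le> g x" and g: "\<And>x. x \<in> X \<Longrightarrow> g x \<le> B"
  shows "\<bar>expectation f\<bar> \<le> expectation g"
proof -
  have "\<bar>g x\<bar> \<le> B" "\<bar>f x\<bar> \<le> B" if "x \<in> X" for x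
    using fg[OF that] g[OF that] by linarith+
  then have int: "integrable P g" "integrable P f" by (intro integrable_bounded[of _ B]; simp)+
  then have "expectation (\<lambda>x. \<bar>f x\<bar>) \<le> expectation g"
    using AE_X fg by (intro integral_mono_AE integrable_abs int) auto
  then show ?thesis using integral_abs_bound[of P f] by linarith
qed

lemma integral_tie: "\<exists>K>0. \<forall>i k z \<epsilon>. i \<noteq> k \<longrightarrow> 0 < \<epsilon> \<longrightarrow> expectation (\<lambda>x. exp (- margin z i k x / \<epsilon>)) \<le> K * \<epsilon>"
proof -
  obtain K where K: "K > 0" "\<And>z i k s. i \<noteq> k \<Longrightarrow> 0 < s \<Longrightarrow> prob {x. margin z i k x \<le> s} \<le> K * s"
    using prob_pot_slab by blast
  define c where "c = (\<Sum>n. exp (- real n) * (real n + 1) ^ 1)"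
  have c: "c > 0" unfolding c_def by (intro suminf_pos summable_exp_poly) auto
  have "expectation (\<lambda>x. exp (- margin z i k x / \<epsilon>)) \<le> c * K * \<epsilon>" if "i \<noteq> k" "0 < \<epsilon>" for i k z \<epsilon>
  proof -
    have "expectation (\<lambda>x. indicator UNIV x * exp (- margin z i k x / \<epsilon>)) \<le> c * K * \<epsilon> ^ 1"
      unfolding c_def by (rule layer_cake_exp) (use K(2)[OF that(1)] that in simp_all)
    then show ?thesis by simp
  qed
  then show ?thesis using c K by (intro exI[of _ "c * K"]) auto
qed

lemma integral_triple:
  "\<exists>K>0. \<forall>i j k z \<epsilon>. i \<noteq> j \<longrightarrow> j \<noteq> k \<longrightarrow> i \<noteq> k \<longrightarrow> good z \<longrightarrow> 0 < \<epsilon> \<longrightarrow>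
    expectation (\<lambda>x. exp (- (margin z i k x + margin z j k x) / \<epsilon>)) \<le> K * \<epsilon>\<^sup>2"
proof -
  obtain K where K: "K > 0" "\<And>i j k z s. i \<noteq> j \<Longrightarrow> j \<noteq> k \<Longrightarrow> i \<noteq> k \<Longrightarrow> good z \<Longrightarrow> 0 < s \<Longrightarrow>
    prob {x. margin z i k x \<le> s \<and> margin z j k x \<le> s} \<le> K * s\<^sup>2"
    using prob_triple by blast
  define c where "c = (\<Sum>n. exp (- real n) * (real n + 1)\<^sup>2)"
  have c: "c > 0" unfolding c_def by (intro suminf_pos summable_exp_poly) auto
  have "expectation (\<lambda>x. exp (- (margin z i k x + margin z j k x) / \<epsilon>)) \<le> c * K * \<epsilon>\<^sup>2"
    if "i \<noteq> j" "j \<noteq> k" "i \<noteq> k" "good z" "0 < \<epsilon>" for i j k z \<epsilon>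
  proof -
    have "prob {x \<in> UNIV. margin z i k x + margin z j k x \<le> s} \<le> K * s\<^sup>2" if "0 < s" for s
    proof -
      have "prob {x \<in> UNIV. margin z i k x + margin z j k x \<le> s}
          \<le> prob {x. margin z i k x \<le> s \<and> margin z j k x \<le> s}"
        by (intro finite_measure_mono) auto
      also have "\<dots> \<le> K * s\<^sup>2" by (rule K) fact+
      finally show ?thesis .
    qed
    then have "expectation (\<lambda>x. indicator UNIV x * exp (- (margin z i k x + margin z j k x) / \<epsilon>)) \<le> c * K * \<epsilon>\<^sup>2"
      unfolding c_def using that by (intro layer_cake_exp) auto
    then show ?thesis by simp
  qed
  then show ?thesis using c K by (intro exI[of _ "c * K"]) auto
qed

lemma pot_lipschitz: "\<exists>Y>0. \<forall>z x x' j. \<bar>pot z x j - pot z x' j\<bar> \<le> Y * norm (x - x')"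
proof -
  have "\<bar>pot z x j - pot z x' j\<bar> \<le> (1 + (\<Sum>j\<in>UNIV. norm (y j))) * norm (x - x')" for z x x' j
  proof -
    have "\<bar>pot z x j - pot z x' j\<bar> = \<bar>(x - x') \<bullet> y j\<bar>" by (simp add: pot_def inner_diff_left)
    also have "\<dots> \<le> norm (x - x') * norm (y j)" by (rule Cauchy_Schwarz_ineq2)
    also have "\<dots> \<le> norm (x - x') * (1 + (\<Sum>j\<in>UNIV. norm (y j)))"
      using member_le_sum[of j UNIV "\<lambda>j. norm (y j)"] by (intro mult_left_mono) auto
    finally show ?thesis by (simp add: mult.commute)
  qed
  moreover have "1 + (\<Sum>j\<in>UNIV. norm (y j)) > 0" by (intro add_pos_nonneg sum_nonneg) auto
  ultimately show ?thesis by blast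
qed

lemma mirror_dist: "\<exists>D>0. \<forall>z i k x. i \<noteq> k \<longrightarrow> norm (mirror z i k x - x) \<le> D * margin z i k x"
proof -
  have "\<exists>D>0. \<forall>z x. i \<noteq> k \<longrightarrow> norm (mirror z i k x - x) \<le> D * margin z i k x" for i k
  proof (cases "i = k")
    case False
    then show ?thesis
      using y_diff[OF False] norm_reflect_diff[OF y_diff[OF False]]
      by (intro exI[of _ "2 / norm (y k - y i)"]) (simp add: mirror_def pot_diff)
  qed (auto intro: exI[of _ 1])
  then obtain D where D: "\<And>i k. D i k > 0" "\<And>i k z x. i \<noteq> k \<Longrightarrow> norm (mirror z i k x - x) \<le> D i k * margin z i k x"
    by metis
  define D' where "D' = (\<Sum>i\<in>UNIV. \<Sum>k\<in>UNIV. D i k)"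
  have le: "D i k \<le> D'" for i k
  proof -
    have "D i k \<le> (\<Sum>k\<in>UNIV. D i k)" using D by (intro member_le_sum) (auto intro: less_imp_le)
    also have "\<dots> \<le> D'" unfolding D'_def using D
      by (intro member_le_sum[of _ _ "\<lambda>i. \<Sum>k\<in>UNIV. D i k"] sum_nonneg less_imp_le[OF D(1)]) auto
    finally show ?thesis .
  qed
  have "norm (mirror z i k x - x) \<le> D' * margin z i k x" if "i \<noteq> k" for i k z x
    using D(2)[OF that] le[of i k] by (meson abs_ge_zero mult_right_mono order_trans)
  moreover have "D' > 0" using le D(1) by (meson less_le_trans)
  ultimately show ?thesis by blast
qed

text \<open>A point of the cell of \<open>k\<close> whose mirror image leaves the cell of \<open>i\<close> is close to \<open>\<partial>X\<close> or to a third cell.\<close>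

lemma prob_mirror_mismatch:
  "\<exists>K>0. \<forall>i k z s. i \<noteq> k \<longrightarrow> good z \<longrightarrow> 0 < s \<longrightarrow>
    prob {x \<in> {x \<in> cell z k. mirror z i k x \<notin> cell z i}. margin z i k x \<le> s} \<le> K * s\<^sup>2"
proof -
  obtain K1 where K1: "K1 > 0" "\<And>z i k s. i \<noteq> k \<Longrightarrow> good z \<Longrightarrow> 0 < s \<Longrightarrow>
    prob {x \<in> X. 0 \<le> pot z x k - pot z x i \<and> pot z x k - pot z x i \<le> s \<and> mirror z i k x \<notin> X} \<le> K1 * s\<^sup>2"
    using prob_boundary by blast
  obtain K2 where K2: "K2 > 0" "\<And>i j k z s. i \<noteq> j \<Longrightarrow> j \<noteq> k \<Longrightarrow> i \<noteq> k \<Longrightarrow> good z \<Longrightarrow> 0 < s \<Longrightarrow>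
    prob {x. margin z i k x \<le> s \<and> margin z j k x \<le> s} \<le> K2 * s\<^sup>2"
    using prob_triple by blast
  obtain Y where Y: "Y > 0" "\<And>z x x' j. \<bar>pot z x j - pot z x' j\<bar> \<le> Y * norm (x - x')" using pot_lipschitz by blast
  obtain D where D: "D > 0" "\<And>z i k x. i \<noteq> k \<Longrightarrow> norm (mirror z i k x - x) \<le> D * margin z i k x"
    using mirror_dist by blast
  \<comment> \<open>Mirroring moves \<open>x\<close> by at most \<open>D * s\<close> and changes
    each potential by at most \<open>Y * D * s\<close>. Two potentials are compared, so the lead of
    \<open>k\<close> over a third cell is at most \<open>s + 2 * Y * D * s\<close>.\<close>
  define C where "C = 1 + 2 * Y * D"
  have C: "C \<ge> 1" using Y D by (simp add: C_def)
  define K where "K = K1 + CARD('n) * (K2 * C\<^sup>2)"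
  have "prob {x \<in> {x \<in> cell z k. mirror z i k x \<notin> cell z i}. margin z i k x \<le> s} \<le> K * s\<^sup>2"
    if ik: "i \<noteq> k" and z: "good z" and s: "0 < s" for i k z s
  proof -
    define S1 where "S1 = {x \<in> X. 0 \<le> pot z x k - pot z x i \<and> pot z x k - pot z x i \<le> s \<and> mirror z i k x \<notin> X}"
    define S2 where "S2 j = {x. margin z i k x \<le> C * s \<and> margin z j k x \<le> C * s}" for j
    have [measurable]: "S1 \<in> sets borel" "\<And>j. S2 j \<in> sets borel" unfolding S1_def S2_def by measurable
    have "{x \<in> {x \<in> cell z k. mirror z i k x \<notin> cell z i}. margin z i k x \<le> s} \<subseteq> S1 \<union> (\<Union>j\<in>UNIV - {i, k}. S2 j)"
    proof clarify
      fix x assume x: "x \<in> cell z k" "mirror z i k x \<notin> cell z i" "margin z i k x \<le> s"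
        and notin: "x \<notin> (\<Union>j\<in>UNIV - {i, k}. S2 j)"
      define x' where "x' = mirror z i k x"
      have xX: "x \<in> X" and ge: "\<And>j. pot z x j \<le> pot z x k" using x by (auto simp: cell_eq)
      show "x \<in> S1"
      proof (rule ccontr)
        assume "x \<notin> S1"
        then have "x' \<in> X" using xX ge[of i] x by (auto simp: S1_def x'_def)
        then obtain j where j: "pot z x' j > pot z x' i" using x(2) by (auto simp: cell_eq x'_def not_le)
        \<comment> \<open>In the mirror image \<open>i\<close> is ahead of \<open>k\<close>, so an
          index that beats \<open>i\<close> belongs to a third cell.\<close>
        have "pot z x' i \<ge> pot z x' k" using pot_mirror[OF ik, of z x] ge[of i] by (simp add: x'_def)
        then have jk: "j \<noteq> k" "j \<noteq> i" using j by auto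
        have d: "Y * norm (x - x') \<le> Y * (D * s)"
        proof (rule mult_left_mono)
          have "D * margin z i k x \<le> D * s" using x(3) D(1) by simp
          then show "norm (x - x') \<le> D * s"
            using D(2)[OF ik, of z x] by (simp add: x'_def norm_minus_commute)
        qed (use Y in simp)
        have "pot z x k - pot z x j \<le> s + 2 * (Y * (D * s))"
          using Y(2)[of z x i x'] Y(2)[of z x j x'] x(3) j d by linarith
        also have "\<dots> = C * s" by (simp add: C_def algebra_simps)
        finally have "margin z j k x \<le> C * s" using ge[of j] by simp
        moreover have "margin z i k x \<le> C * s" using x(3) s C mult_right_mono[of 1 C s] by linarith
        ultimately show False using notin jk by (auto simp: S2_def)
      qed
    qed
    then have "prob {x \<in> {x \<in> cell z k. mirror z i k x \<notin> cell z i}. margin z i k x \<le> s}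
        \<le> prob (S1 \<union> (\<Union>j\<in>UNIV - {i, k}. S2 j))"
      by (intro finite_measure_mono) auto
    also have "\<dots> \<le> prob S1 + prob (\<Union>j\<in>UNIV - {i, k}. S2 j)"
      by (intro measure_Un_le) auto
    also have "\<dots> \<le> prob S1 + (\<Sum>j\<in>UNIV - {i, k}. prob (S2 j))"
      by (intro add_left_mono measure_UNION_le) auto
    also have "\<dots> \<le> K1 * s\<^sup>2 + (\<Sum>j\<in>UNIV - {i, k}. K2 * (C * s)\<^sup>2)"
      unfolding S1_def S2_def using C s by (intro add_mono sum_mono K1(2)[OF ik z s] K2(2)[OF _ _ ik z]) auto
    also have "\<dots> \<le> K1 * s\<^sup>2 + (\<Sum>j\<in>(UNIV::'n set). K2 * (C * s)\<^sup>2)"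
      using K2 by (intro add_left_mono sum_mono2) auto
    also have "\<dots> = K * s\<^sup>2" by (simp add: K_def power_mult_distrib algebra_simps)
    finally show ?thesis .
  qed
  moreover have "K > 0" unfolding K_def using K1 K2 by (intro add_pos_nonneg) auto
  ultimately show ?thesis by blast
qed

lemma integral_mirror_mismatch:
  "\<exists>K>0. \<forall>i k z \<epsilon>. i \<noteq> k \<longrightarrow> good z \<longrightarrow> 0 < \<epsilon> \<longrightarrow>
    expectation (\<lambda>x. indicator {x \<in> cell z k. mirror z i k x \<notin> cell z i} x * exp (- margin z i k x / \<epsilon>)) \<le> K * \<epsilon>\<^sup>2"
proof -
  obtain K where K: "K > 0" "\<And>i k z s. i \<noteq> k \<Longrightarrow> good z \<Longrightarrow> 0 < s \<Longrightarrow>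
    prob {x \<in> {x \<in> cell z k. mirror z i k x \<notin> cell z i}. margin z i k x \<le> s} \<le> K * s\<^sup>2"
    using prob_mirror_mismatch by blast
  define c where "c = (\<Sum>n. exp (- real n) * (real n + 1)\<^sup>2)"
  have c: "c > 0" unfolding c_def by (intro suminf_pos summable_exp_poly) auto
  have "expectation (\<lambda>x. indicator {x \<in> cell z k. mirror z i k x \<notin> cell z i} x * exp (- margin z i k x / \<epsilon>)) \<le> c * K * \<epsilon>\<^sup>2"
    if "i \<noteq> k" "good z" "0 < \<epsilon>" for i k z \<epsilon>
    unfolding c_def by (rule layer_cake_exp) (use K(2)[OF that(1,2)] that in simp_all)
  then show ?thesis using c K by (intro exI[of _ "c * K"]) auto
qed

text \<open>Half of the decay pays for the power of the margin, the rest is a tie integral at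
  temperature \<open>2 * \<epsilon>\<close>; each contributes a factor 2 to the constant
  \<open>4 * K\<close>.\<close>

lemma integral_tie_powr:
  "\<exists>K>0. \<forall>i k z \<epsilon>. i \<noteq> k \<longrightarrow> 0 < \<epsilon> \<longrightarrow>
    expectation (\<lambda>x. margin z i k x powr \<alpha> * exp (- margin z i k x / \<epsilon>)) \<le> K * \<epsilon> powr (1 + \<alpha>)"
proof -
  obtain K where K: "K > 0" "\<And>i k z \<epsilon>. i \<noteq> k \<Longrightarrow> 0 < \<epsilon> \<Longrightarrow> expectation (\<lambda>x. exp (- margin z i k x / \<epsilon>)) \<le> K * \<epsilon>"
    using integral_tie by blast
  have "expectation (\<lambda>x. margin z i k x powr \<alpha> * exp (- margin z i k x / \<epsilon>)) \<le> (4 * K) * \<epsilon> powr (1 + \<alpha>)"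
    if ik: "i \<noteq> k" and \<epsilon>: "0 < \<epsilon>" for i k z \<epsilon>
  proof -
    let ?t = "\<lambda>x. margin z i k x"
    have le: "?t x powr \<alpha> * exp (- ?t x / \<epsilon>) \<le> 2 * \<epsilon> powr \<alpha> * exp (- ?t x / (2 * \<epsilon>))" for x
    proof -
      have "(?t x / \<epsilon>) powr \<alpha> * exp (- (?t x / \<epsilon>)) \<le> 2 * exp (- (?t x / \<epsilon>) / 2)"
        using \<epsilon> by (intro powr_exp_le \<alpha>_pos \<alpha>_le) auto
      then have "\<epsilon> powr \<alpha> * ((?t x / \<epsilon>) powr \<alpha> * exp (- (?t x / \<epsilon>))) \<le> \<epsilon> powr \<alpha> * (2 * exp (- (?t x / \<epsilon>) / 2))"
        by (rule mult_left_mono) simp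
      moreover have "\<epsilon> powr \<alpha> * (?t x / \<epsilon>) powr \<alpha> = ?t x powr \<alpha>"
        using \<epsilon> by (simp add: powr_mult[symmetric])
      ultimately show ?thesis by (simp add: mult.assoc[symmetric]) (simp add: mult_ac)
    qed
    have "\<bar>expectation (\<lambda>x. ?t x powr \<alpha> * exp (- ?t x / \<epsilon>))\<bar> \<le> expectation (\<lambda>x. 2 * \<epsilon> powr \<alpha> * exp (- ?t x / (2 * \<epsilon>)))"
      using le \<epsilon> by (intro integral_abs_le[of _ _ "2 * \<epsilon> powr \<alpha>"]) (auto simp: abs_mult mult_le_cancel_left1)
    also have "\<dots> \<le> 2 * \<epsilon> powr \<alpha> * (K * (2 * \<epsilon>))"
      using K(2)[OF ik, of "2 * \<epsilon>" z] \<epsilon> by (simp add: mult_left_mono)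
    also have "\<dots> = (4 * K) * \<epsilon> powr (1 + \<alpha>)" using \<epsilon> by (simp add: powr_add mult_ac)
    finally show ?thesis by linarith
  qed
  then show ?thesis using K by (intro exI[of _ "4 * K"]) auto
qed

text \<open>Scalar test functions. For a Borel field \<open>\<phi>\<close> of Hoelder norm at most 1
  the functions \<open>\<phi> x \<bullet> y i\<close> are of this kind, with \<open>B\<close> the
  sum of the norms of the targets.\<close>

definition admissible :: "real \<Rightarrow> (real^'d \<Rightarrow> real) \<Rightarrow> bool" where
  "admissible B \<phi> \<longleftrightarrow> \<phi> \<in> borel_measurable borel \<and> (\<forall>x\<in>X. \<bar>\<phi> x\<bar> \<le> B) \<and>
    (\<forall>x\<in>X. \<forall>x'\<in>X. \<bar>\<phi> x - \<phi> x'\<bar> \<le> B * norm (x - x') powr \<alpha>)"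

text \<open>Reflection preserves Lebesgue measure and not \<open>P\<close>, so the modulus of
  \<open>\<phi>\<close> times the density is what counts. The factor \<open>\<rho> x\<close> on the
  right, gained from the lower bound on the density, turns the Lebesgue integral back into an
  expectation.\<close>

lemma admissible_density: "\<exists>H>0. \<forall>\<phi>. admissible B \<phi> \<longrightarrow> (\<forall>x\<in>X. \<forall>x'\<in>X.
  \<bar>\<phi> x * \<rho> x - \<phi> x' * \<rho> x'\<bar> \<le> H * norm (x - x') powr \<alpha> * \<rho> x)"
proof -
  obtain m M where mM: "0 < m" "0 < M" "\<And>x. x \<in> X \<Longrightarrow> m \<le> \<rho> x" "\<And>x. x \<in> X \<Longrightarrow> \<rho> x \<le> M" using \<rho>_bounds by blast
  obtain L where L: "L-lipschitz_on X \<rho>" using \<rho>_lipschitz by blast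
  obtain R where R: "R > 0" "\<And>x. x \<in> X \<Longrightarrow> norm x \<le> R"
    using compact_imp_bounded[OF compact_X] by (auto simp: bounded_pos)
  \<comment> \<open>Exceeds both 1 and the diameter of \<open>X\<close>, so that distances are at
    most \<open>D\<close> times their \<alpha>-th power and the Lipschitz bound on the density
    becomes a Hoelder bound.\<close>
  define D where "D = 1 + 2 * R"
  have D: "D \<ge> 1" using R by (simp add: D_def)
  have L0: "L \<ge> 0" using L by (rule lipschitz_on_nonneg)
  have pw: "norm (x - x') \<le> D * norm (x - x') powr \<alpha>" if "x \<in> X" "x' \<in> X" for x x'
  proof -
    define r where "r = norm (x - x')"
    have r: "0 \<le> r" "r \<le> D"
      using norm_triangle_ineq4[of x x'] R(2)[OF that(1)] R(2)[OF that(2)] by (auto simp: r_def D_def)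
    have "r \<le> D * r powr \<alpha>"
    proof (cases "r \<le> 1")
      case True
      have "r powr 1 \<le> r powr \<alpha>"
        using True r \<alpha>_le powr_mono'[of \<alpha> 1 r] by simp
      also have "\<dots> \<le> D * r powr \<alpha>" using D mult_right_mono[of 1 D "r powr \<alpha>"] by simp
      finally show ?thesis using r by (cases "r = 0") auto
    next
      case False
      then have "1 \<le> r powr \<alpha>" using \<alpha>_pos by (simp add: ge_one_powr_ge_zero)
      then show ?thesis using r D mult_mono[of r D 1 "r powr \<alpha>"] by simp
    qed
    then show ?thesis by (simp add: r_def)
  qed
  define H where "H = (\<bar>B\<bar> * M + \<bar>B\<bar> * L * D) / m"
  have H0: "H \<ge> 0" using mM L0 D by (simp add: H_def)
  have "\<bar>\<phi> x * \<rho> x - \<phi> x' * \<rho> x'\<bar> \<le> (H + 1) * norm (x - x') powr \<alpha> * \<rho> x"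
    if \<phi>: "admissible B \<phi>" and x: "x \<in> X" "x' \<in> X" for \<phi> x x'
  proof -
    have "\<phi> x * \<rho> x - \<phi> x' * \<rho> x' = (\<phi> x - \<phi> x') * \<rho> x + \<phi> x' * (\<rho> x - \<rho> x')"
      by (simp add: algebra_simps)
    then have "\<bar>\<phi> x * \<rho> x - \<phi> x' * \<rho> x'\<bar> \<le> \<bar>\<phi> x - \<phi> x'\<bar> * \<rho> x + \<bar>\<phi> x'\<bar> * \<bar>\<rho> x - \<rho> x'\<bar>"
      using abs_triangle_ineq[of "(\<phi> x - \<phi> x') * \<rho> x" "\<phi> x' * (\<rho> x - \<rho> x')"] \<rho>_nonneg[of x] by (simp add: abs_mult)
    also have "\<dots> \<le> (\<bar>B\<bar> * norm (x - x') powr \<alpha>) * M + \<bar>B\<bar> * (L * (D * norm (x - x') powr \<alpha>))"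
    proof (intro add_mono mult_mono)
      have "\<bar>\<phi> x - \<phi> x'\<bar> \<le> B * norm (x - x') powr \<alpha>" using \<phi> x by (auto simp: admissible_def)
      also have "\<dots> \<le> \<bar>B\<bar> * norm (x - x') powr \<alpha>" by (intro mult_right_mono) auto
      finally show "\<bar>\<phi> x - \<phi> x'\<bar> \<le> \<bar>B\<bar> * norm (x - x') powr \<alpha>" .
      show "\<bar>\<phi> x'\<bar> \<le> \<bar>B\<bar>" using \<phi> x by (fastforce simp: admissible_def)
      have "\<bar>\<rho> x - \<rho> x'\<bar> \<le> L * norm (x - x')"
        using lipschitz_onD[OF L x] by (simp add: dist_norm)
      also have "\<dots> \<le> L * (D * norm (x - x') powr \<alpha>)" using pw[OF x] L0 by (rule mult_left_mono)
      finally show "\<bar>\<rho> x - \<rho> x'\<bar> \<le> L * (D * norm (x - x') powr \<alpha>)" .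
    qed (use mM x \<rho>_nonneg in auto)
    also have "\<dots> = H * norm (x - x') powr \<alpha> * m" using mM by (simp add: H_def field_simps)
    also have "\<dots> \<le> (H + 1) * norm (x - x') powr \<alpha> * \<rho> x"
      using H0 mM x by (intro mult_mono) auto
    finally show ?thesis .
  qed
  then show ?thesis using H0 by (intro exI[of _ "H + 1"]) auto
qed

section \<open>Logistic approximation and its symmetry\<close>

abbreviation tie :: "real \<Rightarrow> real^'n \<Rightarrow> 'n \<Rightarrow> 'n \<Rightarrow> real^'d \<Rightarrow> real" where
  "tie \<epsilon> z i k x \<equiv> exp (- margin z i k x / \<epsilon>)"

text \<open>The softmax weight of the loser among two competitors. Being a function of the margin
  alone, it is symmetric in \<open>i\<close> and \<open>k\<close> and invariant under the mirror,
  which the full softmax weight need not be.\<close>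

definition lgst :: "real \<Rightarrow> real^'n \<Rightarrow> 'n \<Rightarrow> 'n \<Rightarrow> real^'d \<Rightarrow> real" where
  "lgst \<epsilon> z i k x = tie \<epsilon> z i k x / (1 + tie \<epsilon> z i k x)"

lemma lgst_measurable [measurable]: "lgst \<epsilon> z i k \<in> borel_measurable borel"
  unfolding lgst_def[abs_def] by measurable

lemma lgst_bounds: "0 \<le> lgst \<epsilon> z i k x" "lgst \<epsilon> z i k x \<le> tie \<epsilon> z i k x"
  by (auto simp: lgst_def divide_le_eq add_pos_nonneg distrib_left)

lemma tie_le_1: "0 < \<epsilon> \<Longrightarrow> tie \<epsilon> z i k x \<le> 1"
  by simp

lemma lgst_commute: "lgst \<epsilon> z i k = lgst \<epsilon> z k i"
  unfolding lgst_def abs_minus_commute[of "pot z _ k"] ..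

lemma lgst_mirror: "i \<noteq> k \<Longrightarrow> lgst \<epsilon> z i k (mirror z i k x) = lgst \<epsilon> z i k x"
  by (simp add: lgst_def pot_mirror abs_minus_commute)

text \<open>On the cell of \<open>k\<close> the error of the logistic weight decays in two margins
  at once, and \<open>integral_triple\<close> makes its integral quadratic in \<epsilon>.\<close>

lemma softmax_cell_approx:
  "\<exists>K>0. \<forall>\<phi> i k z \<epsilon>. admissible B \<phi> \<longrightarrow> i \<noteq> k \<longrightarrow> good z \<longrightarrow> 0 < \<epsilon> \<longrightarrow>
    \<bar>expectation (\<lambda>x. indicator (cell z k) x * \<phi> x * p \<epsilon> z x i)
      - expectation (\<lambda>x. indicator (cell z k) x * \<phi> x * lgst \<epsilon> z i k x)\<bar> \<le> K * \<epsilon>\<^sup>2"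
proof -
  obtain K where K: "K > 0" "\<And>i j k z \<epsilon>. i \<noteq> j \<Longrightarrow> j \<noteq> k \<Longrightarrow> i \<noteq> k \<Longrightarrow> good z \<Longrightarrow> 0 < \<epsilon> \<Longrightarrow>
    expectation (\<lambda>x. exp (- (margin z i k x + margin z j k x) / \<epsilon>)) \<le> K * \<epsilon>\<^sup>2"
    using integral_triple by blast
  define K' where "K' = \<bar>B\<bar> * (CARD('n) * K) + 1"
  have K': "K' > 0" using K by (auto simp: K'_def intro: add_nonneg_pos)
  have "\<bar>expectation (\<lambda>x. indicator (cell z k) x * \<phi> x * p \<epsilon> z x i)
      - expectation (\<lambda>x. indicator (cell z k) x * \<phi> x * lgst \<epsilon> z i k x)\<bar> \<le> K' * \<epsilon>\<^sup>2"
    if adm: "admissible B \<phi>" and ik: "i \<noteq> k" and z: "good z" and \<epsilon>: "0 < \<epsilon>" for \<phi> i k z \<epsilon>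
  proof -
    have [measurable]: "\<phi> \<in> borel_measurable borel" and \<phi>: "\<And>x. x \<in> X \<Longrightarrow> \<bar>\<phi> x\<bar> \<le> \<bar>B\<bar>"
      using adm by (fastforce simp: admissible_def)+
    let ?e = "\<lambda>x j. exp (- (margin z i k x + margin z j k x) / \<epsilon>)"
    let ?J = "UNIV - {i, k}"
    have le1: "?e x j \<le> 1" for x j using \<epsilon> by (simp add: divide_nonpos_pos)
    have p01: "\<bar>p \<epsilon> z x i\<bar> \<le> 1" for x
      using softmax_pos[of "\<lambda>i. pot z x i / \<epsilon>" i] softmax_le_1[of "\<lambda>i. pot z x i / \<epsilon>" i] by (simp add: p_def)
    have l01: "\<bar>lgst \<epsilon> z i k x\<bar> \<le> 1" for x using lgst_bounds[where \<epsilon>=\<epsilon> and z=z and i=i and k=k and x=x] tie_le_1[OF \<epsilon>, where z=z and i=i and k=k and x=x] by linarith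
    have ind: "\<bar>indicator (cell z k) x * \<phi> x * r\<bar> \<le> \<bar>B\<bar>" if "\<bar>r\<bar> \<le> 1" "x \<in> X" for r x
      using mult_mono[OF \<phi>[OF that(2)] that(1)] by (simp add: abs_mult indicator_def)
    have "expectation (\<lambda>x. indicator (cell z k) x * \<phi> x * p \<epsilon> z x i)
        - expectation (\<lambda>x. indicator (cell z k) x * \<phi> x * lgst \<epsilon> z i k x)
      = expectation (\<lambda>x. indicator (cell z k) x * \<phi> x * (p \<epsilon> z x i - lgst \<epsilon> z i k x))"
      unfolding right_diff_distrib
      by (rule Bochner_Integration.integral_diff[symmetric]; rule integrable_bounded[of _ "\<bar>B\<bar>"])
        (use ind p01 l01 in auto)
    also have "\<bar>\<dots>\<bar> \<le> expectation (\<lambda>x. \<bar>B\<bar> * (\<Sum>j\<in>?J. ?e x j))"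
    proof (rule integral_abs_le)
      fix x assume x: "x \<in> X"
      show "\<bar>indicator (cell z k) x * \<phi> x * (p \<epsilon> z x i - lgst \<epsilon> z i k x)\<bar> \<le> \<bar>B\<bar> * (\<Sum>j\<in>?J. ?e x j)"
      proof (cases "x \<in> cell z k")
        case True
        then have ge: "pot z x j \<le> pot z x k" for j by (auto simp: cell_eq)
        have "\<bar>p \<epsilon> z x i - lgst \<epsilon> z i k x\<bar> \<le> (\<Sum>j\<in>?J. ?e x j)"
          using softmax_approx_logistic[OF ik, of "\<lambda>i. pot z x i / \<epsilon>"] ge \<epsilon>
          by (simp add: p_def lgst_def divide_right_mono diff_divide_distrib[symmetric] sum_distrib_left
              exp_add[symmetric] add_divide_distrib[symmetric] minus_divide_left algebra_simps)
        then have "\<bar>\<phi> x\<bar> * \<bar>p \<epsilon> z x i - lgst \<epsilon> z i k x\<bar> \<le> \<bar>B\<bar> * (\<Sum>j\<in>?J. ?e x j)"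
          using \<phi>[OF x] by (intro mult_mono) auto
        then show ?thesis using True by (simp add: abs_mult)
      qed (simp add: sum_nonneg)
      show "\<bar>B\<bar> * (\<Sum>j\<in>?J. ?e x j) \<le> \<bar>B\<bar> * (\<Sum>j\<in>?J. 1)"
        using le1 by (intro mult_left_mono sum_mono) auto
    qed auto
    also have "\<dots> = \<bar>B\<bar> * (\<Sum>j\<in>?J. expectation (\<lambda>x. ?e x j))"
      using le1 by (subst integral_mult_right_zero, subst Bochner_Integration.integral_sum) (auto intro!: integrable_bounded[of _ 1])
    also have "\<dots> \<le> \<bar>B\<bar> * (\<Sum>j\<in>?J. K * \<epsilon>\<^sup>2)"
      by (intro mult_left_mono sum_mono K(2)) (use ik z \<epsilon> in auto)
    also have "\<dots> \<le> \<bar>B\<bar> * (\<Sum>j\<in>(UNIV::'n set). K * \<epsilon>\<^sup>2)"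
      using K by (intro mult_left_mono sum_mono2) auto
    also have "\<dots> \<le> K' * \<epsilon>\<^sup>2" by (simp add: K'_def algebra_simps)
    finally show ?thesis .
  qed
  then show ?thesis using K' by blast
qed

text \<open>The mirror exchanges \<open>G i k\<close> and \<open>G k i\<close>, the matching parts
  of the two cells. After the change of variables only the variation of \<open>\<phi>\<close> times
  the density over a distance of order \<open>margin\<close> remains, which \<open>tie\<close>
  weights down to order \<open>\<epsilon> powr (1 + \<alpha>)\<close>. The unmatched parts
  \<open>N\<close> are quadratic in \<epsilon>.\<close>

lemma lgst_exchange:
  "\<exists>K>0. \<forall>\<phi> i k z \<epsilon>. admissible B \<phi> \<longrightarrow> i \<noteq> k \<longrightarrow> good z \<longrightarrow> 0 < \<epsilon> \<longrightarrow>
    \<bar>expectation (\<lambda>x. indicator (cell z k) x * \<phi> x * lgst \<epsilon> z i k x)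
      - expectation (\<lambda>x. indicator (cell z i) x * \<phi> x * lgst \<epsilon> z i k x)\<bar> \<le> K * (\<epsilon> powr (1 + \<alpha>) + \<epsilon>\<^sup>2)"
proof -
  obtain K1 where K1: "K1 > 0" "\<And>i k z \<epsilon>. i \<noteq> k \<Longrightarrow> good z \<Longrightarrow> 0 < \<epsilon> \<Longrightarrow>
    expectation (\<lambda>x. indicator {x \<in> cell z k. mirror z i k x \<notin> cell z i} x * tie \<epsilon> z i k x) \<le> K1 * \<epsilon>\<^sup>2"
    using integral_mirror_mismatch by blast
  obtain K2 where K2: "K2 > 0" "\<And>i k z \<epsilon>. i \<noteq> k \<Longrightarrow> 0 < \<epsilon> \<Longrightarrow>
    expectation (\<lambda>x. margin z i k x powr \<alpha> * tie \<epsilon> z i k x) \<le> K2 * \<epsilon> powr (1 + \<alpha>)"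
    using integral_tie_powr by blast
  obtain H where H: "H > 0" "\<And>\<phi> x x'. admissible B \<phi> \<Longrightarrow> x \<in> X \<Longrightarrow> x' \<in> X \<Longrightarrow>
    \<bar>\<phi> x * \<rho> x - \<phi> x' * \<rho> x'\<bar> \<le> H * norm (x - x') powr \<alpha> * \<rho> x"
    using admissible_density[of B] by blast
  obtain D where D: "D > 0" "\<And>z i k x. i \<noteq> k \<Longrightarrow> norm (mirror z i k x - x) \<le> D * margin z i k x"
    using mirror_dist by blast
  obtain R where R: "R > 0" "\<And>x. x \<in> X \<Longrightarrow> norm x \<le> R"
    using compact_imp_bounded[OF compact_X] by (auto simp: bounded_pos)
  obtain Y where Y: "Y > 0" "\<And>z x x' j. \<bar>pot z x j - pot z x' j\<bar> \<le> Y * norm (x - x')" using pot_lipschitz by blast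
  define K where "K = 2 * \<bar>B\<bar> * K1 + H * D powr \<alpha> * K2"
  have K: "K > 0" using K1 H D K2 by (auto simp: K_def intro: add_nonneg_pos)
  have "\<bar>expectation (\<lambda>x. indicator (cell z k) x * \<phi> x * lgst \<epsilon> z i k x)
      - expectation (\<lambda>x. indicator (cell z i) x * \<phi> x * lgst \<epsilon> z i k x)\<bar> \<le> K * (\<epsilon> powr (1 + \<alpha>) + \<epsilon>\<^sup>2)"
    if adm: "admissible B \<phi>" and ik: "i \<noteq> k" and z: "good z" and \<epsilon>: "0 < \<epsilon>" for \<phi> i k z \<epsilon>
  proof -
    have [measurable]: "\<phi> \<in> borel_measurable borel" and \<phi>: "\<And>x. x \<in> X \<Longrightarrow> \<bar>\<phi> x\<bar> \<le> \<bar>B\<bar>"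
      using adm by (fastforce simp: admissible_def)+
    let ?l = "lgst \<epsilon> z i k" and ?m = "mirror z i k"
    define G where "G i k = {x \<in> cell z k. mirror z i k x \<in> cell z i}" for i k
    define N where "N i k = {x \<in> cell z k. mirror z i k x \<notin> cell z i}" for i k
    have [measurable]: "G i k \<in> sets borel" "N i k \<in> sets borel" for i k
      unfolding G_def N_def by measurable
    have l01: "\<bar>?l x\<bar> \<le> 1" "0 \<le> ?l x" for x
      using lgst_bounds[where \<epsilon>=\<epsilon> and z=z and i=i and k=k and x=x] tie_le_1[OF \<epsilon>, where z=z and i=i and k=k and x=x] by linarith+
    have int: "integrable P (\<lambda>x. indicator S x * \<phi> x * ?l x)" if [measurable]: "S \<in> sets borel" for S
      using mult_mono[OF \<phi> l01(1)] by (intro integrable_bounded[of _ "\<bar>B\<bar>"]) (auto simp: abs_mult indicator_def)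
    have split: "expectation (\<lambda>x. indicator (cell z k) x * \<phi> x * ?l x)
      = expectation (\<lambda>x. indicator (G i k) x * \<phi> x * ?l x) + expectation (\<lambda>x. indicator (N i k) x * \<phi> x * ?l x)" for i k
    proof -
      have "indicator (cell z k) x = (indicator (G i k) x + indicator (N i k) x :: real)" for x
        by (auto simp: indicator_def G_def N_def)
      then have "expectation (\<lambda>x. indicator (cell z k) x * \<phi> x * ?l x)
        = expectation (\<lambda>x. indicator (G i k) x * \<phi> x * ?l x + indicator (N i k) x * \<phi> x * ?l x)"
        by (simp add: distrib_right)
      also have "\<dots> = expectation (\<lambda>x. indicator (G i k) x * \<phi> x * ?l x) + expectation (\<lambda>x. indicator (N i k) x * \<phi> x * ?l x)"
        by (intro Bochner_Integration.integral_add int) auto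
      finally show ?thesis .
    qed
    \<comment> \<open>Needed for both orders of the pair; \<open>lgst_commute\<close> supplies the
      premise \<open>l\<close> for the reversed one.\<close>
    have small: "\<bar>expectation (\<lambda>x. indicator (N a b) x * \<phi> x * ?l x)\<bar> \<le> \<bar>B\<bar> * (K1 * \<epsilon>\<^sup>2)"
      if ab: "a \<noteq> b" and l: "?l = lgst \<epsilon> z a b" for a b
    proof -
      have "\<bar>expectation (\<lambda>x. indicator (N a b) x * \<phi> x * ?l x)\<bar> \<le> expectation (\<lambda>x. \<bar>B\<bar> * (indicator (N a b) x * tie \<epsilon> z a b x))"
      proof (rule integral_abs_le)
        fix x assume x: "x \<in> X"
        have "\<bar>\<phi> x\<bar> * ?l x \<le> \<bar>B\<bar> * tie \<epsilon> z a b x"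
          using \<phi>[OF x] l01(2) lgst_bounds(2)[where \<epsilon>=\<epsilon> and z=z and i=a and k=b and x=x] unfolding l[symmetric] by (intro mult_mono) auto
        then show "\<bar>indicator (N a b) x * \<phi> x * ?l x\<bar> \<le> \<bar>B\<bar> * (indicator (N a b) x * tie \<epsilon> z a b x)"
          using l01(2)[of x] by (simp add: abs_mult indicator_def)
        show "\<bar>B\<bar> * (indicator (N a b) x * tie \<epsilon> z a b x) \<le> \<bar>B\<bar> * 1"
          using \<epsilon> by (intro mult_left_mono) (auto simp: indicator_def)
      qed auto
      also have "\<dots> \<le> \<bar>B\<bar> * (K1 * \<epsilon>\<^sup>2)"
        unfolding N_def using K1(2)[OF ab z \<epsilon>] by (simp add: mult_left_mono)
      finally show ?thesis .
    qed
    have lb: "integrable lborel (\<lambda>x. \<rho> x * f x) \<longleftrightarrow> integrable P f" "(LINT x|lborel. \<rho> x * f x) = expectation f"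
      if [measurable]: "f \<in> borel_measurable borel" for f :: "real^'d \<Rightarrow> real"
      unfolding P_eq using \<rho>_nonneg by (subst integrable_density integral_density; auto)+
    have G_mirror: "?m x \<in> G k i \<longleftrightarrow> x \<in> G i k" for x
      using ik by (auto simp: G_def mirror_commute[of z k i])
    let ?fk = "\<lambda>x. indicator (G i k) x * \<phi> x * ?l x" and ?fi = "\<lambda>x. indicator (G k i) x * \<phi> x * ?l x"
    \<comment> \<open>The pullback under the mirror of the integrand on the cell of
      \<open>i\<close>, density included; the logistic factor is unchanged.\<close>
    let ?fm = "\<lambda>x. indicator (G i k) x * (\<phi> (?m x) * \<rho> (?m x)) * ?l x"
    have fm_eq: "\<rho> (?m x) * ?fi (?m x) = ?fm x" for x
      using G_mirror[of x] lgst_mirror[OF ik, of \<epsilon> z x] by (simp add: indicator_def)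
    have distr: "distr lborel borel ?m = lborel"
      unfolding mirror_def by (rule lborel_distr_reflect[OF y_diff[OF ik]])
    have int_i: "integrable lborel (\<lambda>x. \<rho> x * ?fi x)" by (subst lb) (auto intro: int)
    then have "integrable (distr lborel borel ?m) (\<lambda>x. \<rho> x * ?fi x)" unfolding distr .
    then have int_m: "integrable lborel ?fm"
      by (subst (asm) integrable_distr_eq) (auto simp: fm_eq)
    have "expectation ?fi = (LINT x|distr lborel borel ?m. \<rho> x * ?fi x)" unfolding distr by (subst lb) auto
    also have "\<dots> = (LINT x|lborel. ?fm x)" by (subst integral_distr) (auto simp: fm_eq)
    finally have fi: "expectation ?fi = (LINT x|lborel. ?fm x)" .
    have int_k: "integrable lborel (\<lambda>x. \<rho> x * ?fk x)" by (subst lb) (auto intro: int)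
    have "expectation ?fk = (LINT x|lborel. \<rho> x * ?fk x)" by (subst lb) auto
    then have diff: "expectation ?fk - expectation ?fi = (LINT x|lborel. \<rho> x * ?fk x - ?fm x)"
      unfolding fi Bochner_Integration.integral_diff[OF int_k int_m] by simp
    have "\<bar>expectation ?fk - expectation ?fi\<bar> \<le> (LINT x|lborel. \<bar>\<rho> x * ?fk x - ?fm x\<bar>)"
      unfolding diff by (rule integral_abs_bound)
    also have "\<dots> \<le> (LINT x|lborel. \<rho> x * (indicator X x * (H * D powr \<alpha> * (margin z i k x powr \<alpha> * tie \<epsilon> z i k x))))"
    proof (rule Bochner_Integration.integral_mono)
      show "integrable lborel (\<lambda>x. \<bar>\<rho> x * ?fk x - ?fm x\<bar>)"
        by (intro integrable_abs Bochner_Integration.integrable_diff int_k int_m)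
      \<comment> \<open>This bound depends on \<open>z\<close> and serves integrability
        only.\<close>
      have "\<bar>margin z i k x powr \<alpha> * tie \<epsilon> z i k x\<bar> \<le> (\<bar>z $ i - z $ k\<bar> + Y * R + Y * R) powr \<alpha>" if "x \<in> X" for x
      proof -
        have "margin z i k x \<le> \<bar>z $ i - z $ k\<bar> + Y * norm x + Y * norm x"
          using Y(2)[of z x k 0] Y(2)[of z x i 0] by (simp add: pot_def)
        also have "\<dots> \<le> \<bar>z $ i - z $ k\<bar> + Y * R + Y * R"
          using R(2)[OF that] Y(1) by (intro add_mono mult_left_mono) auto
        finally have "margin z i k x powr \<alpha> \<le> (\<bar>z $ i - z $ k\<bar> + Y * R + Y * R) powr \<alpha>"
          using \<alpha>_pos by (intro powr_mono2) auto
        then have "margin z i k x powr \<alpha> * tie \<epsilon> z i k x \<le> (\<bar>z $ i - z $ k\<bar> + Y * R + Y * R) powr \<alpha> * 1"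
          using \<epsilon> by (intro mult_mono) simp_all
        moreover have "0 \<le> margin z i k x powr \<alpha> * tie \<epsilon> z i k x" by simp
        ultimately show ?thesis by (simp only: abs_of_nonneg mult_1_right)
      qed
      then have "integrable P (\<lambda>x. margin z i k x powr \<alpha> * tie \<epsilon> z i k x)"
        by (intro integrable_bounded) auto
      then have "integrable P (\<lambda>x. H * D powr \<alpha> * (margin z i k x powr \<alpha> * tie \<epsilon> z i k x))"
        by (rule integrable_mult_right)
      from integrable_mult_indicator[OF _ this, of X]
      have "integrable P (\<lambda>x. indicator X x * (H * D powr \<alpha> * (margin z i k x powr \<alpha> * tie \<epsilon> z i k x)))"
        by simp
      then show "integrable lborel (\<lambda>x. \<rho> x * (indicator X x * (H * D powr \<alpha> * (margin z i k x powr \<alpha> * tie \<epsilon> z i k x))))"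
        by (subst lb) auto
      fix x
      show "\<bar>\<rho> x * ?fk x - ?fm x\<bar> \<le> \<rho> x * (indicator X x * (H * D powr \<alpha> * (margin z i k x powr \<alpha> * tie \<epsilon> z i k x)))"
      proof (cases "x \<in> G i k")
        case True
        then have x: "x \<in> X" "?m x \<in> X" by (auto simp: G_def cell_eq)
        have "\<bar>\<rho> x * ?fk x - ?fm x\<bar> = \<bar>\<phi> x * \<rho> x - \<phi> (?m x) * \<rho> (?m x)\<bar> * ?l x"
        proof -
          have "\<rho> x * ?fk x - ?fm x = (\<phi> x * \<rho> x - \<phi> (?m x) * \<rho> (?m x)) * ?l x"
            using True by (simp add: algebra_simps)
          then show ?thesis by (simp only: abs_mult abs_of_nonneg[OF l01(2)])
        qed
        also have "\<dots> \<le> (H * norm (x - ?m x) powr \<alpha> * \<rho> x) * tie \<epsilon> z i k x"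
          using H(2)[OF adm x] lgst_bounds[where \<epsilon>=\<epsilon> and z=z and i=i and k=k and x=x] H(1) \<rho>_nonneg[of x] by (intro mult_mono) auto
        also have "\<dots> \<le> (H * (D * margin z i k x) powr \<alpha> * \<rho> x) * tie \<epsilon> z i k x"
          using H(1) \<rho>_nonneg[of x] D(2)[OF ik, of z x] \<alpha>_pos
          by (intro mult_right_mono mult_left_mono powr_mono2) (auto simp: norm_minus_commute)
        also have "\<dots> = \<rho> x * (indicator X x * (H * D powr \<alpha> * (margin z i k x powr \<alpha> * tie \<epsilon> z i k x)))"
          using x D(1) by (simp add: powr_mult mult_ac)
        finally show ?thesis .
      next
        case False
        then show ?thesis using H(1) \<rho>_nonneg[of x] by simp
      qed
    qed
    also have "\<dots> = expectation (\<lambda>x. indicator X x * (H * D powr \<alpha> * (margin z i k x powr \<alpha> * tie \<epsilon> z i k x)))"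
      by (subst lb) auto
    also have "\<dots> = expectation (\<lambda>x. H * D powr \<alpha> * (margin z i k x powr \<alpha> * tie \<epsilon> z i k x))"
    proof (rule integral_cong_AE)
      show "AE x in P. indicator X x * (H * D powr \<alpha> * (margin z i k x powr \<alpha> * tie \<epsilon> z i k x))
        = H * D powr \<alpha> * (margin z i k x powr \<alpha> * tie \<epsilon> z i k x)"
        using AE_X by eventually_elim simp
    qed auto
    also have "\<dots> \<le> H * D powr \<alpha> * (K2 * \<epsilon> powr (1 + \<alpha>))"
      using K2(2)[OF ik \<epsilon>, of z] H(1) by (simp add: mult_left_mono)
    finally have main: "\<bar>expectation ?fk - expectation ?fi\<bar> \<le> H * D powr \<alpha> * (K2 * \<epsilon> powr (1 + \<alpha>))" .
    have "\<bar>expectation (\<lambda>x. indicator (cell z k) x * \<phi> x * ?l x) - expectation (\<lambda>x. indicator (cell z i) x * \<phi> x * ?l x)\<bar>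
      \<le> H * D powr \<alpha> * (K2 * \<epsilon> powr (1 + \<alpha>)) + 2 * (\<bar>B\<bar> * (K1 * \<epsilon>\<^sup>2))"
      unfolding split[of k i] split[of i k]
      using main small[OF ik refl] small[OF ik[symmetric] lgst_commute] by linarith
    also have "\<dots> \<le> K * (\<epsilon> powr (1 + \<alpha>) + \<epsilon>\<^sup>2)"
      using K1 K2 H D by (simp add: K_def algebra_simps)
    finally show ?thesis .
  qed
  then show ?thesis using K by blast
qed

lemma softmax_cell_sum:
  "\<exists>K>0. \<forall>\<phi> i z \<epsilon>. admissible B \<phi> \<longrightarrow> good z \<longrightarrow> 0 < \<epsilon> \<longrightarrow> \<epsilon> < 1 \<longrightarrow>
    \<bar>expectation (\<lambda>x. \<phi> x * (p \<epsilon> z x i - indicator (cell z i) x))\<bar> \<le> K * \<epsilon> powr (1 + \<alpha>)"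
proof -
  obtain K1 where K1: "K1 > 0" "\<And>\<phi> i k z \<epsilon>. admissible B \<phi> \<Longrightarrow> i \<noteq> k \<Longrightarrow> good z \<Longrightarrow> 0 < \<epsilon> \<Longrightarrow>
    \<bar>expectation (\<lambda>x. indicator (cell z k) x * \<phi> x * p \<epsilon> z x i)
      - expectation (\<lambda>x. indicator (cell z k) x * \<phi> x * lgst \<epsilon> z i k x)\<bar> \<le> K1 * \<epsilon>\<^sup>2"
    using softmax_cell_approx[of B] by blast
  obtain K2 where K2: "K2 > 0" "\<And>\<phi> i k z \<epsilon>. admissible B \<phi> \<Longrightarrow> i \<noteq> k \<Longrightarrow> good z \<Longrightarrow> 0 < \<epsilon> \<Longrightarrow>
    \<bar>expectation (\<lambda>x. indicator (cell z k) x * \<phi> x * lgst \<epsilon> z i k x)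
      - expectation (\<lambda>x. indicator (cell z i) x * \<phi> x * lgst \<epsilon> z i k x)\<bar> \<le> K2 * (\<epsilon> powr (1 + \<alpha>) + \<epsilon>\<^sup>2)"
    using lgst_exchange[of B] by blast
  define K where "K = CARD('n) * (2 * K1 + 2 * K2)"
  have K: "K > 0" using K1 K2 by (simp add: K_def)
  have "\<bar>expectation (\<lambda>x. \<phi> x * (p \<epsilon> z x i - indicator (cell z i) x))\<bar> \<le> K * \<epsilon> powr (1 + \<alpha>)"
    if adm: "admissible B \<phi>" and z: "good z" and \<epsilon>: "0 < \<epsilon>" "\<epsilon> < 1" for \<phi> i z \<epsilon>
  proof -
    have [measurable]: "\<phi> \<in> borel_measurable borel" and \<phi>: "\<And>x. x \<in> X \<Longrightarrow> \<bar>\<phi> x\<bar> \<le> \<bar>B\<bar>"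
      using adm by (fastforce simp: admissible_def)+
    define J where "J a b = expectation (\<lambda>x. indicator (cell z a) x * \<phi> x * p \<epsilon> z x b)" for a b
    have p01: "0 \<le> p \<epsilon> z x b" "p \<epsilon> z x b \<le> 1" for x b
      using softmax_pos[of "\<lambda>i. pot z x i / \<epsilon>" b] softmax_le_1[of "\<lambda>i. pot z x i / \<epsilon>" b] by (simp_all add: p_def)
    have int: "integrable P (\<lambda>x. indicator (cell z a) x * \<phi> x * p \<epsilon> z x b)" for a b
    proof (rule integrable_bounded)
      fix x assume "x \<in> X"
      then have "\<bar>\<phi> x\<bar> * p \<epsilon> z x b \<le> \<bar>B\<bar> * 1" using \<phi> p01[of x b] by (intro mult_mono) auto
      then show "\<bar>indicator (cell z a) x * \<phi> x * p \<epsilon> z x b\<bar> \<le> \<bar>B\<bar>"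
        using p01[of x b] by (simp add: abs_mult indicator_def)
    qed auto
    have pair: "\<bar>J k i - J i k\<bar> \<le> (2 * K1 + 2 * K2) * \<epsilon> powr (1 + \<alpha>)" for k
    proof (cases "i = k")
      case False
      have "\<bar>J k i - J i k\<bar> \<le> 2 * K1 * \<epsilon>\<^sup>2 + K2 * (\<epsilon> powr (1 + \<alpha>) + \<epsilon>\<^sup>2)"
        using K1(2)[OF adm False z \<epsilon>(1)] K1(2)[OF adm False[symmetric] z \<epsilon>(1)] K2(2)[OF adm False z \<epsilon>(1)]
        unfolding J_def lgst_commute[of \<epsilon> z k i] by linarith
      \<comment> \<open>\<open>\<epsilon> < 1\<close> and \<open>\<alpha> \<le> 1\<close> absorb the
        quadratic errors into the main order.\<close>
      moreover have "\<epsilon>\<^sup>2 \<le> \<epsilon> powr (1 + \<alpha>)"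
        using \<epsilon> \<alpha>_le powr_mono'[of "1 + \<alpha>" 2 \<epsilon>] by (simp add: powr_numeral)
      ultimately show ?thesis
        using K1(1) K2(1) mult_left_mono[of "\<epsilon>\<^sup>2" "\<epsilon> powr (1 + \<alpha>)" "2 * K1 + K2"] by (simp add: algebra_simps)
    qed (use K1 K2 in simp)
    \<comment> \<open>Almost everywhere the cell indicators sum to 1, which is inserted in the first
      term; the weights sum to 1, which is inserted in the second. The result pairs up as
      \<open>J k i - J i k\<close>.\<close>
    have "expectation (\<lambda>x. \<phi> x * (p \<epsilon> z x i - indicator (cell z i) x))
      = expectation (\<lambda>x. (\<Sum>k\<in>UNIV. indicator (cell z k) x * \<phi> x * p \<epsilon> z x i) - (\<Sum>k\<in>UNIV. indicator (cell z i) x * \<phi> x * p \<epsilon> z x k))"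
    proof (rule integral_cong_AE)
      show "AE x in P. \<phi> x * (p \<epsilon> z x i - indicator (cell z i) x)
        = (\<Sum>k\<in>UNIV. indicator (cell z k) x * \<phi> x * p \<epsilon> z x i) - (\<Sum>k\<in>UNIV. indicator (cell z i) x * \<phi> x * p \<epsilon> z x k)"
        using AE_X AE_no_ties[of z]
      proof eventually_elim
        case (elim x)
        obtain k where k: "\<And>j. pot z x j \<le> pot z x k"
          using finite_imageI[of UNIV "pot z x"] Max_in[of "range (pot z x)"] Max_ge[of "range (pot z x)"] by fastforce
        have "x \<in> cell z j \<longleftrightarrow> j = k" for j using k elim by (auto simp: cell_eq) (metis k order_antisym)
        then have "indicator (cell z j) x * \<phi> x * p \<epsilon> z x i = (if j = k then \<phi> x * p \<epsilon> z x i else 0)" for j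
          by (simp add: indicator_def)
        then have "(\<Sum>j\<in>UNIV. indicator (cell z j) x * \<phi> x * p \<epsilon> z x i) = \<phi> x * p \<epsilon> z x i"
          by simp
        moreover have "(\<Sum>k\<in>UNIV. indicator (cell z i) x * \<phi> x * p \<epsilon> z x k) = indicator (cell z i) x * \<phi> x"
          by (simp add: sum_distrib_left[symmetric] p_def sum_softmax)
        ultimately show ?case by (simp add: algebra_simps)
      qed
    qed auto
    also have "\<dots> = (\<Sum>k\<in>UNIV. J k i) - (\<Sum>k\<in>UNIV. J i k)"
      unfolding J_def by (simp add: int Bochner_Integration.integral_sum Bochner_Integration.integral_diff Bochner_Integration.integrable_sum)
    also have "\<dots> = (\<Sum>k\<in>UNIV. J k i - J i k)" by (simp add: sum_subtractf)
    finally have "\<bar>expectation (\<lambda>x. \<phi> x * (p \<epsilon> z x i - indicator (cell z i) x))\<bar> \<le> (\<Sum>k\<in>UNIV. \<bar>J k i - J i k\<bar>)"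
      by (simp add: sum_abs)
    also have "\<dots> \<le> (\<Sum>k\<in>(UNIV::'n set). (2 * K1 + 2 * K2) * \<epsilon> powr (1 + \<alpha>))"
      by (intro sum_mono pair)
    finally show ?thesis by (simp add: K_def mult.assoc)
  qed
  then show ?thesis using K by blast
qed

end

section \<open>A Poincare inequality for the softmax\<close>

lemma exp_minus_1_le: "0 \<le> t \<Longrightarrow> t \<le> 1 \<Longrightarrow> exp t - 1 \<le> 2 * (t::real)"
  using exp_bound[of t] mult_left_mono[of t 1 t] by (simp add: power2_eq_square)

context semidiscrete
begin

lemma prob_UNIV [simp]: "prob UNIV = 1"
  using prob_space by simp

text \<open>A contraction towards a point of \<open>X\<close> maps the convex set \<open>X\<close>
  into itself, and for ratios from one half on its Jacobian is at least \<open>1 / 2 ^ d\<close>,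
  with \<open>d\<close> the dimension. The bounds \<open>m\<close> and \<open>M\<close> of the
  density then give \<open>K = M * 2 ^ d / m\<close>.\<close>

lemma expectation_contract:
  "\<exists>K>0. \<forall>(h :: real^'d \<Rightarrow> real) s x'. h \<in> borel_measurable borel \<longrightarrow> (\<forall>x. 0 \<le> h x \<and> h x \<le> 1) \<longrightarrow> 1 / 2 \<le> s \<longrightarrow> s \<le> 1 \<longrightarrow> x' \<in> X \<longrightarrow>
    expectation (\<lambda>x. h (s *\<^sub>R x + (1 - s) *\<^sub>R x')) \<le> K * expectation h"
proof -
  obtain m M where mM: "0 < m" "0 < M" "\<And>x. x \<in> X \<Longrightarrow> m \<le> \<rho> x" "\<And>x. x \<in> X \<Longrightarrow> \<rho> x \<le> M" using \<rho>_bounds by blast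
  define K where "K = M * 2 ^ DIM(real^'d) / m"
  have K: "K > 0" using mM by (simp add: K_def)
  have "expectation (\<lambda>x. h (s *\<^sub>R x + (1 - s) *\<^sub>R x')) \<le> K * expectation h"
    if h [measurable]: "h \<in> borel_measurable borel" and h01: "\<forall>x. 0 \<le> h x \<and> h x \<le> 1"
      and s: "1 / 2 \<le> s" "s \<le> 1" and x': "x' \<in> X" for h :: "real^'d \<Rightarrow> real" and s x'
  proof -
    let ?T = "\<lambda>x. (1 - s) *\<^sub>R x' + s *\<^sub>R x"
    have nn: "ennreal (expectation f) = (\<integral>\<^sup>+x. ennreal (\<rho> x) * (indicator X x * ennreal (f x)) \<partial>lborel)"
      if [measurable]: "f \<in> borel_measurable borel" and f: "\<And>x. 0 \<le> f x \<and> f x \<le> 1" for f :: "real^'d \<Rightarrow> real"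
    proof -
      have "integrable P f" using f by (intro integrable_bounded[of _ 1]) auto
      then have "ennreal (expectation f) = (\<integral>\<^sup>+x. ennreal (f x) \<partial>P)"
        using f by (subst nn_integral_eq_integral) auto
      also have "\<dots> = (\<integral>\<^sup>+x. indicator X x * ennreal (f x) \<partial>P)"
        using AE_X by (intro nn_integral_cong_AE) auto
      also have "\<dots> = (\<integral>\<^sup>+x. ennreal (\<rho> x) * (indicator X x * ennreal (f x)) \<partial>lborel)"
        by (subst P_eq, subst nn_integral_density) auto
      finally show ?thesis .
    qed
    have "ennreal (expectation (\<lambda>x. h (?T x))) = (\<integral>\<^sup>+x. ennreal (\<rho> x) * (indicator X x * ennreal (h (?T x))) \<partial>lborel)"
      using h01 by (intro nn) auto
    also have "\<dots> \<le> (\<integral>\<^sup>+x. ennreal M * (indicator X (?T x) * ennreal (h (?T x))) \<partial>lborel)"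
    proof (intro nn_integral_mono)
      fix x
      show "ennreal (\<rho> x) * (indicator X x * ennreal (h (?T x))) \<le> ennreal M * (indicator X (?T x) * ennreal (h (?T x)))"
      proof (cases "x \<in> X")
        case True
        then have "?T x \<in> X" using convex_X x' s by (auto intro: convexD)
        then show ?thesis using True mM(4)[OF True] by (simp add: mult_right_mono ennreal_leI)
      qed simp
    qed
    also have "\<dots> = ennreal M * (\<integral>\<^sup>+x. indicator X x * ennreal (h x) \<partial>distr lborel borel ?T)"
      by (subst nn_integral_distr) (auto simp: nn_integral_cmult)
    also have "\<dots> \<le> ennreal M * (ennreal (2 ^ DIM(real^'d)) * (\<integral>\<^sup>+x. indicator X x * ennreal (h x) \<partial>lborel))"
    proof (intro mult_left_mono)
      let ?I = "\<integral>\<^sup>+x. indicator X x * ennreal (h x) \<partial>distr lborel borel ?T"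
      have "lborel = density (distr lborel borel ?T) (\<lambda>_. ennreal (\<bar>s\<bar> ^ DIM(real^'d)))"
        using s by (intro lborel_affine) auto
      then have "(\<integral>\<^sup>+x. indicator X x * ennreal (h x) \<partial>lborel) =
         (\<integral>\<^sup>+x. indicator X x * ennreal (h x) \<partial>density (distr lborel borel ?T) (\<lambda>_. ennreal (\<bar>s\<bar> ^ DIM(real^'d))))"
        by simp
      also have "\<dots> = ennreal (s ^ DIM(real^'d)) * ?I"
        using s by (subst nn_integral_density) (auto simp: nn_integral_cmult)
      finally have "ennreal (2 ^ DIM(real^'d)) * (\<integral>\<^sup>+x. indicator X x * ennreal (h x) \<partial>lborel)
        = ennreal ((2 * s) ^ DIM(real^'d)) * ?I"
        using s by (simp add: mult.assoc[symmetric] ennreal_mult'[symmetric] power_mult_distrib)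
      moreover have "1 \<le> ennreal ((2 * s) ^ DIM(real^'d))"
        using s by (subst ennreal_1[symmetric], intro ennreal_leI one_le_power) auto
      ultimately show "?I \<le> ennreal (2 ^ DIM(real^'d)) * (\<integral>\<^sup>+x. indicator X x * ennreal (h x) \<partial>lborel)"
        using mult_right_mono[of 1 "ennreal ((2 * s) ^ DIM(real^'d))" ?I] by simp
    qed auto
    also have "\<dots> = ennreal (M * 2 ^ DIM(real^'d)) * (\<integral>\<^sup>+x. indicator X x * ennreal (h x) \<partial>lborel)"
      using mM by (simp add: mult.assoc ennreal_mult' ennreal_power[symmetric])
    also have "\<dots> = ennreal K * (\<integral>\<^sup>+x. ennreal m * (indicator X x * ennreal (h x)) \<partial>lborel)"
      using mM by (subst nn_integral_cmult) (auto simp: K_def mult.assoc[symmetric] ennreal_mult'[symmetric])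
    also have "\<dots> \<le> ennreal K * (\<integral>\<^sup>+x. ennreal (\<rho> x) * (indicator X x * ennreal (h x)) \<partial>lborel)"
      using mM(3) by (intro mult_left_mono nn_integral_mono) (auto simp: indicator_def intro!: mult_right_mono ennreal_leI)
    also have "\<dots> = ennreal K * ennreal (expectation h)" using h01 by (subst nn) auto
    also have "\<dots> = ennreal (K * expectation h)" using K by (simp add: ennreal_mult')
    finally have "expectation (\<lambda>x. h (?T x)) \<le> K * expectation h"
      using K h01 by (subst (asm) ennreal_le_iff) (auto intro: integral_nonneg)
    then show ?thesis by (simp add: add.commute)
  qed
  then show ?thesis using K by blast
qed

text \<open>A Poincare inequality for \<open>g\<close>, the conditional probability of \<open>A\<close>: along a segment, \<open>g\<close> changes by at most
  \<open>O(\<epsilon>\<^sup>-\<^sup>1) g (1 - g)\<close> per unit length, and the segments from \<open>x\<close> to the midpoint of \<open>x\<close> and \<open>x'\<close> can be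
  averaged over \<open>x\<close> because the contractions involved have ratio at least one half.\<close>

lemma softmax_variance_lower:
  "\<exists>c>0. \<forall>z \<epsilon> A. 0 < \<epsilon> \<longrightarrow> \<epsilon> < 1 \<longrightarrow> c0 \<le> expectation (\<lambda>x. \<Sum>i\<in>A. p \<epsilon> z x i) \<longrightarrow>
    expectation (\<lambda>x. \<Sum>i\<in>A. p \<epsilon> z x i) \<le> 1 - c0 \<longrightarrow>
    c * \<epsilon> \<le> expectation (\<lambda>x. (\<Sum>i\<in>A. p \<epsilon> z x i) * (1 - (\<Sum>i\<in>A. p \<epsilon> z x i)))"
proof -
  obtain K where K: "K > 0" "\<And>(h :: real^'d \<Rightarrow> real) s x'. h \<in> borel_measurable borel \<Longrightarrow> (\<forall>x. 0 \<le> h x \<and> h x \<le> 1) \<Longrightarrow> 1 / 2 \<le> s \<Longrightarrow> s \<le> 1 \<Longrightarrow> x' \<in> X \<Longrightarrow>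
    expectation (\<lambda>x. h (s *\<^sub>R x + (1 - s) *\<^sub>R x')) \<le> K * expectation h"
    using expectation_contract by blast
  obtain R where R: "R > 0" "\<And>x. x \<in> X \<Longrightarrow> norm x \<le> R"
    using compact_imp_bounded[OF compact_X] by (auto simp: bounded_pos)
  obtain Y where Y: "Y > 0" "\<And>z x x' j. \<bar>pot z x j - pot z x' j\<bar> \<le> Y * norm (x - x')" using pot_lipschitz by blast
  \<comment> \<open>Bounds the oscillation of each potential over \<open>X\<close>: the diameter is
    at most \<open>2 * R\<close>, the Lipschitz constant is \<open>Y\<close>.\<close>
  define L where "L = 2 * R * Y"
  have L: "L > 0" using R Y by (simp add: L_def)
  define c where "c = c0\<^sup>2 / (1 + 2 * L * K)"
  have c: "c > 0" using c0_pos L K by (simp add: c_def add_pos_pos)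
  have "c * \<epsilon> \<le> expectation (\<lambda>x. (\<Sum>i\<in>A. p \<epsilon> z x i) * (1 - (\<Sum>i\<in>A. p \<epsilon> z x i)))"
    if \<epsilon>: "0 < \<epsilon>" "\<epsilon> < 1" and lo: "c0 \<le> expectation (\<lambda>x. \<Sum>i\<in>A. p \<epsilon> z x i)"
      and hi: "expectation (\<lambda>x. \<Sum>i\<in>A. p \<epsilon> z x i) \<le> 1 - c0" for z \<epsilon> A
  proof -
    define g where "g x = (\<Sum>i\<in>A. p \<epsilon> z x i)" for x
    define G where "G x = g x * (1 - g x)" for x
    have g_m [measurable]: "g \<in> borel_measurable borel" "G \<in> borel_measurable borel"
      unfolding g_def[abs_def] G_def[abs_def] by measurable
    have g01: "0 \<le> g x" "g x \<le> 1" for x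
      unfolding g_def p_def by (rule sum_softmax_nonneg sum_softmax_le_1)+
    have G01: "0 \<le> G x" "G x \<le> 1" for x
      using g01[of x] mult_mono[of "g x" 1 "1 - g x" 1] by (auto simp: G_def)
    have step: "\<bar>g x' - g x\<bar> \<le> (exp (2 * (Y * norm (x' - x) / \<epsilon>)) - 1) * G x" for x x'
      unfolding g_def G_def p_def
    proof (rule abs_sum_softmax_diff_le)
      fix j
      have "\<bar>pot z x' j / \<epsilon> - pot z x j / \<epsilon>\<bar> = \<bar>pot z x' j - pot z x j\<bar> / \<epsilon>"
        using \<epsilon> by (simp add: diff_divide_distrib[symmetric])
      also have "\<dots> \<le> Y * norm (x' - x) / \<epsilon>" using Y \<epsilon> by (intro divide_right_mono) auto
      finally show "\<bar>pot z x' j / \<epsilon> - pot z x j / \<epsilon>\<bar> \<le> Y * norm (x' - x) / \<epsilon>" .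
    qed
    \<comment> \<open>With at least \<open>L / \<epsilon>\<close> pieces the exponent on each piece
      is at most 1, so \<open>exp t - 1 \<le> 2 * t\<close> applies there. Half-segments have length
      at most \<open>R\<close>, which cancels the 2 in the exponent of \<open>step\<close>.\<close>
    define n where "n = nat \<lceil>L / \<epsilon>\<rceil>"
    have n: "L / \<epsilon> \<le> real n" unfolding n_def by (rule real_nat_ceiling_ge)
    have n0: "n > 0" using L \<epsilon> n by (cases n) (auto simp: divide_le_0_iff)
    define pt where "pt x' m x = (1 - real m / (2 * real n)) *\<^sub>R x + (1 - (1 - real m / (2 * real n))) *\<^sub>R x'" for x' x :: "real^'d" and m :: nat
    define mid where "mid x x' = (1/2) *\<^sub>R x + (1/2) *\<^sub>R x'" for x x' :: "real^'d"
    have [measurable]: "pt x' m \<in> borel_measurable borel" for x' m unfolding pt_def[abs_def] by measurable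
    have ends: "pt x' 0 x = x" "pt x' n x = mid x x'" for x x' using n0 by (auto simp: pt_def mid_def)
    have path: "\<bar>g (mid x x') - g x\<bar> \<le> (\<Sum>m<n. 2 * (L / (n * \<epsilon>)) * G (pt x' m x))" if "x \<in> X" "x' \<in> X" for x x'
    proof -
      have "\<bar>g (pt x' k x) - g (pt x' 0 x)\<bar> \<le> (\<Sum>m<k. 2 * (L / (n * \<epsilon>)) * G (pt x' m x))" for k
      proof (induction k)
        case (Suc k)
        have "pt x' (Suc k) x - pt x' k x = (1 / (2 * real n)) *\<^sub>R (x' - x)"
          by (simp add: pt_def algebra_simps add_divide_distrib)
        then have "norm (pt x' (Suc k) x - pt x' k x) = norm (x' - x) / (2 * n)" by simp
        also have "\<dots> \<le> (2 * R) / (2 * n)"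
          using norm_triangle_ineq4[of x' x] R(2)[OF that(1)] R(2)[OF that(2)] by (intro divide_right_mono) auto
        finally have "2 * (Y * norm (pt x' (Suc k) x - pt x' k x) / \<epsilon>) \<le> 2 * (Y * ((2 * R) / (2 * n)) / \<epsilon>)"
          using Y \<epsilon> by (intro mult_left_mono divide_right_mono) auto
        also have "\<dots> = L / (n * \<epsilon>)" by (simp add: L_def)
        finally have "exp (2 * (Y * norm (pt x' (Suc k) x - pt x' k x) / \<epsilon>)) - 1 \<le> exp (L / (n * \<epsilon>)) - 1" by simp
        also have "\<dots> \<le> 2 * (L / (n * \<epsilon>))"
          using n n0 L \<epsilon> by (intro exp_minus_1_le) (auto simp: field_simps)
        finally have "\<bar>g (pt x' (Suc k) x) - g (pt x' k x)\<bar> \<le> 2 * (L / (n * \<epsilon>)) * G (pt x' k x)"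
          using step[of "pt x' (Suc k) x" "pt x' k x"] G01 by (meson mult_right_mono order_trans)
        then show ?case using Suc by simp
      qed simp
      from this[of n] show ?thesis unfolding ends .
    qed
    have half: "expectation (\<lambda>x. \<bar>g (mid x x') - g x\<bar>) \<le> 2 * L * K / \<epsilon> * expectation G" if x': "x' \<in> X" for x'
    proof -
      have [measurable]: "(\<lambda>x. mid x x') \<in> borel_measurable borel" unfolding mid_def by measurable
      have "\<bar>expectation (\<lambda>x. \<bar>g (mid x x') - g x\<bar>)\<bar> \<le> expectation (\<lambda>x. \<Sum>m<n. 2 * (L / (n * \<epsilon>)) * G (pt x' m x))"
      proof (rule integral_abs_le)
        show "\<bar>\<bar>g (mid x x') - g x\<bar>\<bar> \<le> (\<Sum>m<n. 2 * (L / (n * \<epsilon>)) * G (pt x' m x))" if "x \<in> X" for x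
          using path[OF that x'] by simp
        show "(\<Sum>m<n. 2 * (L / (n * \<epsilon>)) * G (pt x' m x)) \<le> (\<Sum>m<n. 2 * (L / (n * \<epsilon>)) * 1)" for x
          using L \<epsilon> G01 by (intro sum_mono mult_left_mono) auto
      qed measurable
      also have "\<dots> = (\<Sum>m<n. 2 * (L / (n * \<epsilon>)) * expectation (\<lambda>x. G (pt x' m x)))"
      proof -
        have "integrable P (\<lambda>x. G (pt x' m x))" for m
          using G01 by (intro integrable_bounded[of _ 1]) auto
        then have "integrable P (\<lambda>x. 2 * (L / (n * \<epsilon>)) * G (pt x' m x))" for m by (rule integrable_mult_right)
        then show ?thesis by (subst Bochner_Integration.integral_sum) simp_all
      qed
      also have "\<dots> \<le> (\<Sum>m<n. 2 * (L / (n * \<epsilon>)) * (K * expectation G))"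
      proof (intro sum_mono mult_left_mono)
        fix m assume "m \<in> {..<n}"
        then show "expectation (\<lambda>x. G (pt x' m x)) \<le> K * expectation G"
          unfolding pt_def using x' n0 G01 by (intro K(2)) (auto simp: field_simps)
      qed (use L \<epsilon> in auto)
      also have "\<dots> = 2 * L * K / \<epsilon> * expectation G" using n0 by simp
      finally show ?thesis by simp
    qed
    interpret PP: pair_prob_space P P ..
    have [measurable]: "(\<lambda>(x, x'). mid x x') \<in> borel_measurable (borel \<Otimes>\<^sub>M borel)"
      unfolding mid_def by measurable
    have Pintegrable: "integrable (P \<Otimes>\<^sub>M P) (\<lambda>(x, x'). f x x')"
      if "(\<lambda>(x, x'). f x x') \<in> borel_measurable (borel \<Otimes>\<^sub>M borel)" "\<And>x x'. \<bar>f x x' :: real\<bar> \<le> 1" for f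
      using that by (intro PP.P.integrable_const_bound[of _ 1]) (auto cong: measurable_cong_sets sets_pair_measure_cong)
    have g_diff: "\<bar>g a - g b\<bar> \<le> 1" for a b using g01[of a] g01[of b] by linarith
    have int_mid: "integrable (P \<Otimes>\<^sub>M P) (\<lambda>(x, x'). \<bar>g (mid x x') - g x\<bar>)"
       "integrable (P \<Otimes>\<^sub>M P) (\<lambda>(x, x'). \<bar>g (mid x x') - g x'\<bar>)"
      using g_diff by (auto intro!: Pintegrable)
    have int_sq: "integrable (P \<Otimes>\<^sub>M P) (\<lambda>(x, x'). (g x - g x')\<^sup>2)"
      using g_diff by (intro Pintegrable) (auto simp: abs_square_le_1)
    have int_g: "integrable P g" "integrable P (\<lambda>x. (g x)\<^sup>2)" "integrable P G"
      using g01 G01 by (auto intro!: integrable_bounded[of _ 1] simp: power_le_one)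
    define \<mu> where "\<mu> = expectation g"
    define \<sigma> where "\<sigma> = expectation (\<lambda>x. (g x)\<^sup>2)"
    have EG: "expectation G = \<mu> - \<sigma>"
      unfolding \<mu>_def \<sigma>_def using int_g by (simp add: G_def[abs_def] right_diff_distrib power2_eq_square)
    have inner: "expectation (\<lambda>x'. (g x - g x')\<^sup>2) = (g x)\<^sup>2 - 2 * g x * \<mu> + \<sigma>" for x
      unfolding power2_diff \<mu>_def \<sigma>_def using int_g by (simp add: prob_space)
    \<comment> \<open>Twice the variance is the mean square difference of two independent copies.
      The value at the midpoint is inserted between them, so that each half-segment can be averaged
      over its own endpoint.\<close>
    have "2 * (\<sigma> - \<mu>\<^sup>2) = expectation (\<lambda>x. expectation (\<lambda>x'. (g x - g x')\<^sup>2))"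
    proof -
      have "expectation (\<lambda>x. (g x)\<^sup>2 - 2 * g x * \<mu> + \<sigma>) = \<sigma> - 2 * \<mu> * \<mu> + \<sigma>"
        using int_g by (simp add: \<mu>_def[symmetric] \<sigma>_def[symmetric])
      then show ?thesis unfolding inner by (simp add: power2_eq_square)
    qed
    also have "\<dots> = integral\<^sup>L (P \<Otimes>\<^sub>M P) (\<lambda>(x, x'). (g x - g x')\<^sup>2)"
      by (rule PP.integral_fst'[OF int_sq, simplified])
    also have "\<dots> \<le> integral\<^sup>L (P \<Otimes>\<^sub>M P) (\<lambda>(x, x'). \<bar>g (mid x x') - g x\<bar> + \<bar>g (mid x x') - g x'\<bar>)"
    proof (rule Bochner_Integration.integral_mono[OF int_sq])
      show "integrable (P \<Otimes>\<^sub>M P) (\<lambda>(x, x'). \<bar>g (mid x x') - g x\<bar> + \<bar>g (mid x x') - g x'\<bar>)"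
        using Bochner_Integration.integrable_add[OF int_mid] by (simp add: case_prod_unfold)
      have "(g x - g x')\<^sup>2 \<le> \<bar>g (mid x x') - g x\<bar> + \<bar>g (mid x x') - g x'\<bar>" for x x'
      proof -
        have "(g x - g x')\<^sup>2 \<le> \<bar>g x - g x'\<bar>"
          using g_diff[of x x'] mult_left_mono[of "\<bar>g x - g x'\<bar>" 1 "\<bar>g x - g x'\<bar>"]
          by (simp add: power2_eq_square abs_mult[symmetric])
        then show ?thesis by linarith
      qed
      then show "(case xx of (x, x') \<Rightarrow> (g x - g x')\<^sup>2) \<le> (case xx of (x, x') \<Rightarrow> \<bar>g (mid x x') - g x\<bar> + \<bar>g (mid x x') - g x'\<bar>)" for xx
        by (auto split: prod.split)
    qed
    also have "\<dots> = integral\<^sup>L (P \<Otimes>\<^sub>M P) (\<lambda>(x, x'). \<bar>g (mid x x') - g x\<bar>) + integral\<^sup>L (P \<Otimes>\<^sub>M P) (\<lambda>(x, x'). \<bar>g (mid x x') - g x'\<bar>)"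
      using Bochner_Integration.integral_add[OF int_mid] by (simp add: case_prod_unfold)
    also have "\<dots> = expectation (\<lambda>x'. expectation (\<lambda>x. \<bar>g (mid x x') - g x\<bar>)) + expectation (\<lambda>x. expectation (\<lambda>x'. \<bar>g (mid x x') - g x'\<bar>))"
      using PP.integral_snd[of "\<lambda>x x'. \<bar>g (mid x x') - g x\<bar>"] PP.integral_fst'[OF int_mid(2)] int_mid(1) by simp
    also have "\<dots> \<le> 2 * L * K / \<epsilon> * expectation G + 2 * L * K / \<epsilon> * expectation G"
    proof (rule add_mono)
      have "expectation (\<lambda>x'. expectation (\<lambda>x. \<bar>g (mid x x') - g x\<bar>)) \<le> expectation (\<lambda>x'. 2 * L * K / \<epsilon> * expectation G)"
        using AE_X half PP.integrable_snd[OF int_mid(1)]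
        by (intro integral_mono_AE) auto
      then show "expectation (\<lambda>x'. expectation (\<lambda>x. \<bar>g (mid x x') - g x\<bar>)) \<le> 2 * L * K / \<epsilon> * expectation G"
        by (simp add: prob_space)
      have "mid x x' = mid x' x" for x x' by (simp add: mid_def add.commute)
      then have "expectation (\<lambda>x'. \<bar>g (mid x x') - g x'\<bar>) \<le> 2 * L * K / \<epsilon> * expectation G" if "x \<in> X" for x
        using half[OF that] by simp
      then have "expectation (\<lambda>x. expectation (\<lambda>x'. \<bar>g (mid x x') - g x'\<bar>)) \<le> expectation (\<lambda>x. 2 * L * K / \<epsilon> * expectation G)"
        using AE_X PP.integrable_fst'[OF int_mid(2)]
        by (intro integral_mono_AE) auto
      then show "expectation (\<lambda>x. expectation (\<lambda>x'. \<bar>g (mid x x') - g x'\<bar>)) \<le> 2 * L * K / \<epsilon> * expectation G"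
        by (simp add: prob_space)
    qed
    finally have "2 * (\<sigma> - \<mu>\<^sup>2) \<le> 2 * L * K / \<epsilon> * expectation G + 2 * L * K / \<epsilon> * expectation G" .
    moreover have "2 * a \<le> b + b \<Longrightarrow> a \<le> b" for a b :: real by simp
    ultimately have "\<sigma> - \<mu>\<^sup>2 \<le> 2 * L * K / \<epsilon> * expectation G" by blast
    \<comment> \<open>The left side is at least \<open>c0\<^sup>2\<close> by the two mass bounds. On
      the right the mean of \<open>G\<close> is at most its quotient by
      \<open>\<epsilon> < 1\<close>, so both terms are multiples of that quotient; this gives
      \<open>c\<close>.\<close>
    moreover have "\<mu> * (1 - \<mu>) = expectation G + (\<sigma> - \<mu>\<^sup>2)"
      unfolding EG by (simp add: power2_eq_square algebra_simps)
    ultimately have "\<mu> * (1 - \<mu>) \<le> expectation G + 2 * L * K / \<epsilon> * expectation G" by simp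
    moreover have "c0\<^sup>2 \<le> \<mu> * (1 - \<mu>)"
      using lo hi c0_pos unfolding \<mu>_def power2_eq_square g_def[abs_def] by (intro mult_mono) auto
    moreover have "expectation G \<le> expectation G / \<epsilon>"
    proof -
      have "0 \<le> expectation G" using G01 by (intro Bochner_Integration.integral_nonneg) auto
      then show ?thesis using \<epsilon> mult_left_mono[of \<epsilon> 1 "expectation G"] by (simp add: field_simps)
    qed
    ultimately have "c0\<^sup>2 \<le> (1 + 2 * L * K) * (expectation G / \<epsilon>)"
      by (simp add: algebra_simps)
    then have "c * \<epsilon> \<le> expectation G"
      using \<epsilon> L K by (simp add: c_def field_simps add_pos_pos)
    then show ?thesis by (simp add: G_def[abs_def] g_def[abs_def])
  qed
  then show ?thesis using c by blast
qed

end

section \<open>Optimality of the potentials\<close>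

text \<open>The complement of the support is covered by the null sets of a countable basis.\<close>

lemma AE_measure_support:
  fixes M :: "'a::second_countable_topology measure"
  assumes "sets M = sets borel"
  shows "AE x in M. x \<in> measure_support M"
proof -
  obtain B :: "'a set set" where B: "countable B" "topological_basis B"
    using ex_countable_basis by blast
  have "\<Union>{U \<in> B. emeasure M U = 0} \<in> null_sets M"
  proof (rule null_sets_UN'[of "{U \<in> B. emeasure M U = 0}" id, simplified])
    show "countable {U \<in> B. emeasure M U = 0}" using B by simp
    show "U \<in> null_sets M" if "U \<in> B \<and> emeasure M U = 0" for U
      using that topological_basis_open[OF B(2)] assms by (auto intro!: null_setsI)
  qed
  moreover have "{x \<in> space M. x \<notin> measure_support M} \<subseteq> \<Union>{U \<in> B. emeasure M U = 0}"
  proof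
    fix x assume "x \<in> {x \<in> space M. x \<notin> measure_support M}"
    then obtain U where U: "open U" "x \<in> U" "emeasure M U = 0"
      by (auto simp: measure_support_def)
    then obtain V where V: "V \<in> B" "x \<in> V" "V \<subseteq> U" using topological_basisE[OF B(2) U(1,2)] by blast
    have "emeasure M V \<le> emeasure M U" using V U assms by (intro emeasure_mono) auto
    then show "x \<in> \<Union>{U \<in> B. emeasure M U = 0}" using U V by auto
  qed
  ultimately show ?thesis by (rule AE_I')
qed

text \<open>Jensen's inequality for the exponential under the weights \<open>softmax u'\<close>,
  obtained from the tangent at the mean \<open>m\<close> of \<open>u - u'\<close>.\<close>

lemma log_sum_exp_subgradient:
  fixes u u' :: "'n::finite \<Rightarrow> real"
  shows "ln (\<Sum>i\<in>UNIV. exp (u' i)) + (\<Sum>i\<in>UNIV. softmax u' i * (u i - u' i)) \<le> ln (\<Sum>i\<in>UNIV. exp (u i))"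
proof -
  define m where "m = (\<Sum>i\<in>UNIV. softmax u' i * (u i - u' i))"
  let ?S = "\<Sum>i\<in>UNIV. exp (u' i)"
  have S: "?S > 0" by (rule sum_exp_pos)
  have "exp m = exp m * (\<Sum>i\<in>UNIV. softmax u' i * (1 + (u i - u' i - m)))"
    by (simp add: distrib_left right_diff_distrib sum.distrib sum_subtractf sum_softmax sum_distrib_right[symmetric] m_def)
  also have "\<dots> = (\<Sum>i\<in>UNIV. softmax u' i * (exp m * (1 + (u i - u' i - m))))"
    by (simp add: sum_distrib_left mult.left_commute)
  also have "\<dots> \<le> (\<Sum>i\<in>UNIV. softmax u' i * (exp m * exp (u i - u' i - m)))"
    using softmax_pos by (intro sum_mono mult_left_mono exp_ge_add_one_self) (auto intro: less_imp_le)
  also have "\<dots> = (\<Sum>i\<in>UNIV. exp (u i)) / ?S"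
    by (simp add: exp_add[symmetric] softmax_def sum_divide_distrib)
  finally have "exp m * ?S \<le> (\<Sum>i\<in>UNIV. exp (u i))" using S by (simp add: field_simps)
  then have "ln (exp m * ?S) \<le> ln (\<Sum>i\<in>UNIV. exp (u i))"
    using S by (subst ln_le_cancel_iff) (auto intro: sum_exp_pos)
  then show ?thesis using S by (simp add: ln_mult m_def)
qed

context semidiscrete
begin

lemma sum_vec_eq_inner: "z \<bullet> (1 :: real^'n) = (\<Sum>i\<in>UNIV. z $ i)"
  by (simp add: inner_vec_def)

text \<open>Treats both semiduals at once: \<open>f\<close> is the integrand and \<open>- s\<close>
  a subgradient of it in \<open>z\<close>, made of cell indicators or of softmax weights. Instead of
  differentiating \<open>F\<close>, the subgradient inequality at \<open>z0 + v / (n + 1)\<close> is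
  played against the minimality of \<open>z0\<close>, and \<open>s_cont\<close> passes to the
  limit.\<close>

lemma potential_optimality:
  fixes f :: "real^'n \<Rightarrow> real^'d \<Rightarrow> real" and s :: "real^'n \<Rightarrow> real^'d \<Rightarrow> 'n \<Rightarrow> real" and q :: "real^'n"
  assumes f_int: "\<And>z. integrable P (f z)" and f_ge: "\<And>z x i. pot z x i \<le> f z x"
    and s_meas [measurable]: "\<And>z i. (\<lambda>x. s z x i) \<in> borel_measurable borel"
    and s01: "\<And>z x i. 0 \<le> s z x i" "\<And>z x i. s z x i \<le> 1"
    and s_sum: "\<And>z. AE x in P. (\<Sum>i\<in>UNIV. s z x i) = 1"
    and subgrad: "\<And>z z'. AE x in P. f z' x - (\<Sum>i\<in>UNIV. s z' x i * (z $ i - z' $ i)) \<le> f z x"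
    and s_cont: "\<And>z v i. AE x in P. (\<lambda>n. s (z + (1 / (real n + 1)) *\<^sub>R v) x i) \<longlonglongrightarrow> s z x i"
    and q: "(\<Sum>i\<in>UNIV. q $ i) = 1" "\<And>i. c0 \<le> q $ i"
  defines "F \<equiv> \<lambda>z. expectation (f z) + z \<bullet> q"
  defines "z0 \<equiv> arg_min F (\<lambda>z. z \<bullet> 1 = 0)"
  shows "z0 \<bullet> 1 = 0" and "expectation (\<lambda>x. s z0 x i) = q $ i"
proof -
  obtain R where R: "R > 0" "\<And>x. x \<in> X \<Longrightarrow> norm x \<le> R"
    using compact_imp_bounded[OF compact_X] by (auto simp: bounded_pos)
  obtain Y where Y: "Y > 0" "\<And>z x x' j. \<bar>pot z x j - pot z x' j\<bar> \<le> Y * norm (x - x')" using pot_lipschitz by blast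
  have s_int: "integrable P (\<lambda>x. s z x i)" for z i
    using s01 by (intro integrable_bounded[of _ 1]) auto
  have f_lower: "- (Y * R) - z $ i \<le> expectation (f z)" for z i
  proof -
    have "expectation (\<lambda>x. - (Y * R) - z $ i) \<le> expectation (f z)"
    proof (rule integral_mono_AE)
      show "AE x in P. - (Y * R) - z $ i \<le> f z x"
        using AE_X
      proof eventually_elim
        case (elim x)
        have "Y * norm x \<le> Y * R" using R(2)[OF elim] Y(1) by (intro mult_left_mono) auto
        moreover have "\<bar>pot z x i - pot z 0 i\<bar> \<le> Y * norm x" using Y(2)[of z x i 0] by simp
        ultimately show ?case using f_ge[of z x i] by (simp add: pot_def)
      qed
    qed (auto intro: f_int)
    then show ?thesis by simp
  qed
  have exp_diff: "expectation (f z') - (\<Sum>i\<in>UNIV. expectation (\<lambda>x. s z' x i) * (z $ i - z' $ i)) \<le> expectation (f z)" for z z'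
  proof -
    have "expectation (\<lambda>x. f z' x - (\<Sum>i\<in>UNIV. s z' x i * (z $ i - z' $ i))) \<le> expectation (f z)"
      by (intro integral_mono_AE subgrad Bochner_Integration.integrable_diff f_int Bochner_Integration.integrable_sum integrable_mult_left s_int)
    also have "expectation (\<lambda>x. f z' x - (\<Sum>i\<in>UNIV. s z' x i * (z $ i - z' $ i)))
      = expectation (f z') - (\<Sum>i\<in>UNIV. expectation (\<lambda>x. s z' x i) * (z $ i - z' $ i))"
      by (subst Bochner_Integration.integral_diff, (intro f_int Bochner_Integration.integrable_sum integrable_mult_left s_int)+,
          subst Bochner_Integration.integral_sum) (auto intro: s_int)
    finally show ?thesis .
  qed
  have m01: "0 \<le> expectation (\<lambda>x. s z x i)" "expectation (\<lambda>x. s z x i) \<le> 1" for z i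
    using s01 s_int by (auto intro!: Bochner_Integration.integral_nonneg integral_le_const)
  have F_lip: "F z' \<le> F z + (CARD('n) + norm q) * norm (z - z')" for z z'
  proof -
    have "(\<Sum>i\<in>UNIV. expectation (\<lambda>x. s z' x i) * (z $ i - z' $ i)) \<le> (\<Sum>i\<in>(UNIV::'n set). norm (z - z'))"
    proof (rule sum_mono)
      fix i
      have "expectation (\<lambda>x. s z' x i) * (z $ i - z' $ i) \<le> expectation (\<lambda>x. s z' x i) * norm (z - z')"
        using component_le_norm_cart[of "z - z'" i] m01 by (intro mult_left_mono) auto
      also have "\<dots> \<le> 1 * norm (z - z')" using m01 by (intro mult_right_mono) auto
      finally show "expectation (\<lambda>x. s z' x i) * (z $ i - z' $ i) \<le> norm (z - z')" by simp
    qed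
    moreover have "(z' - z) \<bullet> q \<le> norm (z' - z) * norm q" by (rule norm_cauchy_schwarz)
    ultimately show ?thesis using exp_diff[of z' z]
      by (simp add: F_def inner_diff_left norm_minus_commute algebra_simps)
  qed
  have cont: "continuous_on UNIV F"
  proof (rule lipschitz_on_continuous_on)
    show "(CARD('n) + norm q)-lipschitz_on UNIV F"
    proof (rule lipschitz_onI)
      fix z z' :: "real^'n"
      show "dist (F z) (F z') \<le> (CARD('n) + norm q) * dist z z'"
        using F_lip[of z z'] F_lip[of z' z] by (simp add: dist_real_def dist_norm norm_minus_commute)
    qed auto
  qed
  define r where "r = (F 0 + Y * R) / c0"
  \<comment> \<open>\<open>f_lower\<close> at the smallest coordinate \<open>k\<close>, together
    with masses at least \<open>c0\<close>, bounds \<open>z $ l - z $ k\<close> by \<open>r\<close>.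
    The zero sum makes \<open>z $ k\<close> nonpositive, which bounds every coordinate above by
    \<open>r\<close> and then, by the zero sum again, below.\<close>
  have coercive: "norm z \<le> real CARD('n) * (real CARD('n) * r)" if z: "z \<bullet> 1 = 0" "F z \<le> F 0" for z
  proof -
    obtain k where k: "\<And>j. z $ k \<le> z $ j"
      using finite_imageI[of UNIV "($) z"] Min_in[of "range (($) z)"] Min_le[of "range (($) z)"] by fastforce
    have sum0: "(\<Sum>i\<in>UNIV. z $ i) = 0" using z(1) by (simp add: sum_vec_eq_inner)
    have zk: "z $ k \<le> 0"
    proof (rule ccontr)
      assume "\<not> z $ k \<le> 0"
      then have "z $ i > 0" for i using k[of i] by linarith
      then have "(\<Sum>i\<in>UNIV. z $ i) > 0" by (intro sum_pos) auto
      then show False using sum0 by simp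
    qed
    have up: "z $ l \<le> r" for l
    proof -
      have "c0 * (z $ l - z $ k) \<le> q $ l * (z $ l - z $ k)" using q k[of l] by (intro mult_right_mono) auto
      also have "\<dots> \<le> (\<Sum>i\<in>UNIV. q $ i * (z $ i - z $ k))"
        using q c0_pos k by (intro member_le_sum[of l UNIV "\<lambda>i. q $ i * (z $ i - z $ k)"] mult_nonneg_nonneg)
          (auto intro: order_trans[OF less_imp_le])
      also have "\<dots> = z \<bullet> q - z $ k"
        using q by (simp add: inner_vec_def right_diff_distrib sum_subtractf sum_distrib_right[symmetric] mult.commute)
      also have "\<dots> \<le> F 0 + Y * R" using f_lower[of z k] z(2) by (simp add: F_def)
      finally have "z $ l - z $ k \<le> r" using c0_pos by (simp add: r_def field_simps)
      then show ?thesis using zk by simp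
    qed
    have "0 \<le> (\<Sum>i\<in>(UNIV::'n set). r)" using up sum_mono[of UNIV "($) z" "\<lambda>_. r"] sum0 by simp
    then have r0: "0 \<le> r" by (simp add: zero_le_mult_iff)
    have lo: "- (real CARD('n) * r) \<le> z $ l" for l
    proof -
      have "(\<Sum>i\<in>UNIV - {l}. z $ i) \<le> (\<Sum>i\<in>UNIV - {l}. r)" using up by (intro sum_mono) auto
      also have "\<dots> \<le> (\<Sum>i\<in>(UNIV::'n set). r)" using r0 by (intro sum_mono2) auto
      finally show ?thesis using sum0 sum.remove[of UNIV l "($) z"] by simp
    qed
    have "norm z \<le> (\<Sum>i\<in>UNIV. \<bar>z $ i\<bar>)" by (rule norm_le_l1_cart)
    also have "\<dots> \<le> (\<Sum>i\<in>(UNIV::'n set). real CARD('n) * r)"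
    proof (rule sum_mono)
      fix l
      have "r \<le> real CARD('n) * r" using r0 mult_right_mono[of 1 "real CARD('n)" r] by (simp add: Suc_leI)
      then show "\<bar>z $ l\<bar> \<le> real CARD('n) * r" using up[of l] lo[of l] by linarith
    qed
    finally show ?thesis by simp
  qed
  define B where "B = {z::real^'n. z \<bullet> 1 = 0} \<inter> cball 0 (real CARD('n) * (real CARD('n) * r))"
  have "closed {z::real^'n. z \<bullet> 1 = 0}" by (intro closed_Collect_eq continuous_intros)
  then have "compact B" unfolding B_def by (intro closed_Int_compact) auto
  moreover have B0: "0 \<in> B" using coercive[of 0] by (simp add: B_def)
  ultimately obtain zm where zm: "zm \<in> B" "\<And>z. z \<in> B \<Longrightarrow> F zm \<le> F z"
    using continuous_attains_inf[of B F] continuous_on_subset[OF cont] by blast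
  have min: "F zm \<le> F z" if "z \<bullet> 1 = 0" for z
  proof (cases "z \<in> B")
    case False
    then have "F 0 < F z" using coercive[of z] that by (fastforce simp: B_def)
    then show ?thesis using zm(2)[OF B0] by simp
  qed (use zm in auto)
  \<comment> \<open>\<open>arg_min\<close> has the minimizing property only once a minimizer is
    known; compactness has just provided \<open>zm\<close>.\<close>
  have z0: "z0 \<bullet> 1 = 0 \<and> (\<forall>z. z \<bullet> 1 = 0 \<longrightarrow> F z0 \<le> F z)"
    unfolding z0_def
  proof (rule arg_minI[where P="\<lambda>z. z \<bullet> 1 = 0" and f=F and x=zm])
    show "zm \<bullet> 1 = 0" using zm by (simp add: B_def)
    show "\<not> F z < F zm" if "z \<bullet> 1 = 0" for z using min[OF that] by simp
  qed (auto simp: not_less)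
  then show "z0 \<bullet> 1 = 0" by simp
  define m where "m i = expectation (\<lambda>x. s z0 x i)" for i
  have first_order: "(\<Sum>i\<in>UNIV. v $ i * m i) \<le> v \<bullet> q" if v: "v \<bullet> 1 = 0" for v
  proof (rule LIMSEQ_le_const2)
    let ?h = "\<lambda>n::nat. 1 / (real n + 1)"
    show "(\<lambda>n. \<Sum>i\<in>UNIV. v $ i * expectation (\<lambda>x. s (z0 + ?h n *\<^sub>R v) x i)) \<longlonglongrightarrow> (\<Sum>i\<in>UNIV. v $ i * m i)"
      unfolding m_def
    proof (intro tendsto_intros)
      fix i
      show "(\<lambda>n. expectation (\<lambda>x. s (z0 + ?h n *\<^sub>R v) x i)) \<longlonglongrightarrow> expectation (\<lambda>x. s z0 x i)"
        by (rule integral_dominated_convergence[of _ P _ "\<lambda>_. 1"]) (use s_cont s01 in auto)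
    qed
    have "(\<Sum>i\<in>UNIV. v $ i * expectation (\<lambda>x. s (z0 + ?h n *\<^sub>R v) x i)) \<le> v \<bullet> q" for n
    proof -
      let ?z = "z0 + ?h n *\<^sub>R v"
      have h: "?h n > 0" by simp
      have "F z0 \<le> F ?z" using z0 v by (simp add: inner_add_left)
      moreover have "expectation (f ?z) + ?h n * (\<Sum>i\<in>UNIV. v $ i * expectation (\<lambda>x. s ?z x i)) \<le> expectation (f z0)"
        using exp_diff[of ?z z0] by (simp add: sum_distrib_left sum_negf mult_ac)
      ultimately have "?h n * (\<Sum>i\<in>UNIV. v $ i * expectation (\<lambda>x. s ?z x i)) \<le> ?h n * (v \<bullet> q)"
        by (simp add: F_def inner_add_left)
      then show ?thesis using h by (simp only: mult_le_cancel_left_pos)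
    qed
    then show "\<exists>N. \<forall>n\<ge>N. (\<Sum>i\<in>UNIV. v $ i * expectation (\<lambda>x. s (z0 + ?h n *\<^sub>R v) x i)) \<le> v \<bullet> q" by blast
  qed
  have diff: "m i - q $ i \<le> m k - q $ k" for i k
  proof -
    \<comment> \<open>Trades coordinate \<open>i\<close> against \<open>k\<close> and keeps the sum
      zero. With both orders of the pair, \<open>m - q\<close> is constant; as \<open>m\<close> and
      \<open>q\<close> have the same total, the constant is 0.\<close>
    define v :: "real^'n" where "v = axis i 1 - axis k 1"
    have "v \<bullet> 1 = 0" by (simp add: v_def inner_diff_left inner_axis')
    from first_order[OF this] have "m i - m k \<le> v \<bullet> q"
      by (simp add: v_def axis_def left_diff_distrib sum_subtractf if_distrib[of "\<lambda>c. c * _"] cong: if_cong)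
    also have "v \<bullet> q = q $ i - q $ k" by (simp add: v_def inner_diff_left inner_axis')
    finally show ?thesis by simp
  qed
  have "(\<Sum>k\<in>UNIV. m k) = expectation (\<lambda>x. \<Sum>k\<in>UNIV. s z0 x k)"
    unfolding m_def by (subst Bochner_Integration.integral_sum) (auto intro: s_int)
  also have "\<dots> = expectation (\<lambda>x. 1)" using s_sum[of z0] by (intro integral_cong_AE) auto
  finally have "(\<Sum>k\<in>UNIV. m k - q $ k) = 0" using q by (simp add: sum_subtractf)
  moreover have "(\<Sum>k\<in>UNIV. m k - q $ k) = (\<Sum>k\<in>(UNIV::'n set). m i - q $ i)"
    by (intro sum.cong refl antisym diff)
  ultimately have "real CARD('n) * (m i - q $ i) = 0" by simp
  then show "expectation (\<lambda>x. s z0 x i) = q $ i" by (simp add: m_def)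
qed

section \<open>First-order conditions of the Brenier and entropic potentials\<close>

lemma pot_bounded: "\<exists>B. \<forall>x\<in>X. \<forall>i. \<bar>pot z x i\<bar> \<le> B"
proof -
  obtain R where R: "R > 0" "\<And>x. x \<in> X \<Longrightarrow> norm x \<le> R"
    using compact_imp_bounded[OF compact_X] by (auto simp: bounded_pos)
  obtain Y where Y: "Y > 0" "\<And>z x x' j. \<bar>pot z x j - pot z x' j\<bar> \<le> Y * norm (x - x')" using pot_lipschitz by blast
  have "\<bar>pot z x i\<bar> \<le> Y * R + norm z" if "x \<in> X" for x i
  proof -
    have "Y * norm x \<le> Y * R" using R(2)[OF that] Y(1) by (intro mult_left_mono) auto
    moreover have "\<bar>pot z x i - pot z 0 i\<bar> \<le> Y * norm x" using Y(2)[of z x i 0] by simp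
    moreover have "\<bar>pot z 0 i\<bar> \<le> norm z" using component_le_norm_cart[of z i] by (simp add: pot_def)
    ultimately show ?thesis by linarith
  qed
  then show ?thesis by blast
qed

lemma unique_cell:
  assumes "x \<in> X" and no_ties: "\<forall>i k. i \<noteq> k \<longrightarrow> pot z x i \<noteq> pot z x k"
  shows "\<exists>k. (\<forall>j. pot z x j \<le> pot z x k) \<and> (\<forall>j. j \<noteq> k \<longrightarrow> pot z x j < pot z x k) \<and> (\<forall>j. x \<in> cell z j \<longleftrightarrow> j = k)"
proof -
  have "Max (range (pot z x)) \<in> range (pot z x)" by (rule Max_in) auto
  then obtain k where "Max (range (pot z x)) = pot z x k" by (rule rangeE)
  then have k: "pot z x j \<le> pot z x k" for j using Max_ge[of "range (pot z x)" "pot z x j"] by simp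
  have less: "pot z x j < pot z x k" if "j \<noteq> k" for j using k[of j] no_ties that by (simp add: less_le)
  have "x \<in> cell z j \<longleftrightarrow> j = k" for j
  proof
    assume "x \<in> cell z j"
    then have "pot z x k \<le> pot z x j" by (simp add: cell_eq)
    then show "j = k" using less[of j] by (cases "j = k") simp_all
  next
    assume "j = k"
    then show "x \<in> cell z j" using k assms(1) by (simp add: cell_eq)
  qed
  then show ?thesis using k less by blast
qed

lemma pot_sequence: "(\<lambda>n. pot (z + (1 / (real n + 1)) *\<^sub>R v) x j) \<longlonglongrightarrow> pot z x j"
proof -
  have "(\<lambda>n::nat. 1 / (real n + 1)) \<longlonglongrightarrow> 0"
    using LIMSEQ_inverse_real_of_nat by (simp add: inverse_eq_divide add.commute)
  then have "(\<lambda>n. pot z x j - (1 / (real n + 1)) * v $ j) \<longlonglongrightarrow> pot z x j - 0 * v $ j"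
    by (intro tendsto_diff tendsto_mult tendsto_const)
  then show ?thesis by (simp add: pot_def diff_diff_eq)
qed

text \<open>A strict maximizer among finitely many indices survives small changes of the potential,
  so membership is eventually constant.\<close>

lemma cell_sequence:
  assumes "x \<in> X" "\<forall>i k. i \<noteq> k \<longrightarrow> pot z x i \<noteq> pot z x k"
  shows "(\<lambda>n. indicator (cell (z + (1 / (real n + 1)) *\<^sub>R v) i) x :: real) \<longlonglongrightarrow> indicator (cell z i) x"
proof -
  obtain k where k: "\<forall>j. j \<noteq> k \<longrightarrow> pot z x j < pot z x k" "\<forall>j. x \<in> cell z j \<longleftrightarrow> j = k"
    using unique_cell[OF assms] by (elim exE conjE) (rule that)
  let ?z = "\<lambda>n::nat. z + (1 / (real n + 1)) *\<^sub>R v"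
  note lim = pot_sequence[of z v x]
  have "eventually (\<lambda>n. \<forall>j\<in>UNIV - {k}. pot (?z n) x j < pot (?z n) x k) sequentially"
    using k(1) order_tendstoD(1)[OF tendsto_diff[OF lim lim], of 0 k] by (intro eventually_ball_finite) auto
  then have "eventually (\<lambda>n. indicator (cell (?z n) i) x = (indicator (cell z i) x :: real)) sequentially"
  proof eventually_elim
    case (elim n)
    have "x \<in> cell (?z n) j \<longleftrightarrow> j = k" for j
    proof
      assume "x \<in> cell (?z n) j"
      then have "pot (?z n) x k \<le> pot (?z n) x j" by (auto simp: cell_eq)
      moreover have "pot (?z n) x j < pot (?z n) x k" if "j \<noteq> k" using elim that by simp
      ultimately show "j = k" by linarith
    next
      assume "j = k"
      moreover have "pot (?z n) x l \<le> pot (?z n) x k" for l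
        using elim by (cases "l = k") (auto intro: less_imp_le)
      ultimately show "x \<in> cell (?z n) j" using assms(1) by (auto simp: cell_eq)
    qed
    then show ?case using k(2) by (simp add: indicator_def)
  qed
  then show ?thesis by (rule tendsto_eventually)
qed

text \<open>Ties are null, so almost everywhere the cell indicators sum to 1, give a subgradient of
  the maximum, and depend continuously on the potential.\<close>

lemma brenier_optimality:
  fixes Q :: "(real^'d) measure"
  assumes q: "(\<Sum>i\<in>UNIV. measure Q {y i}) = 1" "\<And>i. c0 \<le> measure Q {y i}"
  shows "brenier_potential P Q y \<bullet> 1 = 0" and "prob (cell (brenier_potential P Q y) i) = measure Q {y i}"
proof -
  define f where "f z x = (MAX i. pot z x i)" for z x
  have [measurable]: "f z \<in> borel_measurable borel" for z unfolding f_def[abs_def] by measurable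
  have f_attained: "\<exists>k. f z x = pot z x k" for z x
  proof -
    have "Max (range (pot z x)) \<in> range (pot z x)" by (rule Max_in) auto
    then obtain k where "Max (range (pot z x)) = pot z x k" by (rule rangeE)
    then show ?thesis unfolding f_def ..
  qed
  have f_ge: "pot z x i \<le> f z x" for z x i by (simp add: f_def)
  have F: "semidual P Q y = (\<lambda>z. expectation (f z) + z \<bullet> masses Q y)"
    by (simp add: fun_eq_iff semidual_def f_def[abs_def] pot_def)
  have f_int: "integrable P (f z)" for z
  proof -
    obtain B where B: "\<forall>x\<in>X. \<forall>i. \<bar>pot z x i\<bar> \<le> B" using pot_bounded by blast
    have "\<bar>f z x\<bar> \<le> B" if "x \<in> X" for x
    proof -
      obtain k where "f z x = pot z x k" using f_attained by blast
      then show ?thesis using B that by simp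
    qed
    then show ?thesis by (intro integrable_bounded[of _ B]) auto
  qed
  have bp: "brenier_potential P Q y = arg_min (\<lambda>z. expectation (f z) + z \<bullet> masses Q y) (\<lambda>z. z \<bullet> 1 = 0)"
    by (simp only: brenier_potential_def F)
  have ae: "AE x in P. x \<in> X \<and> (\<forall>i k. i \<noteq> k \<longrightarrow> pot z x i \<noteq> pot z x k)" for z
    using AE_X AE_no_ties[of z] by eventually_elim (rule conjI)
  have sum1: "AE x in P. (\<Sum>i\<in>UNIV. indicator (cell z i) x :: real) = 1" for z
    using ae[of z]
  proof eventually_elim
    case (elim x)
    obtain k where k: "\<forall>j. x \<in> cell z j \<longleftrightarrow> j = k"
      using unique_cell[OF conjunct1[OF elim] conjunct2[OF elim]] by (elim exE conjE) (rule that)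
    have "indicator (cell z i) x = (if i = k then 1 else 0 :: real)" for i
      using k[rule_format, of i] by (simp add: indicator_def)
    then show ?case by simp
  qed
  have subgrad: "AE x in P. f z' x - (\<Sum>i\<in>UNIV. indicator (cell z' i) x * (z $ i - z' $ i)) \<le> f z x" for z z'
    using ae[of z']
  proof eventually_elim
    case (elim x)
    obtain k where k: "\<forall>j. pot z' x j \<le> pot z' x k" "\<forall>j. x \<in> cell z' j \<longleftrightarrow> j = k"
      using unique_cell[OF conjunct1[OF elim] conjunct2[OF elim]] by (elim exE conjE) (rule that)
    obtain l where "f z' x = pot z' x l" using f_attained by blast
    then have "f z' x = pot z' x k" using k(1)[rule_format, of l] f_ge[of z' x k] by simp
    moreover have "indicator (cell z' i) x * (z $ i - z' $ i) = (if i = k then z $ k - z' $ k else 0)" for i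
      using k(2)[rule_format, of i] by (simp add: indicator_def)
    ultimately show ?case using f_ge[of z x k] by (simp add: pot_def)
  qed
  have cont: "AE x in P. (\<lambda>n. indicator (cell (z + (1 / (real n + 1)) *\<^sub>R v) i) x :: real) \<longlonglongrightarrow> indicator (cell z i) x" for z v i
    using ae[of z]
  proof eventually_elim
    case (elim x)
    show ?case by (rule cell_sequence[OF conjunct1[OF elim] conjunct2[OF elim]])
  qed
  have q': "(\<Sum>i\<in>UNIV. masses Q y $ i) = 1" "\<And>i. c0 \<le> masses Q y $ i" using q by (simp_all add: masses_def)
  have meas: "(\<lambda>x. indicator (cell z i) x :: real) \<in> borel_measurable borel" for z i by measurable
  have ind: "0 \<le> (indicator (cell z i) x :: real)" "indicator (cell z i) x \<le> (1 :: real)" for z i x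
    by (simp_all add: indicator_def)
  show "brenier_potential P Q y \<bullet> 1 = 0"
    unfolding bp by (rule potential_optimality(1)[where f=f and s="\<lambda>z x i. indicator (cell z i) x", OF f_int f_ge meas ind sum1 subgrad cont q'])
  have "expectation (indicator (cell (brenier_potential P Q y) i)) = masses Q y $ i"
    unfolding bp by (rule potential_optimality(2)[where f=f and s="\<lambda>z x i. indicator (cell z i) x", OF f_int f_ge meas ind sum1 subgrad cont q'])
  then show "prob (cell (brenier_potential P Q y) i) = measure Q {y i}" by (simp add: masses_def)
qed

lemma entropic_optimality:
  fixes Q :: "(real^'d) measure"
  assumes q: "(\<Sum>i\<in>UNIV. measure Q {y i}) = 1" "\<And>i. c0 \<le> measure Q {y i}" and \<epsilon>: "0 < \<epsilon>"
  shows "entropic_potential P Q y \<epsilon> \<bullet> 1 = 0"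
    and "expectation (\<lambda>x. p \<epsilon> (entropic_potential P Q y \<epsilon>) x i) = measure Q {y i}"
proof -
  define f where "f z x = \<epsilon> * ln (\<Sum>i\<in>UNIV. exp (pot z x i / \<epsilon>))" for z x
  have [measurable]: "f z \<in> borel_measurable borel" for z unfolding f_def[abs_def] by measurable
  have F: "entropic_semidual P Q y \<epsilon> = (\<lambda>z. expectation (f z) + z \<bullet> masses Q y)"
    by (simp add: fun_eq_iff entropic_semidual_def f_def[abs_def] pot_def)
  have f_ge: "pot z x i \<le> f z x" for z x i
  proof -
    have "exp (pot z x i / \<epsilon>) \<le> (\<Sum>i\<in>UNIV. exp (pot z x i / \<epsilon>))" by (intro member_le_sum) auto
    then have "pot z x i / \<epsilon> \<le> ln (\<Sum>i\<in>UNIV. exp (pot z x i / \<epsilon>))"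
      by (subst ln_ge_iff) (auto intro: sum_exp_pos)
    then show ?thesis using \<epsilon> by (simp add: f_def field_simps)
  qed
  have subgrad: "f z' x - (\<Sum>i\<in>UNIV. p \<epsilon> z' x i * (z $ i - z' $ i)) \<le> f z x" for z z' x
  proof -
    have eq: "pot z x i / \<epsilon> - pot z' x i / \<epsilon> = - (z $ i - z' $ i) / \<epsilon>" for i
      by (simp add: pot_def diff_divide_distrib)
    have "\<epsilon> * (ln (\<Sum>i\<in>UNIV. exp (pot z' x i / \<epsilon>)) + (\<Sum>i\<in>UNIV. p \<epsilon> z' x i * (- (z $ i - z' $ i) / \<epsilon>))) \<le> f z x"
      unfolding f_def using log_sum_exp_subgradient[of "\<lambda>i. pot z' x i / \<epsilon>" "\<lambda>i. pot z x i / \<epsilon>"] \<epsilon>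
      by (intro mult_left_mono) (auto simp only: eq p_def less_imp_le)
    also have "\<epsilon> * (ln (\<Sum>i\<in>UNIV. exp (pot z' x i / \<epsilon>)) + (\<Sum>i\<in>UNIV. p \<epsilon> z' x i * (- (z $ i - z' $ i) / \<epsilon>)))
      = f z' x - (\<Sum>i\<in>UNIV. p \<epsilon> z' x i * (z $ i - z' $ i))"
      using \<epsilon> by (simp add: f_def distrib_left sum_distrib_left sum_subtractf[symmetric] sum_negf[symmetric] del: sum_negf)
        (simp add: algebra_simps sum_subtractf)
    finally show ?thesis .
  qed
  have f_int: "integrable P (f z)" for z
  proof -
    obtain B where B: "\<forall>x\<in>X. \<forall>i. \<bar>pot z x i\<bar> \<le> B" using pot_bounded by blast
    define N where "N = real CARD('n)"
    have N: "N \<ge> 1" by (simp add: N_def Suc_leI)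
    have "\<bar>f z x\<bar> \<le> B + \<epsilon> * ln N" if x: "x \<in> X" for x
    proof -
      have "(\<Sum>i\<in>UNIV. exp (pot z x i / \<epsilon>)) \<le> (\<Sum>i\<in>(UNIV::'n set). exp (B / \<epsilon>))"
        using B x \<epsilon> by (intro sum_mono) (auto simp: divide_right_mono abs_le_iff)
      then have "ln (\<Sum>i\<in>UNIV. exp (pot z x i / \<epsilon>)) \<le> ln (N * exp (B / \<epsilon>))"
        using N by (subst ln_le_cancel_iff) (auto intro: sum_exp_pos simp: N_def)
      also have "\<dots> = ln N + B / \<epsilon>" using N by (simp add: ln_mult)
      finally have "f z x \<le> \<epsilon> * (ln N + B / \<epsilon>)" using \<epsilon> by (simp add: f_def)
      also have "\<dots> = B + \<epsilon> * ln N" using \<epsilon> by (simp add: algebra_simps)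
      finally have "f z x \<le> B + \<epsilon> * ln N" .
      moreover have "\<bar>pot z x undefined\<bar> \<le> B" using B x by blast
      then have "- B \<le> f z x" using f_ge[of z x undefined] by linarith
      moreover have "0 \<le> \<epsilon> * ln N" using \<epsilon> N by simp
      ultimately show ?thesis by linarith
    qed
    then show ?thesis by (intro integrable_bounded[of _ "B + \<epsilon> * ln N"]) auto
  qed
  have cont: "(\<lambda>n. p \<epsilon> (z + (1 / (real n + 1)) *\<^sub>R v) x i) \<longlonglongrightarrow> p \<epsilon> z x i" for z v x i
  proof -
    show ?thesis unfolding p_def softmax_def
      using sum_exp_pos[of "\<lambda>j. pot z x j / \<epsilon>"] \<epsilon> by (intro tendsto_intros pot_sequence) auto
  qed
  have ep: "entropic_potential P Q y \<epsilon> = arg_min (\<lambda>z. expectation (f z) + z \<bullet> masses Q y) (\<lambda>z. z \<bullet> 1 = 0)"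
    by (simp only: entropic_potential_def F)
  have q': "(\<Sum>i\<in>UNIV. masses Q y $ i) = 1" "\<And>i. c0 \<le> masses Q y $ i" using q by (simp_all add: masses_def)
  have p01: "0 \<le> p \<epsilon> z x i" "p \<epsilon> z x i \<le> 1" for z x i
    by (simp_all add: p_def softmax_le_1 less_imp_le[OF softmax_pos])
  have sum1: "AE x in P. (\<Sum>i\<in>UNIV. p \<epsilon> z x i) = 1" for z by (simp add: p_def sum_softmax)
  show "entropic_potential P Q y \<epsilon> \<bullet> 1 = 0"
    unfolding ep by (rule potential_optimality(1)[where f=f and s="p \<epsilon>", OF f_int f_ge p_measurable p01 sum1 AE_I2[OF subgrad] AE_I2[OF cont] q'])
  have "expectation (\<lambda>x. p \<epsilon> (entropic_potential P Q y \<epsilon>) x i) = masses Q y $ i"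
    unfolding ep by (rule potential_optimality(2)[where f=f and s="p \<epsilon>", OF f_int f_ge p_measurable p01 sum1 AE_I2[OF subgrad] AE_I2[OF cont] q'])
  then show "expectation (\<lambda>x. p \<epsilon> (entropic_potential P Q y \<epsilon>) x i) = measure Q {y i}" by (simp add: masses_def)
qed

end

section \<open>Comparison of the maps\<close>

text \<open>Pigeonhole: the interval from \<open>v a\<close> to \<open>v b\<close> is cut into
  \<open>CARD('n)\<close> disjoint open pieces, none of which contains \<open>v a\<close>. So one
  piece contains no value of \<open>v\<close>, and \<open>A\<close> consists of the indices above
  it.\<close>

lemma gap_set:
  fixes v :: "'n::finite \<Rightarrow> real"
  assumes ab: "v a < v b"
  obtains A where "b \<in> A" "a \<notin> A" "\<And>i j. i \<in> A \<Longrightarrow> j \<notin> A \<Longrightarrow> (v b - v a) / CARD('n) \<le> v i - v j"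
proof -
  define h where "h = (v b - v a) / CARD('n)"
  have h: "h > 0" using ab by (simp add: h_def)
  have vb: "v b = v a + real CARD('n) * h" by (simp add: h_def)
  have "\<exists>l<CARD('n). \<forall>i. \<not> (v a + real l * h < v i \<and> v i < v a + (real l + 1) * h)"
  proof (rule ccontr)
    assume "\<not> ?thesis"
    then obtain w where w: "\<And>l. l < CARD('n) \<Longrightarrow> v a + real l * h < v (w l) \<and> v (w l) < v a + (real l + 1) * h"
      by metis
    have "inj_on w {..<CARD('n)}"
    proof (rule inj_onI)
      fix l l' assume l: "l \<in> {..<CARD('n)}" "l' \<in> {..<CARD('n)}" "w l = w l'"
      have "real l * h < (real l' + 1) * h" "real l' * h < (real l + 1) * h"
        using w[of l] w[of l'] l by (auto intro: less_trans)
      then have "real l < real l' + 1" "real l' < real l + 1" using h by (simp_all only: mult_less_cancel_right_pos)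
      then show "l = l'" by linarith
    qed
    moreover have "w ` {..<CARD('n)} \<subseteq> UNIV - {a}"
    proof clarsimp
      fix l assume l: "l < CARD('n)" "a = w l"
      have "v a + real l * h < v a" using w[OF l(1)] l(2) by simp
      moreover have "0 \<le> real l * h" using h by simp
      ultimately show False by linarith
    qed
    ultimately have "card {..<CARD('n)} \<le> card (UNIV - {a})" by (intro card_inj_on_le) auto
    moreover have "card (UNIV - {a}) < card (UNIV :: 'n set)" by (rule psubset_card_mono) auto
    ultimately have "CARD('n) < CARD('n)" unfolding card_lessThan by (rule le_less_trans)
    then show False by simp
  qed
  then obtain l where l: "l < CARD('n)" "\<And>i. \<not> (v a + real l * h < v i \<and> v i < v a + (real l + 1) * h)" by blast
  define A where "A = {i. v a + (real l + 1) * h \<le> v i}"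
  have "real l + 1 \<le> real CARD('n)" using l(1) by linarith
  then have "b \<in> A" using h by (simp add: A_def vb)
  moreover have "a \<notin> A" using h by (simp add: A_def add_pos_nonneg mult_pos_pos not_le)
  moreover have "h \<le> v i - v j" if "i \<in> A" "j \<notin> A" for i j
  proof -
    have "v a + real l * h + h \<le> v i" using that(1) by (simp add: A_def algebra_simps)
    moreover have "v j \<le> v a + real l * h" using that(2) l(2)[of j] by (simp add: A_def not_le not_less)
    ultimately show ?thesis by linarith
  qed
  ultimately show ?thesis using that unfolding h_def by blast
qed

context semidiscrete
begin

lemma p_bounds: "0 \<le> p \<epsilon> z x i" "p \<epsilon> z x i \<le> 1"
  by (simp_all add: p_def softmax_le_1 less_imp_le[OF softmax_pos])

lemma integrable_p: "integrable P (\<lambda>x. p \<epsilon> z x i)"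
  using p_bounds by (intro integrable_bounded[of _ 1]) auto

lemma expectation_sum_p: "expectation (\<lambda>x. \<Sum>i\<in>A. p \<epsilon> z x i) = (\<Sum>i\<in>A. expectation (\<lambda>x. p \<epsilon> z x i))"
  by (rule Bochner_Integration.integral_sum) (rule integrable_p)

text \<open>Let \<open>A\<close> lie above a gap of \<open>z - ze\<close>. From \<open>ze\<close> to
  \<open>z\<close> the mean softmax mass of \<open>A\<close> drops by at least \<open>h / 2\<close>
  times a variance of order \<epsilon>. It drops by at most
  \<open>N * K1 * \<epsilon> powr (1 + \<alpha>)\<close>, because the masses at \<open>ze\<close>
  are the cell masses at \<open>z\<close>.\<close>

lemma potential_distance:
  "\<exists>K>0. \<forall>z ze \<epsilon>. good z \<longrightarrow> 0 < \<epsilon> \<longrightarrow> \<epsilon> < 1 \<longrightarrow> K * \<epsilon> powr \<alpha> < 1 \<longrightarrow> z \<bullet> 1 = 0 \<longrightarrow> ze \<bullet> 1 = 0 \<longrightarrow>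
    (\<forall>i. expectation (\<lambda>x. p \<epsilon> ze x i) = prob (cell z i)) \<longrightarrow>
    (\<forall>i. \<bar>z $ i - ze $ i\<bar> \<le> real CARD('n) * K * \<epsilon> powr (1 + \<alpha>))"
proof -
  obtain K1 where K1: "K1 > 0" "\<And>\<phi> i z \<epsilon>. admissible 1 \<phi> \<Longrightarrow> good z \<Longrightarrow> 0 < \<epsilon> \<Longrightarrow> \<epsilon> < 1 \<Longrightarrow>
    \<bar>expectation (\<lambda>x. \<phi> x * (p \<epsilon> z x i - indicator (cell z i) x))\<bar> \<le> K1 * \<epsilon> powr (1 + \<alpha>)"
    using softmax_cell_sum[of 1] by blast
  obtain c where c: "c > 0" "\<And>z \<epsilon> A. 0 < \<epsilon> \<Longrightarrow> \<epsilon> < 1 \<Longrightarrow> c0 \<le> expectation (\<lambda>x. \<Sum>i\<in>A. p \<epsilon> z x i) \<Longrightarrow>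
    expectation (\<lambda>x. \<Sum>i\<in>A. p \<epsilon> z x i) \<le> 1 - c0 \<Longrightarrow>
    c * \<epsilon> \<le> expectation (\<lambda>x. (\<Sum>i\<in>A. p \<epsilon> z x i) * (1 - (\<Sum>i\<in>A. p \<epsilon> z x i)))"
    using softmax_variance_lower by blast
  define N where "N = real CARD('n)"
  have N: "N > 0" by (simp add: N_def)
  \<comment> \<open>Read off from \<open>h / 2 * (c * \<epsilon>) \<le> N * K1 * \<epsilon> powr (1
    + \<alpha>)\<close>, solved for \<open>h\<close>.\<close>
  define K where "K = 2 * N * K1 / c"
  have K: "K > 0" using K1 c N by (simp add: K_def)
  have main: "\<bar>z $ l - ze $ l\<bar> \<le> N * K * \<epsilon> powr (1 + \<alpha>)"
    if z: "good z" and \<epsilon>: "0 < \<epsilon>" "\<epsilon> < 1" and small: "K * \<epsilon> powr \<alpha> < 1" and sum0: "z \<bullet> 1 = 0" "ze \<bullet> 1 = 0"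
      and opt: "\<forall>i. expectation (\<lambda>x. p \<epsilon> ze x i) = prob (cell z i)" for z ze \<epsilon> l
  proof -
    have adm: "admissible 1 (\<lambda>_. 1)" by (simp add: admissible_def)
    have cellp: "\<bar>expectation (\<lambda>x. p \<epsilon> z x i) - prob (cell z i)\<bar> \<le> K1 * \<epsilon> powr (1 + \<alpha>)" for i
    proof -
      have "expectation (\<lambda>x. p \<epsilon> z x i - indicator (cell z i) x) = expectation (\<lambda>x. p \<epsilon> z x i) - expectation (indicator (cell z i))"
        by (rule Bochner_Integration.integral_diff) (auto intro: integrable_p simp: less_top[symmetric])
      then show ?thesis using K1(2)[OF adm z \<epsilon>, of i] by simp
    qed
    define v where "v i = z $ i - ze $ i" for i
    have gap: "v b - v a \<le> N * K * \<epsilon> powr (1 + \<alpha>)" for a b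
    proof (cases "v a < v b")
      case True
      obtain A where A: "b \<in> A" "a \<notin> A" "\<And>i j. i \<in> A \<Longrightarrow> j \<notin> A \<Longrightarrow> (v b - v a) / N \<le> v i - v j"
        using gap_set[OF True, folded N_def] by blast
      define \<gamma> where "\<gamma> = (v b - v a) / N"
      have \<gamma>: "\<gamma> > 0" using True N by (simp add: \<gamma>_def)
      \<comment> \<open>\<open>sum_softmax_gap\<close> requires the cap at 1. Smallness of
        \<open>K * \<epsilon> powr \<alpha>\<close> rules it out afterwards, leaving
        \<open>h = \<gamma> / \<epsilon>\<close>.\<close>
      define h where "h = min (\<gamma> / \<epsilon>) 1"
      have h: "0 \<le> h" "h \<le> 1" using \<gamma> \<epsilon> by (auto simp: h_def)
      let ?g = "\<lambda>x. \<Sum>i\<in>A. p \<epsilon> ze x i"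
      have pw: "h / 2 * (?g x * (1 - ?g x)) \<le> ?g x - (\<Sum>i\<in>A. p \<epsilon> z x i)" for x
        unfolding p_def
      proof (rule sum_softmax_gap[OF _ h])
        fix i j assume ij: "i \<in> A" "j \<notin> A"
        have "h \<le> \<gamma> / \<epsilon>" by (simp add: h_def)
        also have "\<dots> \<le> (v i - v j) / \<epsilon>"
          using A(3)[OF ij] \<epsilon> by (intro divide_right_mono) (auto simp: \<gamma>_def)
        also have "\<dots> = (pot z x j / \<epsilon> - pot ze x j / \<epsilon>) - (pot z x i / \<epsilon> - pot ze x i / \<epsilon>)"
          by (simp add: pot_def v_def diff_divide_distrib)
        finally show "h \<le> (pot z x j / \<epsilon> - pot ze x j / \<epsilon>) - (pot z x i / \<epsilon> - pot ze x i / \<epsilon>)" .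
      qed
      have g01: "0 \<le> ?g x" "?g x \<le> 1" for x
        unfolding p_def by (rule sum_softmax_nonneg sum_softmax_le_1)+
      have int_gg: "integrable P (\<lambda>x. ?g x * (1 - ?g x))"
      proof (rule integrable_bounded)
        show "\<bar>?g x * (1 - ?g x)\<bar> \<le> 1" for x
          using g01[of x] mult_mono[of "?g x" 1 "1 - ?g x" 1] by simp
      qed auto
      have Eg: "expectation ?g = (\<Sum>i\<in>A. prob (cell z i))" using opt by (simp add: expectation_sum_p)
      \<comment> \<open>That \<open>A\<close> contains \<open>b\<close> and misses \<open>a\<close>
        keeps its mass between \<open>c0\<close> and \<open>1 - c0\<close>, as the variance bound
        demands.\<close>
      have "prob (cell z b) \<le> (\<Sum>i\<in>A. prob (cell z i))" using A(1) by (intro member_le_sum) auto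
      then have lo: "c0 \<le> expectation ?g" using z unfolding Eg good_def by (meson order_trans)
      have "(\<Sum>i\<in>UNIV. expectation (\<lambda>x. p \<epsilon> ze x i)) = 1"
        unfolding expectation_sum_p[symmetric] by (simp add: p_def sum_softmax)
      then have tot: "(\<Sum>i\<in>UNIV. prob (cell z i)) = 1" using opt by simp
      have "expectation ?g + prob (cell z a) = (\<Sum>i\<in>insert a A. prob (cell z i))" using A(2) by (simp add: Eg)
      also have "\<dots> \<le> (\<Sum>i\<in>UNIV. prob (cell z i))" by (intro sum_mono2) auto
      finally have "expectation ?g + prob (cell z a) \<le> 1" by (simp add: tot)
      moreover have "c0 \<le> prob (cell z a)" using z by (simp add: good_def)
      ultimately have hi: "expectation ?g \<le> 1 - c0" by linarith
      have "h / 2 * (c * \<epsilon>) \<le> h / 2 * expectation (\<lambda>x. ?g x * (1 - ?g x))"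
        using c(2)[OF \<epsilon> lo hi] h by (intro mult_left_mono) auto
      also have "\<dots> = expectation (\<lambda>x. h / 2 * (?g x * (1 - ?g x)))" by simp
      also have "\<dots> \<le> expectation (\<lambda>x. ?g x - (\<Sum>i\<in>A. p \<epsilon> z x i))"
        by (intro Bochner_Integration.integral_mono pw integrable_mult_right int_gg
            Bochner_Integration.integrable_diff Bochner_Integration.integrable_sum integrable_p)
      also have "\<dots> = expectation ?g - expectation (\<lambda>x. \<Sum>i\<in>A. p \<epsilon> z x i)"
        by (intro Bochner_Integration.integral_diff Bochner_Integration.integrable_sum integrable_p)
      also have "\<dots> = (\<Sum>i\<in>A. prob (cell z i) - expectation (\<lambda>x. p \<epsilon> z x i))"
        unfolding Eg expectation_sum_p by (simp add: sum_subtractf)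
      also have "\<dots> \<le> (\<Sum>i\<in>A. K1 * \<epsilon> powr (1 + \<alpha>))"
        by (intro sum_mono) (use cellp in \<open>auto simp: abs_le_iff\<close>)
      also have "\<dots> \<le> (\<Sum>i\<in>(UNIV::'n set). K1 * \<epsilon> powr (1 + \<alpha>))" using K1 by (intro sum_mono2) auto
      also have "\<dots> = N * K1 * (\<epsilon> * \<epsilon> powr \<alpha>)" using \<epsilon> by (simp add: N_def powr_add)
      finally have "h * (c * \<epsilon>) \<le> (K * \<epsilon> powr \<alpha>) * (c * \<epsilon>)" using c by (simp add: K_def field_simps)
      then have hK: "h \<le> K * \<epsilon> powr \<alpha>" using c \<epsilon> by (simp only: mult_le_cancel_right_pos mult_pos_pos)
      then have "h = \<gamma> / \<epsilon>" using small by (auto simp: h_def min_def split: if_splits)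
      then have "\<gamma> \<le> K * \<epsilon> powr \<alpha> * \<epsilon>" using hK \<epsilon> by (simp add: divide_le_eq)
      then have "N * \<gamma> \<le> N * (K * \<epsilon> powr \<alpha> * \<epsilon>)" using N by simp
      moreover have "N * \<gamma> = v b - v a" using N by (simp add: \<gamma>_def)
      ultimately show ?thesis using \<epsilon> by (simp add: powr_add mult_ac)
    next
      case False
      moreover have "0 \<le> N * K * \<epsilon> powr (1 + \<alpha>)" using N K by simp
      ultimately show ?thesis by linarith
    qed
    \<comment> \<open>The zero sum turns bounds on differences into bounds on coordinates:
      \<open>N * v l\<close> is the sum of all \<open>v l - v a\<close>.\<close>
    have vsum: "(\<Sum>i\<in>UNIV. v i) = 0" using sum0 by (simp add: v_def sum_subtractf sum_vec_eq_inner)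
    let ?b = "N * K * \<epsilon> powr (1 + \<alpha>)"
    have "(\<Sum>a\<in>UNIV. v l - v a) \<le> (\<Sum>a\<in>(UNIV::'n set). ?b)" "(\<Sum>a\<in>UNIV. v a - v l) \<le> (\<Sum>a\<in>(UNIV::'n set). ?b)"
      by (intro sum_mono gap)+
    then have "N * v l \<le> N * ?b" "N * (- v l) \<le> N * ?b"
      using vsum by (simp_all add: sum_subtractf N_def)
    then have "v l \<le> ?b" "- v l \<le> ?b" using N by (simp_all only: mult_le_cancel_left_pos)
    then show ?thesis by (simp add: v_def abs_le_iff)
  qed
  show ?thesis
    by (intro exI[of _ K] conjI K allI impI) (rule main[unfolded N_def])
qed

text \<open>The relative change of the weights is of order \<open>\<delta> / \<epsilon>\<close>, at
  most \<kappa>. It is multiplied by \<open>p * (1 - p)\<close>, which is dominated by ties with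
  integral of order \<epsilon>; the two powers of \<epsilon> cancel.\<close>

lemma expectation_p_diff:
  "\<exists>K>0. \<forall>z ze \<epsilon> \<delta> i. 0 < \<epsilon> \<longrightarrow> \<delta> \<le> \<kappa> * \<epsilon> \<longrightarrow> (\<forall>j. \<bar>z $ j - ze $ j\<bar> \<le> \<delta>) \<longrightarrow>
    expectation (\<lambda>x. \<bar>p \<epsilon> ze x i - p \<epsilon> z x i\<bar>) \<le> K * \<delta>"
proof -
  obtain K where K: "K > 0" "\<And>i k z \<epsilon>. i \<noteq> k \<Longrightarrow> 0 < \<epsilon> \<Longrightarrow> expectation (\<lambda>x. exp (- margin z i k x / \<epsilon>)) \<le> K * \<epsilon>"
    using integral_tie by blast
  define N where "N = real CARD('n)"
  have N: "N > 0" by (simp add: N_def)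
  have "expectation (\<lambda>x. \<bar>p \<epsilon> ze x i - p \<epsilon> z x i\<bar>) \<le> (2 * exp (2 * \<kappa>) * N * K) * \<delta>"
    if \<epsilon>: "0 < \<epsilon>" and \<delta>\<kappa>: "\<delta> \<le> \<kappa> * \<epsilon>" and v: "\<forall>j. \<bar>z $ j - ze $ j\<bar> \<le> \<delta>" for z ze \<epsilon> \<delta> i
  proof -
    have \<delta>: "0 \<le> \<delta>" using v by (meson abs_ge_zero order_trans)
    define c where "c = \<delta> / \<epsilon>"
    have c: "0 \<le> c" "c \<le> \<kappa>" using \<delta> \<delta>\<kappa> \<epsilon> by (auto simp: c_def divide_le_eq)
    let ?J = "UNIV - {i}"
    have pw: "\<bar>p \<epsilon> ze x i - p \<epsilon> z x i\<bar> \<le> (2 * c * exp (2 * \<kappa>)) * (\<Sum>j\<in>?J. tie \<epsilon> z i j x)" for x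
    proof -
      let ?u = "\<lambda>j. pot z x j / \<epsilon>" and ?u' = "\<lambda>j. pot ze x j / \<epsilon>"
      have "\<bar>?u' j - ?u j\<bar> \<le> c" for j
      proof -
        have "\<bar>?u' j - ?u j\<bar> = \<bar>z $ j - ze $ j\<bar> / \<epsilon>"
          using \<epsilon> by (simp add: pot_def diff_divide_distrib[symmetric])
        then show ?thesis using v \<epsilon> by (simp add: c_def divide_right_mono)
      qed
      from abs_sum_softmax_diff_le[OF this, where A="{i}"]
      have "\<bar>p \<epsilon> ze x i - p \<epsilon> z x i\<bar> \<le> (exp (2 * c) - 1) * (p \<epsilon> z x i * (1 - p \<epsilon> z x i))" by (simp add: p_def)
      also have "\<dots> \<le> (2 * c * exp (2 * \<kappa>)) * (\<Sum>j\<in>?J. tie \<epsilon> z i j x)"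
      proof (rule mult_mono)
        have "1 - 2 * c \<le> exp (- (2 * c))" using exp_ge_add_one_self[of "- (2 * c)"] by simp
        then have "exp (2 * c) * (1 - 2 * c) \<le> exp (2 * c) * exp (- (2 * c))" by (rule mult_left_mono) simp
        then have "exp (2 * c) - 1 \<le> 2 * c * exp (2 * c)" by (simp add: exp_add[symmetric] algebra_simps)
        also have "\<dots> \<le> 2 * c * exp (2 * \<kappa>)" using c by (intro mult_left_mono) auto
        finally show "exp (2 * c) - 1 \<le> 2 * c * exp (2 * \<kappa>)" .
        have "1 - p \<epsilon> z x i = (\<Sum>j\<in>?J. p \<epsilon> z x j)"
          using sum_softmax[of ?u] sum.remove[of UNIV i "softmax ?u"] by (simp add: p_def)
        then have "p \<epsilon> z x i * (1 - p \<epsilon> z x i) = (\<Sum>j\<in>?J. p \<epsilon> z x i * p \<epsilon> z x j)" by (simp add: sum_distrib_left)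
        also have "\<dots> \<le> (\<Sum>j\<in>?J. tie \<epsilon> z i j x)"
        proof (rule sum_mono)
          fix j
          have "\<bar>?u i - ?u j\<bar> = margin z i j x / \<epsilon>"
            using \<epsilon> by (simp add: diff_divide_distrib[symmetric] abs_minus_commute)
          then show "p \<epsilon> z x i * p \<epsilon> z x j \<le> tie \<epsilon> z i j x"
            using softmax_mult_le[of ?u i j] by (simp add: p_def)
        qed
        finally show "p \<epsilon> z x i * (1 - p \<epsilon> z x i) \<le> (\<Sum>j\<in>?J. tie \<epsilon> z i j x)" .
      qed (use c p_bounds[of \<epsilon> z x i] in auto)
      finally show ?thesis .
    qed
    have tie_int: "integrable P (\<lambda>x. tie \<epsilon> z i j x)" for j
      using \<epsilon> by (intro integrable_bounded[of _ 1]) auto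
    have "expectation (\<lambda>x. \<bar>p \<epsilon> ze x i - p \<epsilon> z x i\<bar>) \<le> expectation (\<lambda>x. (2 * c * exp (2 * \<kappa>)) * (\<Sum>j\<in>?J. tie \<epsilon> z i j x))"
      by (intro Bochner_Integration.integral_mono pw integrable_abs Bochner_Integration.integrable_diff integrable_p
          integrable_mult_right Bochner_Integration.integrable_sum tie_int)
    also have "\<dots> = (2 * c * exp (2 * \<kappa>)) * (\<Sum>j\<in>?J. expectation (\<lambda>x. tie \<epsilon> z i j x))"
    proof -
      have "expectation (\<lambda>x. \<Sum>j\<in>?J. tie \<epsilon> z i j x) = (\<Sum>j\<in>?J. expectation (\<lambda>x. tie \<epsilon> z i j x))"
        by (rule Bochner_Integration.integral_sum) (rule tie_int)
      then show ?thesis by (simp only: integral_mult_right_zero)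
    qed
    also have "\<dots> \<le> (2 * c * exp (2 * \<kappa>)) * (\<Sum>j\<in>?J. K * \<epsilon>)"
      using c by (intro mult_left_mono sum_mono K(2) \<epsilon>) auto
    also have "\<dots> \<le> (2 * c * exp (2 * \<kappa>)) * (\<Sum>j\<in>(UNIV::'n set). K * \<epsilon>)"
      using c K \<epsilon> by (intro mult_left_mono sum_mono2) auto
    also have "\<dots> = (2 * exp (2 * \<kappa>) * N * K) * \<delta>" using \<epsilon> by (simp add: c_def N_def)
    finally show ?thesis .
  qed
  then show ?thesis using K N by (intro exI[of _ "2 * exp (2 * \<kappa>) * N * K"]) auto
qed

lemma entropic_map_eq: "entropic_map P Q y \<epsilon> x = (\<Sum>i\<in>UNIV. p \<epsilon> (entropic_potential P Q y \<epsilon>) x i *\<^sub>R y i)"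
  by (simp add: entropic_map_def Let_def p_def softmax_def pot_def)

lemma AE_brenier_map_eq:
  "AE x in P. brenier_map P X Q y x = (\<Sum>i\<in>UNIV. indicator (cell (brenier_potential P Q y) i) x *\<^sub>R y i)"
  using AE_X AE_no_ties[of "brenier_potential P Q y"]
proof eventually_elim
  case (elim x)
  obtain k where k: "\<forall>j. x \<in> cell (brenier_potential P Q y) j \<longleftrightarrow> j = k"
    using unique_cell[OF elim] by (elim exE conjE) (rule that)
  have "(SOME i. x \<in> cell (brenier_potential P Q y) i) = k" using k by (intro some_equality) auto
  then have "brenier_map P X Q y x = y k" by (simp add: brenier_map_def)
  moreover have "indicator (cell (brenier_potential P Q y) i) x *\<^sub>R y i = (if i = k then y k else 0)" for i
    using k[rule_format, of i] by (simp add: indicator_def)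
  ultimately show ?case by simp
qed

text \<open>The choice acts on the set of indices of all cells containing \<open>x\<close>, a
  function of \<open>x\<close> with finitely many values and Borel level sets.\<close>

lemma brenier_map_measurable [measurable]: "brenier_map P X Q y \<in> borel_measurable borel"
proof -
  let ?z = "brenier_potential P Q y"
  let ?S = "\<lambda>x. {i. x \<in> cell ?z i}"
  have "?S \<in> borel \<rightarrow>\<^sub>M count_space UNIV"
  proof (subst measurable_count_space_eq2, simp, intro conjI ballI)
    fix A :: "'n set"
    have "?S -` {A} \<inter> space borel = (\<Inter>i\<in>UNIV. if i \<in> A then cell ?z i else - cell ?z i)"
      by (auto split: if_splits)
    also have "\<dots> \<in> sets borel" by (intro sets.finite_INT) auto
    finally show "?S -` {A} \<inter> space borel \<in> sets borel" .
  qed auto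
  then have "(\<lambda>x. (\<lambda>A. y (SOME i. i \<in> A)) (?S x)) \<in> borel_measurable borel"
    by (rule measurable_compose) simp
  then show ?thesis by (simp add: brenier_map_def[abs_def])
qed

lemma abs_inner_y_le: "\<bar>a \<bullet> y i\<bar> \<le> (\<Sum>j\<in>UNIV. norm (y j)) * norm a"
proof -
  have "\<bar>a \<bullet> y i\<bar> \<le> norm a * norm (y i)" by (rule Cauchy_Schwarz_ineq2)
  also have "\<dots> \<le> norm a * (\<Sum>j\<in>UNIV. norm (y j))"
    by (intro mult_left_mono member_le_sum) auto
  finally show ?thesis by (simp add: mult.commute)
qed

lemma map_distance:
  "\<exists>C>0. \<forall>(Q :: (real^'d) measure) \<epsilon> (\<phi> :: real^'d \<Rightarrow> real^'d).
    (\<Sum>i\<in>UNIV. measure Q {y i}) = 1 \<longrightarrow> (\<forall>i. c0 \<le> measure Q {y i}) \<longrightarrow> 0 < \<epsilon> \<longrightarrow> \<epsilon> < 1 \<longrightarrow>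
    \<phi> \<in> borel_measurable borel \<longrightarrow> (\<forall>x\<in>X. norm (\<phi> x) \<le> 1) \<longrightarrow>
    (\<forall>x\<in>X. \<forall>x'\<in>X. norm (\<phi> x - \<phi> x') \<le> norm (x - x') powr \<alpha>) \<longrightarrow>
    expectation (\<lambda>x. \<phi> x \<bullet> (entropic_map P Q y \<epsilon> x - brenier_map P X Q y x)) \<le> C * \<epsilon> powr (1 + \<alpha>)"
proof -
  define B where "B = (\<Sum>j\<in>UNIV. norm (y j))"
  define N where "N = real CARD('n)"
  have B: "B \<ge> 0" and N: "N > 0" by (auto simp: B_def N_def intro: sum_nonneg)
  obtain K1 where K1: "K1 > 0" "\<And>\<phi> i z \<epsilon>. admissible B \<phi> \<Longrightarrow> good z \<Longrightarrow> 0 < \<epsilon> \<Longrightarrow> \<epsilon> < 1 \<Longrightarrow>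
    \<bar>expectation (\<lambda>x. \<phi> x * (p \<epsilon> z x i - indicator (cell z i) x))\<bar> \<le> K1 * \<epsilon> powr (1 + \<alpha>)"
    using softmax_cell_sum[of B] by blast
  obtain K where K: "K > 0" "\<And>z ze \<epsilon>. good z \<Longrightarrow> 0 < \<epsilon> \<Longrightarrow> \<epsilon> < 1 \<Longrightarrow> K * \<epsilon> powr \<alpha> < 1 \<Longrightarrow> z \<bullet> 1 = 0 \<Longrightarrow> ze \<bullet> 1 = 0 \<Longrightarrow>
    (\<forall>i. expectation (\<lambda>x. p \<epsilon> ze x i) = prob (cell z i)) \<Longrightarrow> (\<forall>i. \<bar>z $ i - ze $ i\<bar> \<le> real CARD('n) * K * \<epsilon> powr (1 + \<alpha>))"
    using potential_distance by blast
  \<comment> \<open>For the \<open>\<delta>\<close> coming from \<open>potential_distance\<close>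
    the ratio \<open>\<delta> / \<epsilon>\<close> is at most \<open>N * K\<close>, which fixes
    \<kappa>.\<close>
  obtain K2 where K2: "K2 > 0" "\<And>z ze \<epsilon> \<delta> i. 0 < \<epsilon> \<Longrightarrow> \<delta> \<le> (N * K) * \<epsilon> \<Longrightarrow> (\<forall>j. \<bar>z $ j - ze $ j\<bar> \<le> \<delta>) \<Longrightarrow>
    expectation (\<lambda>x. \<bar>p \<epsilon> ze x i - p \<epsilon> z x i\<bar>) \<le> K2 * \<delta>"
    using expectation_p_diff[of "N * K"] by blast
  define C1 where "C1 = N * (B * (K2 * (N * K)) + K1)"
  \<comment> \<open>Covers \<open>K * \<epsilon> powr \<alpha> \<ge> 1\<close>, where
    \<open>potential_distance\<close> says nothing: the power
    \<open>(1 + \<alpha>) / \<alpha>\<close> of this quantity is at least 1 and contains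
    \<open>\<epsilon> powr (1 + \<alpha>)\<close>, so the trivial bound \<open>2 * N * B\<close> is
    enough.\<close>
  define C2 where "C2 = 2 * N * B * K powr ((1 + \<alpha>) / \<alpha>)"
  define C where "C = C1 + C2 + 1"
  have C0: "C1 \<ge> 0" "C2 \<ge> 0" using N B K K1 K2 by (auto simp: C1_def C2_def)
  then have C: "C > 0" "C1 \<le> C" "C2 \<le> C" by (auto simp: C_def)
  have "expectation (\<lambda>x. \<phi> x \<bullet> (entropic_map P Q y \<epsilon> x - brenier_map P X Q y x)) \<le> C * \<epsilon> powr (1 + \<alpha>)"
    if q: "(\<Sum>i\<in>UNIV. measure Q {y i}) = 1" "\<forall>i. c0 \<le> measure Q {y i}" and \<epsilon>: "0 < \<epsilon>" "\<epsilon> < 1"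
      and \<phi>_m [measurable]: "\<phi> \<in> borel_measurable borel" and \<phi>1: "\<forall>x\<in>X. norm (\<phi> x) \<le> 1"
      and \<phi>h: "\<forall>x\<in>X. \<forall>x'\<in>X. norm (\<phi> x - \<phi> x') \<le> norm (x - x') powr \<alpha>"
    for Q :: "(real^'d) measure" and \<epsilon> and \<phi> :: "real^'d \<Rightarrow> real^'d"
  proof -
    define z where "z = brenier_potential P Q y"
    define ze where "ze = entropic_potential P Q y \<epsilon>"
    have z1: "z \<bullet> 1 = 0" and zq: "\<And>i. prob (cell z i) = measure Q {y i}"
      unfolding z_def using brenier_optimality[OF q(1)] q(2) by auto
    have ze1: "ze \<bullet> 1 = 0" and zeq: "\<And>i. expectation (\<lambda>x. p \<epsilon> ze x i) = measure Q {y i}"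
      unfolding ze_def using entropic_optimality[OF q(1) _ \<epsilon>(1)] q(2) by auto
    have gz: "good z" using q(2) by (simp add: good_def zq)
    let ?f = "\<lambda>i x. \<phi> x \<bullet> y i"
    have f_bound: "\<bar>?f i x\<bar> \<le> B" if "x \<in> X" for i x
    proof -
      have "B * norm (\<phi> x) \<le> B * 1" using \<phi>1 that B by (intro mult_left_mono) auto
      then show ?thesis using abs_inner_y_le[of "\<phi> x" i] by (simp add: B_def)
    qed
    have adm: "admissible B (?f i)" for i
      unfolding admissible_def
    proof (intro conjI ballI)
      fix x x' assume x: "x \<in> X" "x' \<in> X"
      have "\<bar>?f i x - ?f i x'\<bar> = \<bar>(\<phi> x - \<phi> x') \<bullet> y i\<bar>" by (simp add: inner_diff_left)
      also have "\<dots> \<le> B * norm (\<phi> x - \<phi> x')" unfolding B_def by (rule abs_inner_y_le)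
      also have "\<dots> \<le> B * norm (x - x') powr \<alpha>" using \<phi>h x B by (intro mult_left_mono) auto
      finally show "\<bar>?f i x - ?f i x'\<bar> \<le> B * norm (x - x') powr \<alpha>" .
    qed (use f_bound in auto)
    let ?d = "\<lambda>i x. ?f i x * (p \<epsilon> ze x i - indicator (cell z i) x)"
    have d_bound: "\<bar>?d i x\<bar> \<le> 2 * B" if "x \<in> X" for i x
    proof -
      have "\<bar>p \<epsilon> ze x i - indicator (cell z i) x\<bar> \<le> 2"
        using p_bounds[of \<epsilon> ze x i] by (auto simp: indicator_def)
      then have "\<bar>?f i x\<bar> * \<bar>p \<epsilon> ze x i - indicator (cell z i) x\<bar> \<le> B * 2"
        using f_bound[OF that] B by (intro mult_mono) auto
      then show ?thesis by (simp add: abs_mult)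
    qed
    have d_int: "integrable P (?d i)" for i
      using d_bound by (intro integrable_bounded[of _ "2 * B"]) auto
    have "expectation (\<lambda>x. \<phi> x \<bullet> (entropic_map P Q y \<epsilon> x - brenier_map P X Q y x)) = expectation (\<lambda>x. \<Sum>i\<in>UNIV. ?d i x)"
    proof (rule integral_cong_AE)
      show "AE x in P. \<phi> x \<bullet> (entropic_map P Q y \<epsilon> x - brenier_map P X Q y x) = (\<Sum>i\<in>UNIV. ?d i x)"
        using AE_brenier_map_eq[of Q]
      proof eventually_elim
        case (elim x)
        show ?case unfolding elim entropic_map_eq z_def[symmetric] ze_def[symmetric]
          by (simp add: inner_diff_right inner_sum_right sum_subtractf right_diff_distrib mult.commute)
      qed
    qed (auto simp: entropic_map_eq)
    also have "\<dots> = (\<Sum>i\<in>UNIV. expectation (?d i))"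
      by (rule Bochner_Integration.integral_sum) (rule d_int)
    finally have eq: "expectation (\<lambda>x. \<phi> x \<bullet> (entropic_map P Q y \<epsilon> x - brenier_map P X Q y x)) = (\<Sum>i\<in>UNIV. expectation (?d i))" .
    have "(\<Sum>i\<in>UNIV. expectation (?d i)) \<le> C * \<epsilon> powr (1 + \<alpha>)"
    proof (cases "K * \<epsilon> powr \<alpha> < 1")
      case True
      define \<delta> where "\<delta> = N * K * \<epsilon> powr (1 + \<alpha>)"
      have \<delta>: "\<forall>i. \<bar>z $ i - ze $ i\<bar> \<le> \<delta>"
        unfolding \<delta>_def N_def by (rule K(2)[OF gz \<epsilon> True z1 ze1]) (simp add: zq zeq)
      have "\<epsilon> powr (1 + \<alpha>) \<le> \<epsilon>" using \<epsilon> \<alpha>_pos powr_mono'[of 1 "1 + \<alpha>" \<epsilon>] by simp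
      then have \<delta>2: "\<delta> \<le> (N * K) * \<epsilon>" using N K by (simp add: \<delta>_def)
      have "expectation (?d i) \<le> (B * (K2 * (N * K)) + K1) * \<epsilon> powr (1 + \<alpha>)" for i
      proof -
        \<comment> \<open>\<open>?a\<close> moves the potential from \<open>z\<close> to
          \<open>ze\<close> at fixed temperature; \<open>?b\<close> compares softmax and cells at
          the same potential \<open>z\<close>.\<close>
        let ?a = "\<lambda>x. ?f i x * (p \<epsilon> ze x i - p \<epsilon> z x i)" and ?b = "\<lambda>x. ?f i x * (p \<epsilon> z x i - indicator (cell z i) x)"
        have pd: "\<bar>p \<epsilon> ze x i - p \<epsilon> z x i\<bar> \<le> 1" for x
          using p_bounds[of \<epsilon> ze x i] p_bounds[of \<epsilon> z x i] by linarith
        have a_le: "\<bar>?a x\<bar> \<le> B * \<bar>p \<epsilon> ze x i - p \<epsilon> z x i\<bar>" if "x \<in> X" for x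
          using f_bound[OF that] by (simp add: abs_mult mult_right_mono)
        have Bpd: "B * \<bar>p \<epsilon> ze x i - p \<epsilon> z x i\<bar> \<le> B" for x
          using B pd mult_left_mono[of _ 1 B] by simp
        have ia: "integrable P ?a"
          using order_trans[OF a_le Bpd] by (intro integrable_bounded[of _ B]) auto
        have "?b = (\<lambda>x. ?d i x - ?a x)" by (simp add: fun_eq_iff algebra_simps)
        then have ib: "integrable P ?b" using d_int ia by simp
        have "expectation (?d i) = expectation (\<lambda>x. ?a x + ?b x)" by (simp add: algebra_simps)
        also have "\<dots> = expectation ?a + expectation ?b" by (rule Bochner_Integration.integral_add[OF ia ib])
        also have "\<dots> \<le> B * (K2 * \<delta>) + K1 * \<epsilon> powr (1 + \<alpha>)"
        proof (rule add_mono)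
          have "\<bar>expectation ?a\<bar> \<le> expectation (\<lambda>x. B * \<bar>p \<epsilon> ze x i - p \<epsilon> z x i\<bar>)"
            by (rule integral_abs_le[OF _ _ a_le Bpd]) auto
          also have "\<dots> \<le> B * (K2 * \<delta>)"
            using K2(2)[OF \<epsilon>(1) \<delta>2 \<delta>, of i] B by (simp add: mult_left_mono)
          finally show "expectation ?a \<le> B * (K2 * \<delta>)" by linarith
          show "expectation ?b \<le> K1 * \<epsilon> powr (1 + \<alpha>)"
            using K1(2)[OF adm gz \<epsilon>, of i i] by linarith
        qed
        also have "\<dots> = (B * (K2 * (N * K)) + K1) * \<epsilon> powr (1 + \<alpha>)" by (simp add: \<delta>_def algebra_simps)
        finally show ?thesis .
      qed
      then have "(\<Sum>i\<in>UNIV. expectation (?d i)) \<le> (\<Sum>i\<in>(UNIV::'n set). (B * (K2 * (N * K)) + K1) * \<epsilon> powr (1 + \<alpha>))"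
        by (rule sum_mono)
      also have "\<dots> = C1 * \<epsilon> powr (1 + \<alpha>)" by (simp add: C1_def N_def)
      also have "\<dots> \<le> C * \<epsilon> powr (1 + \<alpha>)" using C by (intro mult_right_mono) auto
      finally show ?thesis .
    next
      case False
      have "1 \<le> (K * \<epsilon> powr \<alpha>) powr ((1 + \<alpha>) / \<alpha>)"
        using False \<alpha>_pos by (intro ge_one_powr_ge_zero) auto
      also have "\<dots> = K powr ((1 + \<alpha>) / \<alpha>) * \<epsilon> powr (1 + \<alpha>)"
        using K \<alpha>_pos by (simp add: powr_mult powr_powr)
      finally have one: "1 \<le> K powr ((1 + \<alpha>) / \<alpha>) * \<epsilon> powr (1 + \<alpha>)" .
      have "expectation (?d i) \<le> 2 * B" for i
      proof -
        have "\<bar>expectation (?d i)\<bar> \<le> expectation (\<lambda>x. 2 * B)"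
          by (rule integral_abs_le[OF _ _ d_bound order_refl]) auto
        then show ?thesis by simp
      qed
      then have "(\<Sum>i\<in>UNIV. expectation (?d i)) \<le> (\<Sum>i\<in>(UNIV::'n set). 2 * B)" by (rule sum_mono)
      also have "\<dots> = 2 * N * B * 1" by (simp add: N_def)
      also have "\<dots> \<le> 2 * N * B * (K powr ((1 + \<alpha>) / \<alpha>) * \<epsilon> powr (1 + \<alpha>))"
        using one N B by (intro mult_left_mono) auto
      also have "\<dots> = C2 * \<epsilon> powr (1 + \<alpha>)" by (simp add: C2_def)
      also have "\<dots> \<le> C * \<epsilon> powr (1 + \<alpha>)" using C by (intro mult_right_mono) auto
      finally show ?thesis .
    qed
    then show ?thesis unfolding eq .
  qed
  then show ?thesis using C by blast
qed

end

section \<open>Hoelder test functions and the dual norm\<close>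

lemma holder_norm_on_le_1D:
  fixes \<phi> :: "'a::real_normed_vector \<Rightarrow> 'b::real_normed_vector"
  assumes "holder_norm_on \<alpha> X \<phi> \<le> 1"
  shows "x \<in> X \<Longrightarrow> norm (\<phi> x) \<le> 1"
    and "x \<in> X \<Longrightarrow> x' \<in> X \<Longrightarrow> norm (\<phi> x - \<phi> x') \<le> norm (x - x') powr \<alpha>"
proof -
  let ?H = "SUP (x, x') \<in> {(x, x'). x \<in> X \<and> x' \<in> X \<and> x \<noteq> x'}. ennreal (norm (\<phi> x - \<phi> x') / norm (x - x') powr \<alpha>)"
  have le: "sup_norm_on X \<phi> + ?H \<le> 1" using assms by (simp add: holder_norm_on_def)
  have s: "sup_norm_on X \<phi> \<le> 1" and h: "?H \<le> 1"
    by (rule order_trans[OF _ le], rule add_increasing2, simp, rule order_refl)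
      (rule order_trans[OF _ le], rule add_increasing, simp, rule order_refl)
  show "norm (\<phi> x) \<le> 1" if "x \<in> X" for x
  proof -
    have "ennreal (norm (\<phi> x)) \<le> sup_norm_on X \<phi>" unfolding sup_norm_on_def using that by (rule SUP_upper)
    then have "ennreal (norm (\<phi> x)) \<le> 1" using s by (rule order_trans)
    then show ?thesis by simp
  qed
  show "norm (\<phi> x - \<phi> x') \<le> norm (x - x') powr \<alpha>" if "x \<in> X" "x' \<in> X" for x x'
  proof (cases "x = x'")
    case False
    have "ennreal (norm (\<phi> x - \<phi> x') / norm (x - x') powr \<alpha>) \<le> ?H"
      using that False by (intro SUP_upper2[of "(x, x')"]) auto
    then have "ennreal (norm (\<phi> x - \<phi> x') / norm (x - x') powr \<alpha>) \<le> 1" using h by (rule order_trans)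
    then show ?thesis using False by (simp add: divide_le_eq)
  qed simp
qed

text \<open>Test functions come without a measurability assumption; continuity on \<open>X\<close>
  makes their cut-off to \<open>X\<close> Borel.\<close>

lemma holder_continuous_on:
  fixes \<phi> :: "'a::real_normed_vector \<Rightarrow> 'b::real_normed_vector"
  assumes "0 < \<alpha>" and h: "\<And>x x'. x \<in> X \<Longrightarrow> x' \<in> X \<Longrightarrow> norm (\<phi> x - \<phi> x') \<le> norm (x - x') powr \<alpha>"
  shows "continuous_on X \<phi>"
  unfolding continuous_on_iff
proof (intro ballI allI impI)
  fix x and e :: real assume x: "x \<in> X" and e: "0 < e"
  show "\<exists>d>0. \<forall>x'\<in>X. dist x' x < d \<longrightarrow> dist (\<phi> x') (\<phi> x) < e"
  proof (intro exI[of _ "e powr (1 / \<alpha>)"] conjI ballI impI)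
    fix x' assume x': "x' \<in> X" "dist x' x < e powr (1 / \<alpha>)"
    have "norm (x' - x) powr \<alpha> < (e powr (1 / \<alpha>)) powr \<alpha>"
      using x' assms(1) by (intro powr_less_mono2) (auto simp: dist_norm)
    also have "\<dots> = e" using e assms(1) by (simp add: powr_powr)
    finally show "dist (\<phi> x') (\<phi> x) < e" using h[OF x'(1) x] by (simp add: dist_norm)
  qed (use e in simp)
qed

theorem corollary1:
  fixes \<alpha> c0 :: real
    and P :: "(real^'d) measure"
    and X :: "(real^'d) set"
    and \<rho> :: "real^'d \<Rightarrow> real"
    and y :: "'n::finite \<Rightarrow> real^'d"
  assumes "0 < \<alpha>" and "\<alpha> \<le> 1"
    and "prob_space P"
    and "compact X" and "convex X" and "interior X \<noteq> {}"
    and "measure_support P = X"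
    and "\<rho> \<in> borel_measurable borel" and "\<And>x. 0 \<le> \<rho> x"
    and "P = density lborel (\<lambda>x. ennreal (\<rho> x))"
    and "\<exists>L. L-lipschitz_on X \<rho>" and "\<And>x. x \<in> X \<Longrightarrow> 0 < \<rho> x"
    and "inj y"
    and "0 < c0" and "c0 < 1"
  shows "\<exists>C>0. \<forall>Q :: (real^'d) measure.
           prob_space Q \<and> sets Q = sets borel \<and> measure_support Q = range y \<and>
           (\<forall>i. c0 \<le> measure Q {y i}) \<longrightarrow>
           (\<forall>\<epsilon>. 0 < \<epsilon> \<and> \<epsilon> < 1 \<longrightarrow>
              holder_dual_norm \<alpha> X
                (L2_functional P X (\<lambda>x. entropic_map P Q y \<epsilon> x - brenier_map P X Q y x))
              \<le> ereal (C * max (\<epsilon> powr (1 + \<alpha>)) (\<epsilon>\<^sup>2 * (ln (1 / \<epsilon>)) ^ 3)))"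
proof -
  have "sets P = sets borel" by (simp add: assms(10))
  then have aeX: "AE x in P. x \<in> X" using AE_measure_support[of P] assms(7) by simp
  interpret semidiscrete P X \<rho> y \<alpha> c0
    by (intro semidiscrete.intro semidiscrete_axioms.intro) (fact assms aeX)+
  obtain C where C: "C > 0" "\<And>(Q :: (real^'d) measure) \<epsilon> (\<phi> :: real^'d \<Rightarrow> real^'d).
    (\<Sum>i\<in>UNIV. measure Q {y i}) = 1 \<Longrightarrow> (\<forall>i. c0 \<le> measure Q {y i}) \<Longrightarrow> 0 < \<epsilon> \<Longrightarrow> \<epsilon> < 1 \<Longrightarrow>
    \<phi> \<in> borel_measurable borel \<Longrightarrow> (\<forall>x\<in>X. norm (\<phi> x) \<le> 1) \<Longrightarrow>
    (\<forall>x\<in>X. \<forall>x'\<in>X. norm (\<phi> x - \<phi> x') \<le> norm (x - x') powr \<alpha>) \<Longrightarrow>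
    expectation (\<lambda>x. \<phi> x \<bullet> (entropic_map P Q y \<epsilon> x - brenier_map P X Q y x)) \<le> C * \<epsilon> powr (1 + \<alpha>)"
    using map_distance by blast
  show ?thesis
  proof (intro exI[of _ C] conjI C(1) allI impI, elim conjE)
    fix Q :: "(real^'d) measure" and \<epsilon> :: real
    assume Q: "prob_space Q" "sets Q = sets borel" "measure_support Q = range y" "\<forall>i. c0 \<le> measure Q {y i}"
      and \<epsilon>: "0 < \<epsilon>" "\<epsilon> < 1"
    interpret Q: prob_space Q by fact
    have ae: "AE x in Q. x \<in> range y" using AE_measure_support[OF Q(2)] Q(3) by simp
    have range_sets: "range y \<in> sets Q" unfolding Q(2) by (intro borel_closed finite_imp_closed) simp
    have "measure Q (range y) = 1" by (rule iffD2[OF Q.prob_eq_1[OF range_sets] ae])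
    moreover have "measure Q (\<Union>i\<in>UNIV. {y i}) = (\<Sum>i\<in>UNIV. measure Q {y i})"
    proof (rule Q.finite_measure_finite_Union)
      show "disjoint_family_on (\<lambda>i. {y i}) UNIV"
        using injD[OF assms(13)] by (fastforce simp: disjoint_family_on_def)
      show "range (\<lambda>i. {y i}) \<subseteq> sets Q" unfolding Q(2) by auto
    qed simp
    then have "measure Q (range y) = (\<Sum>i\<in>UNIV. measure Q {y i})" by (simp only: UNION_singleton_eq_range)
    ultimately have q1: "(\<Sum>i\<in>UNIV. measure Q {y i}) = 1" by simp
    show "holder_dual_norm \<alpha> X (L2_functional P X (\<lambda>x. entropic_map P Q y \<epsilon> x - brenier_map P X Q y x))
      \<le> ereal (C * max (\<epsilon> powr (1 + \<alpha>)) (\<epsilon>\<^sup>2 * (ln (1 / \<epsilon>)) ^ 3))"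
      unfolding holder_dual_norm_def
    proof (rule SUP_least)
      fix \<phi> :: "real^'d \<Rightarrow> real^'d" assume "\<phi> \<in> {\<phi>. holder_norm_on \<alpha> X \<phi> \<le> 1}"
      then have \<phi>: "holder_norm_on \<alpha> X \<phi> \<le> 1" by simp
      note \<phi>D = holder_norm_on_le_1D[OF \<phi>]
      \<comment> \<open>The Hoelder norm controls \<open>\<phi>\<close> on \<open>X\<close> only.
        Cutting it off there gives a Borel field with the same pairing.\<close>
      define \<psi> where "\<psi> x = indicator X x *\<^sub>R \<phi> x" for x
      have "L2_functional P X (\<lambda>x. entropic_map P Q y \<epsilon> x - brenier_map P X Q y x) \<phi>
        = expectation (\<lambda>x. \<psi> x \<bullet> (entropic_map P Q y \<epsilon> x - brenier_map P X Q y x))"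
        by (simp add: L2_functional_def set_lebesgue_integral_def \<psi>_def)
      also have "\<dots> \<le> C * \<epsilon> powr (1 + \<alpha>)"
      proof (rule C(2)[OF q1 Q(4) \<epsilon>])
        show "\<psi> \<in> borel_measurable borel"
          unfolding \<psi>_def using holder_continuous_on[OF assms(1) \<phi>D(2)] X_borel
          by (intro borel_measurable_continuous_on_indicator) auto
      qed (use \<phi>D in \<open>auto simp: \<psi>_def\<close>)
      also have "\<dots> \<le> C * max (\<epsilon> powr (1 + \<alpha>)) (\<epsilon>\<^sup>2 * (ln (1 / \<epsilon>)) ^ 3)"
        using C(1) by (intro mult_left_mono) auto
      finally show "ereal (L2_functional P X (\<lambda>x. entropic_map P Q y \<epsilon> x - brenier_map P X Q y x) \<phi>)
        \<le> ereal (C * max (\<epsilon> powr (1 + \<alpha>)) (\<epsilon>\<^sup>2 * (ln (1 / \<epsilon>)) ^ 3))"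
        by (subst ereal_less_eq)
    qed
  qed
qed

end
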